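(* Let $J$ be a bounded half-line Jacobi matrix with coefficients $a(n),b(n)$, and let $w_\pm^{(N)}$, $g_N$, $d\nu_N$, $dk_N$ be the associated objects defined in the context. Fix a sequence $N_j\to\infty$, and consider the following statements: (WP) $w_+^{(N_j)}(z) \to w_+(z)$ uniformly on compact subsets of $\mathbb{C}^+$, for some $w_+\in\mathcal{H}$. (WM) $w_-^{(N_j)}(z) \to w_-(z)$ uniformly on compact subsets of $\mathbb{C}^+$, for some $w_-\in\mathcal{H}$. (G) $g_{N_j}(z)\to g(z)$ uniformly on compact subsets of $\mathbb{C}^+$, for some $g\in\mathcal{H}$. (N) $d\nu_{N_j}\to d\nu$ in weak $*$ sense, for some probability (Borel) measure $\nu$ on $\mathbb{R}$. (K) $dk_{N_j}\to d\widetilde{k}$ in weak $*$ sense, for some probability (Borel) measure $d\widetilde{k}$ on $\mathbb{R}$. (A) $\left( a(1) \cdots a(N_j) \right)^{1/N_j}\to A$, for some $A>0$. Then (WP)$\iff$(WM) and (G)$\iff$(N)$\iff$(K). Moreover, (WP) or (WM) implies (G), (N), (K) and also (A). Conversely, if (A) holds, then each of (G), (N), (K) implies (WP), (WM).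
   Context: $\mathcal{H}$ is the set of Herglotz functions, i.e. holomorphic maps of $\mathbb{C}^+=\{z\in\mathbb{C}:\operatorname{Im}z>0\}$ to itself. $J$ is a half-line Jacobi matrix on $\ell_2(\mathbb{Z}_+)$, $\mathbb{Z}_+=\{1,2,\dots\}$: $(Ju)(n)=a(n)u(n+1)+a(n-1)u(n-1)+b(n)u(n)$ (term with $u(n-1)$ omitted for $n=1$), with real coefficients satisfying $(M+1)^{-1}\le a(n)\le M+1$, $|b(n)|\le M$ for some $M>0$. Put $a(0)=1$. For $z\in\mathbb{C}^+$ let $f_\pm(n,z)$ be the solutions of $a(n)f(n+1)+a(n-1)f(n-1)+b(n)f(n)=zf(n)$ ($n\ge1$) with $f_-(0,z)=0$, $f_-(1,z)=1$, $f_+(0,z)=1$, $f_+(1,z)=-m_+(z)$, where $m_+(z)=\langle\delta_1,(J-z)^{-1}\delta_1\rangle$. Then $f_\pm(n,z)\ne0$ for $n\ge1$ and $m_\pm(n,z)=\mp \frac{f_\pm(n+1,z)}{a(n)f_\pm(n,z)}$ are Herglotz functions. With the logarithm satisfying $\operatorname{Im}\ln\zeta\in(0,\pi)$ for $\zeta\in\mathbb{C}^+$, put $$w_\pm^{(N)}(z)=\frac1N\sum_{n=1}^N\ln\left[a(n)m_\pm(n,z)\right],\qquad g_N(z)=\frac1N\sum_{n=1}^N\langle\delta_n,(J-z)^{-1}\delta_n\rangle=\int_{\mathbb{R}}\frac{d\nu_N(t)}{t-z},$$ where $d\nu_N(t)=\frac1N\sum_{n=1}^N d\|E(t)\delta_n\|^2$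 and $E$ is the spectral resolution of $J$. Finally $dk_N=\frac1N\sum_{n=1}^N\delta_{\lambda_n^{(N)}}$, where $\lambda_1^{(N)},\dots,\lambda_N^{(N)}$ are the eigenvalues of the truncation of $J$ to $\ell_2(\{1,\dots,N\})$ with boundary conditions $u(0)=u(N+1)=0$. *)

theory Defs
  imports "HOL-Complex_Analysis.Complex_Analysis" "HOL-Probability.Probability"
begin

abbreviation upper_half_plane :: "complex set"
  where "upper_half_plane \<equiv> {z. Im z > 0}"

definition herglotz :: "(complex \<Rightarrow> complex) set" where
  "herglotz = {h. h holomorphic_on upper_half_plane \<and>
                  (\<forall>z\<in>upper_half_plane. h z \<in> upper_half_plane)}"


subsection \<open>The Hilbert space of square summable sequences over the positive integers\<close>

text \<open>A sequence indexed by 1, 2, ... is a function on \<open>nat\<close> whose (irrelevant) value at 0 is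
  normalised to 0.\<close>

definition ell2 :: "(nat \<Rightarrow> complex) set" where
  "ell2 = {u. u 0 = 0 \<and> summable (\<lambda>n. (cmod (u n))\<^sup>2)}"

definition ell2_inner :: "(nat \<Rightarrow> complex) \<Rightarrow> (nat \<Rightarrow> complex) \<Rightarrow> complex" where
  "ell2_inner u v = (\<Sum>n. cnj (u n) * v n)"

definition ell2_norm :: "(nat \<Rightarrow> complex) \<Rightarrow> real" where
  "ell2_norm u = sqrt (\<Sum>n. (cmod (u n))\<^sup>2)"

definition delta :: "nat \<Rightarrow> nat \<Rightarrow> complex" where
  "delta n = (\<lambda>k. if k = n then 1 else 0)"

definition orthogonal_projection :: "((nat \<Rightarrow> complex) \<Rightarrow> (nat \<Rightarrow> complex)) \<Rightarrow> bool" where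
  "orthogonal_projection P \<longleftrightarrow>
     (\<forall>u\<in>ell2. P u \<in> ell2) \<and>
     (\<forall>u\<in>ell2. \<forall>v\<in>ell2. \<forall>c d. P (\<lambda>n. c * u n + d * v n) = (\<lambda>n. c * P u n + d * P v n)) \<and>
     (\<forall>u\<in>ell2. P (P u) = P u) \<and>
     (\<forall>u\<in>ell2. \<forall>v\<in>ell2. ell2_inner (P u) v = ell2_inner u (P v))"

text \<open>\<open>E\<close> is a resolution of the identity (increasing, strongly right-continuous, with strong
  limits 0 and 1 at the two ends) and \<open>T\<close> is the integral of \<open>t\<close> against \<open>dE(t)\<close>. The latter is
  expressed by quadratic forms, which by polarization determine the everywhere defined
  operator \<open>T\<close>.\<close>

definition spectral_resolution ::
  "((nat \<Rightarrow> complex) \<Rightarrow> (nat \<Rightarrow> complex)) \<Rightarrow> (real \<Rightarrow> (nat \<Rightarrow> complex) \<Rightarrow> (nat \<Rightarrow> complex)) \<Rightarrow> bool"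
where
  "spectral_resolution T E \<longleftrightarrow>
     (\<forall>t. orthogonal_projection (E t)) \<and>
     (\<forall>u\<in>ell2. \<forall>s t. E s (E t u) = E (min s t) u) \<and>
     (\<forall>u\<in>ell2. \<forall>t. ((\<lambda>s. ell2_norm (\<lambda>n. E s u n - E t u n)) \<longlongrightarrow> 0) (at_right t)) \<and>
     (\<forall>u\<in>ell2. ((\<lambda>t. ell2_norm (E t u)) \<longlongrightarrow> 0) at_bot) \<and>
     (\<forall>u\<in>ell2. ((\<lambda>t. ell2_norm (\<lambda>n. E t u n - u n)) \<longlongrightarrow> 0) at_top) \<and>
     (\<forall>u\<in>ell2.
        integrable (interval_measure (\<lambda>t. (ell2_norm (E t u))\<^sup>2)) (\<lambda>t. t) \<and>
        ell2_inner u (T u) =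
          complex_of_real (\<integral>t. t \<partial>interval_measure (\<lambda>t. (ell2_norm (E t u))\<^sup>2)))"


subsection \<open>Half-line Jacobi matrices\<close>

definition jacobi ::
  "(nat \<Rightarrow> real) \<Rightarrow> (nat \<Rightarrow> real) \<Rightarrow> (nat \<Rightarrow> complex) \<Rightarrow> nat \<Rightarrow> complex" where
  "jacobi a b u n =
     (if n = 0 then 0
      else of_real (a n) * u (n + 1)
           + (if n = 1 then 0 else of_real (a (n - 1)) * u (n - 1))
           + of_real (b n) * u n)"

definition resolvent ::
  "(nat \<Rightarrow> real) \<Rightarrow> (nat \<Rightarrow> real) \<Rightarrow> complex \<Rightarrow> (nat \<Rightarrow> complex) \<Rightarrow> (nat \<Rightarrow> complex)" where
  "resolvent a b z = inv_into ell2 (\<lambda>u n. jacobi a b u n - z * u n)"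

definition green :: "(nat \<Rightarrow> real) \<Rightarrow> (nat \<Rightarrow> real) \<Rightarrow> nat \<Rightarrow> complex \<Rightarrow> complex" where
  "green a b n z = ell2_inner (delta n) (resolvent a b z (delta n))"

definition difference_equation ::
  "(nat \<Rightarrow> real) \<Rightarrow> (nat \<Rightarrow> real) \<Rightarrow> complex \<Rightarrow> (nat \<Rightarrow> complex) \<Rightarrow> nat \<Rightarrow> bool" where
  "difference_equation a b z f n \<longleftrightarrow>
     of_real (a n) * f (n + 1) + of_real (a (n - 1)) * f (n - 1) + of_real (b n) * f n = z * f n"

text \<open>Here \<open>green a b 1\<close> is the function \<open>m\<^sub>+\<close> of the operator. Both solutions
  exist and are unique as soon as \<open>a n\<close> never vanishes for \<open>n\<close> at least 1.\<close>

definition f_minus :: "(nat \<Rightarrow> real) \<Rightarrow> (nat \<Rightarrow> real) \<Rightarrow> nat \<Rightarrow> complex \<Rightarrow> complex" where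
  "f_minus a b n z =
     (THE f. (\<forall>k\<ge>1. difference_equation a b z f k) \<and> f 0 = 0 \<and> f 1 = 1) n"

definition f_plus :: "(nat \<Rightarrow> real) \<Rightarrow> (nat \<Rightarrow> real) \<Rightarrow> nat \<Rightarrow> complex \<Rightarrow> complex" where
  "f_plus a b n z =
     (THE f. (\<forall>k\<ge>1. difference_equation a b z f k) \<and> f 0 = 1 \<and> f 1 = - green a b 1 z) n"

definition m_plus :: "(nat \<Rightarrow> real) \<Rightarrow> (nat \<Rightarrow> real) \<Rightarrow> nat \<Rightarrow> complex \<Rightarrow> complex" where
  "m_plus a b n z = - (f_plus a b (n + 1) z / (of_real (a n) * f_plus a b n z))"

definition m_minus :: "(nat \<Rightarrow> real) \<Rightarrow> (nat \<Rightarrow> real) \<Rightarrow> nat \<Rightarrow> complex \<Rightarrow> complex" where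
  "m_minus a b n z = f_minus a b (n + 1) z / (of_real (a n) * f_minus a b n z)"

text \<open>The principal branch \<open>Ln\<close> has imaginary part in \<open>(0, pi)\<close> on the upper half-plane.\<close>

definition w_plus :: "(nat \<Rightarrow> real) \<Rightarrow> (nat \<Rightarrow> real) \<Rightarrow> nat \<Rightarrow> complex \<Rightarrow> complex" where
  "w_plus a b N z = (\<Sum>n=1..N. Ln (of_real (a n) * m_plus a b n z)) / of_nat N"

definition w_minus :: "(nat \<Rightarrow> real) \<Rightarrow> (nat \<Rightarrow> real) \<Rightarrow> nat \<Rightarrow> complex \<Rightarrow> complex" where
  "w_minus a b N z = (\<Sum>n=1..N. Ln (of_real (a n) * m_minus a b n z)) / of_nat N"

definition g_avg :: "(nat \<Rightarrow> real) \<Rightarrow> (nat \<Rightarrow> real) \<Rightarrow> nat \<Rightarrow> complex \<Rightarrow> complex" where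
  "g_avg a b N z = (\<Sum>n=1..N. green a b n z) / of_nat N"

definition nu_measure ::
  "(real \<Rightarrow> (nat \<Rightarrow> complex) \<Rightarrow> (nat \<Rightarrow> complex)) \<Rightarrow> nat \<Rightarrow> real measure" where
  "nu_measure E N = interval_measure (\<lambda>t. (\<Sum>n=1..N. (ell2_norm (E t (delta n)))\<^sup>2) / real N)"

definition truncated_eigenvalues :: "(nat \<Rightarrow> real) \<Rightarrow> (nat \<Rightarrow> real) \<Rightarrow> nat \<Rightarrow> real set" where
  "truncated_eigenvalues a b N =
     {x. \<exists>u. u 0 = 0 \<and> u (N + 1) = 0 \<and> (\<exists>n\<in>{1..N}. u n \<noteq> 0) \<and>
             (\<forall>n\<in>{1..N}. difference_equation a b (of_real x) u n)}"

text \<open>The truncation is a real symmetric tridiagonal matrix with nonzero off-diagonal entries, so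
  its \<open>N\<close> eigenvalues are real and simple, and the set of eigenvalues carries no less
  information than the list. The measure gives mass \<open>1 / N\<close> to each of them.\<close>

definition k_measure :: "(nat \<Rightarrow> real) \<Rightarrow> (nat \<Rightarrow> real) \<Rightarrow> nat \<Rightarrow> real measure" where
  "k_measure a b N =
     distr (point_measure (truncated_eigenvalues a b N) (\<lambda>_. ennreal (1 / real N))) borel (\<lambda>t. t)"


subsection \<open>The two modes of convergence\<close>

definition converges_in_herglotz :: "(nat \<Rightarrow> complex \<Rightarrow> complex) \<Rightarrow> bool" where
  "converges_in_herglotz W \<longleftrightarrow>
     (\<exists>w\<in>herglotz. \<forall>K. compact K \<and> K \<subseteq> upper_half_plane \<longrightarrow> uniform_limit K W w sequentially)"

text \<open>Weak-star convergence: finite measures on the line as functionals on the continuous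
  functions vanishing at infinity.\<close>

definition weak_star_conv :: "(nat \<Rightarrow> real measure) \<Rightarrow> real measure \<Rightarrow> bool" where
  "weak_star_conv \<mu>s \<mu> \<longleftrightarrow>
     (\<forall>f::real \<Rightarrow> real. continuous_on UNIV f \<and> (f \<longlongrightarrow> 0) at_infinity \<longrightarrow>
        (\<lambda>j. \<integral>t. f t \<partial>\<mu>s j) \<longlonglongrightarrow> (\<integral>t. f t \<partial>\<mu>))"

definition converges_to_probability :: "(nat \<Rightarrow> real measure) \<Rightarrow> bool" where
  "converges_to_probability \<mu>s \<longleftrightarrow> (\<exists>\<mu>. prob_space \<mu> \<and> sets \<mu> = sets borel \<and> weak_star_conv \<mu>s \<mu>)"

definition cond_WP :: "(nat \<Rightarrow> real) \<Rightarrow> (nat \<Rightarrow> real) \<Rightarrow> (nat \<Rightarrow> nat) \<Rightarrow> bool" where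
  "cond_WP a b N \<longleftrightarrow> converges_in_herglotz (\<lambda>j. w_plus a b (N j))"

definition cond_WM :: "(nat \<Rightarrow> real) \<Rightarrow> (nat \<Rightarrow> real) \<Rightarrow> (nat \<Rightarrow> nat) \<Rightarrow> bool" where
  "cond_WM a b N \<longleftrightarrow> converges_in_herglotz (\<lambda>j. w_minus a b (N j))"

definition cond_G :: "(nat \<Rightarrow> real) \<Rightarrow> (nat \<Rightarrow> real) \<Rightarrow> (nat \<Rightarrow> nat) \<Rightarrow> bool" where
  "cond_G a b N \<longleftrightarrow> converges_in_herglotz (\<lambda>j. g_avg a b (N j))"

definition cond_N ::
  "(real \<Rightarrow> (nat \<Rightarrow> complex) \<Rightarrow> (nat \<Rightarrow> complex)) \<Rightarrow> (nat \<Rightarrow> nat) \<Rightarrow> bool" where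
  "cond_N E N \<longleftrightarrow> converges_to_probability (\<lambda>j. nu_measure E (N j))"

definition cond_K :: "(nat \<Rightarrow> real) \<Rightarrow> (nat \<Rightarrow> real) \<Rightarrow> (nat \<Rightarrow> nat) \<Rightarrow> bool" where
  "cond_K a b N \<longleftrightarrow> converges_to_probability (\<lambda>j. k_measure a b (N j))"

definition cond_A :: "(nat \<Rightarrow> real) \<Rightarrow> (nat \<Rightarrow> nat) \<Rightarrow> bool" where
  "cond_A a N \<longleftrightarrow> (\<exists>A>0. (\<lambda>j. (\<Prod>n=1..N j. a n) powr (1 / real (N j))) \<longlonglongrightarrow> A)"

end

theory Submission
  imports Defs "HOL-Computational_Algebra.Fundamental_Theorem_Algebra"
begin

text \<open>The solution \<open>p\<close> of the difference equation with \<open>p 0 = 0\<close>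
  and \<open>p 1 = 1\<close> links logarithms of \<open>m\<close>-functions to eigenvalues. Its
  value at \<open>N + 1\<close> is the product of the ratios \<open>p (n + 1) / p n = a n *
  m_minus n\<close> for \<open>n \<le> N\<close>, and it is also the characteristic polynomial
  of the truncation divided by \<open>a 1 * \<dots> * a N\<close>. Taking logarithms yields the
  Thouless formula (\<open>log_average_eq\<close>): \<open>w_minus\<close> is the integral of
  \<open>ln (z - t)\<close> against the eigenvalue measure \<open>k\<close>, minus the average
  of \<open>ln (a n)\<close>. The eigenvalue measures live on a fixed bounded interval, so their
  weak-star convergence makes the integral converge; conversely the derivative of
  \<open>w_minus\<close> is minus the Stieltjes transform of \<open>k\<close>. Hence convergence
  of \<open>w_minus\<close> is equivalent to convergence of \<open>k\<close> together with
  convergence of the geometric means of the \<open>a n\<close> to a positive limit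
  (\<open>cond_WM_iff\<close>).

The two averages \<open>w_plus\<close> and \<open>w_minus\<close> determine each other. The
  product \<open>(a n)\<^sup>2 * m_plus n * m_minus n\<close> is minus the quotient of
  consecutive diagonal Green functions, so the sum of the logarithms telescopes and
  \<open>w_plus + w_minus - \<i> * pi\<close> is of order \<open>1 / N\<close>
  (\<open>w_plus_w_minus\<close>), because the Green functions are bounded above and away from 0
  (\<open>green_bounds\<close>).

The averaged Green function is the Stieltjes transform of \<open>\<nu>\<close>
  (\<open>nu_measure_stieltjes\<close>) and differs by \<open>O(1 / N)\<close> from that of
  \<open>k\<close>, because truncation changes the resolvent by an operator of rank one
  (\<open>g_avg_stieltjes_k_measure\<close>). For probability measures on a fixed interval,
  weak-star convergence to a probability measure is the same as convergence of the Stieltjes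
  transforms at every point of the upper half-plane
  (\<open>converges_to_probability_iff_stieltjes\<close>): the transforms determine the limits
  of all moments, and the Weierstrass and Helly theorems do the rest. So the conditions on
  \<open>g\<close>, \<open>\<nu>\<close> and \<open>k\<close> all say that the averaged Green
  functions converge pointwise.

Limits are never on the boundary of the Herglotz class: at each point the imaginary parts of the
  averages are bounded below by a positive number, uniformly in \<open>N\<close>, since the
  \<open>m\<close>-functions stay in a compact subset of the upper half-plane.\<close>

section \<open>Locally uniform convergence on the upper half-plane\<close>

text \<open>A uniform limit of convergent sequences converges. It is used when a quantity is
  only an approximation, uniform along the sequence, of something already known to converge: a
  moment approximated by Stieltjes transforms, an integral approximated by moments.\<close>
lemma convergent_approx:
  fixes x :: "nat \<Rightarrow> 'a::banach"
  assumes "\<And>e. e > 0 \<Longrightarrow> \<exists>y. convergent y \<and> (\<forall>\<^sub>F j in sequentially. norm (x j - y j) \<le> e)"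
  shows "convergent x"
proof -
  have "Cauchy x"
  proof (rule metric_CauchyI)
    fix e :: real assume "e > 0"
    then obtain y where y: "convergent y" "\<forall>\<^sub>F j in sequentially. norm (x j - y j) \<le> e / 4"
      using assms[of "e / 4"] by auto
    obtain n0 where n0: "\<And>j. j \<ge> n0 \<Longrightarrow> norm (x j - y j) \<le> e / 4"
      using y(2) by (auto simp: eventually_sequentially)
    have "Cauchy y" using y(1) by (simp add: convergent_Cauchy)
    then obtain n1 where n1: "\<And>i j. i \<ge> n1 \<Longrightarrow> j \<ge> n1 \<Longrightarrow> dist (y i) (y j) < e / 4"
      using \<open>e > 0\<close> unfolding Cauchy_def by (meson zero_less_divide_iff zero_less_numeral)
    show "\<exists>n. \<forall>i\<ge>n. \<forall>j\<ge>n. dist (x i) (x j) < e"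
    proof (intro exI[of _ "max n0 n1"] allI impI)
      fix i j assume ij: "max n0 n1 \<le> i" "max n0 n1 \<le> j"
      have "dist (x i) (x j) \<le> dist (x i) (y i) + dist (y i) (x j)" by (rule dist_triangle)
      also have "dist (y i) (x j) \<le> dist (y i) (y j) + dist (y j) (x j)" by (rule dist_triangle)
      finally have "dist (x i) (x j) \<le> norm (x i - y i) + dist (y i) (y j) + norm (x j - y j)"
        by (simp add: dist_norm norm_minus_commute)
      then show "dist (x i) (x j) < e"
        using n0[of i] n0[of j] n1[of i j] ij \<open>e > 0\<close> by auto
    qed
  qed
  then show ?thesis by (simp add: Cauchy_convergent)
qed

lemma convergent_eventually_eq:
  "\<forall>\<^sub>F j in sequentially. f j = g j \<Longrightarrow> convergent g \<Longrightarrow> convergent f"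
  by (simp add: convergent_cong)

lemma convergent_Re: "convergent x \<Longrightarrow> convergent (\<lambda>j. Re (x j))"
  unfolding convergent_def by (blast intro: tendsto_Re)

lemma convergent_of_real_sequence: "convergent x \<Longrightarrow> convergent (\<lambda>j. complex_of_real (x j))"
  unfolding convergent_def by (blast intro: tendsto_of_real)

lemma compact_upper_half_plane_Im_bound:
  assumes "compact K" "K \<subseteq> upper_half_plane"
  shows "\<exists>e>0. \<forall>z\<in>K. e \<le> Im z"
proof (cases "K = {}")
  case False
  have "continuous_on K Im" by (intro continuous_intros)
  then obtain x where "x \<in> K" "\<forall>y\<in>K. Im x \<le> Im y"
    using continuous_attains_inf[OF assms(1) False] by blast
  then show ?thesis using assms(2) by (intro exI[of _ "Im x"]) auto
qed (auto intro: exI[of _ 1])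

lemma open_upper_half_plane: "open upper_half_plane"
  by (simp add: open_halfspace_Im_gt)

text \<open>This is convergence in the Herglotz class without the requirement on the imaginary
  part of the limit. The requirement is split off because it never has to be assumed: all
  averages in question have imaginary parts bounded below by a positive number that depends only
  on the point.\<close>
definition converges_holomorphically :: "(nat \<Rightarrow> complex \<Rightarrow> complex) \<Rightarrow> bool" where
  "converges_holomorphically W \<longleftrightarrow>
     (\<exists>w. w holomorphic_on upper_half_plane \<and>
       (\<forall>K. compact K \<and> K \<subseteq> upper_half_plane \<longrightarrow> uniform_limit K W w sequentially))"

lemma converges_in_herglotz_imp_holomorphically:
  "converges_in_herglotz W \<Longrightarrow> converges_holomorphically W"
  unfolding converges_in_herglotz_def converges_holomorphically_def herglotz_def by blast

text \<open>Functions with a common Lipschitz constant on every half-plane \<open>Im z \<ge>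
  e\<close> are equicontinuous on compact sets, so for them pointwise convergence is already
  locally uniform, and the limit inherits holomorphy.\<close>
lemma converges_holomorphically_pointwise:
  fixes h :: "nat \<Rightarrow> complex \<Rightarrow> complex"
  assumes hol: "\<And>j. h j holomorphic_on upper_half_plane"
    and lip: "\<And>e. e > 0 \<Longrightarrow> \<exists>B. \<forall>j z w. e \<le> Im z \<longrightarrow> e \<le> Im w \<longrightarrow>
                cmod (h j z - h j w) \<le> B * cmod (z - w)"
    and conv: "\<And>z. Im z > 0 \<Longrightarrow> convergent (\<lambda>j. h j z)"
  shows "converges_holomorphically h"
proof -
  define g where "g z = lim (\<lambda>j. h j z)" for z
  have hg: "(\<lambda>j. h j z) \<longlonglongrightarrow> g z" if "Im z > 0" for z
    using conv[OF that] by (simp add: g_def convergent_LIMSEQ_iff)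
  have unif: "uniform_limit K h g sequentially" if K: "compact K" "K \<subseteq> upper_half_plane" for K
  proof (rule uniform_limitI)
    fix r :: real assume "r > 0"
    obtain e where e: "e > 0" "\<forall>z\<in>K. e \<le> Im z"
      using compact_upper_half_plane_Im_bound[OF K] by blast
    obtain B0 where B0: "\<forall>j z w. e \<le> Im z \<longrightarrow> e \<le> Im w \<longrightarrow> cmod (h j z - h j w) \<le> B0 * cmod (z - w)"
      using lip[OF e(1)] by blast
    define B where "B = \<bar>B0\<bar> + 1"
    have "B > 0" by (simp add: B_def)
    have B: "cmod (h j z - h j w) \<le> B * cmod (z - w)" if "z \<in> K" "w \<in> K" for j z w
    proof -
      have "cmod (h j z - h j w) \<le> B0 * cmod (z - w)" using B0 e(2) that by blast
      also have "\<dots> \<le> B * cmod (z - w)" by (intro mult_right_mono) (auto simp: B_def)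
      finally show ?thesis .
    qed
    have Bg: "cmod (g z - g w) \<le> B * cmod (z - w)" if "z \<in> K" "w \<in> K" for z w
    proof (rule tendsto_upperbound)
      show "(\<lambda>j. cmod (h j z - h j w)) \<longlonglongrightarrow> cmod (g z - g w)"
        using that K(2) by (intro tendsto_intros hg) auto
      show "\<forall>\<^sub>F j in sequentially. cmod (h j z - h j w) \<le> B * cmod (z - w)"
        using B[OF that] by simp
    qed simp
    \<comment> \<open>Two Lipschitz errors of \<open>r / 4\<close> each and \<open>r / 2\<close> at the centre of a ball.\<close>
    define d where "d = r / (4 * B)"
    have "d > 0" using \<open>r > 0\<close> \<open>B > 0\<close> by (simp add: d_def)
    have "\<exists>F\<subseteq>K. finite F \<and> K \<subseteq> (\<Union>x\<in>F. ball x d)"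
      using compactE_image[OF K(1), of K "\<lambda>x. ball x d"] \<open>d > 0\<close>
      by (metis UN_I centre_in_ball open_ball subsetI)
    then obtain F where F: "F \<subseteq> K" "finite F" "K \<subseteq> (\<Union>x\<in>F. ball x d)" by blast
    have "\<forall>\<^sub>F j in sequentially. \<forall>x\<in>F. dist (h j x) (g x) < r / 2"
    proof (intro eventually_ball_finite F(2) ballI)
      fix x assume "x \<in> F"
      then have "Im x > 0" using F(1) K(2) by auto
      then show "\<forall>\<^sub>F j in sequentially. dist (h j x) (g x) < r / 2"
        using tendstoD[OF hg, of x "r / 2"] \<open>r > 0\<close> by simp
    qed
    then show "\<forall>\<^sub>F j in sequentially. \<forall>z\<in>K. dist (h j z) (g z) < r"
    proof (eventually_elim, intro ballI)
      fix j z assume j: "\<forall>x\<in>F. dist (h j x) (g x) < r / 2" and "z \<in> K"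
      then obtain x where x: "x \<in> F" "dist x z < d" using F(3) by auto
      then have "x \<in> K" using F(1) by auto
      have Bd: "B * cmod (z - x) \<le> r / 4"
      proof -
        have "B * cmod (z - x) \<le> B * d"
          using x(2) \<open>B > 0\<close> by (intro mult_left_mono) (auto simp: dist_norm norm_minus_commute)
        also have "\<dots> = r / 4" using \<open>B > 0\<close> by (simp add: d_def)
        finally show ?thesis .
      qed
      have "dist (h j z) (g z) \<le> dist (h j z) (h j x) + dist (h j x) (g x) + dist (g x) (g z)"
        using dist_triangle[of "h j z" "g z" "h j x"] dist_triangle[of "h j x" "g z" "g x"] by linarith
      moreover have "dist (h j z) (h j x) \<le> r / 4"
        using B[OF \<open>z \<in> K\<close> \<open>x \<in> K\<close>, of j] Bd by (simp add: dist_norm)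
      moreover have "dist (g x) (g z) \<le> r / 4"
        using Bg[OF \<open>z \<in> K\<close> \<open>x \<in> K\<close>] Bd by (simp add: dist_norm norm_minus_commute)
      moreover have "dist (h j x) (g x) < r / 2" using j x by blast
      ultimately show "dist (h j z) (g z) < r" by linarith
    qed
  qed
  have "g holomorphic_on upper_half_plane"
  proof (rule holomorphic_uniform_sequence[OF open_upper_half_plane hol])
    fix x assume "x \<in> upper_half_plane"
    then obtain d where "d > 0" "cball x d \<subseteq> upper_half_plane"
      using open_contains_cball open_upper_half_plane by meson
    then show "\<exists>d>0. cball x d \<subseteq> upper_half_plane \<and> uniform_limit (cball x d) h g sequentially"
      using unif by auto
  qed
  then show ?thesis unfolding converges_holomorphically_def using unif by blast
qed

lemma converges_holomorphically_imp_convergent: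
  assumes "converges_holomorphically W" "Im z > 0"
  shows "convergent (\<lambda>j. W j z)"
proof -
  obtain w where "\<forall>K. compact K \<and> K \<subseteq> upper_half_plane \<longrightarrow> uniform_limit K W w sequentially"
    using assms(1) by (auto simp: converges_holomorphically_def)
  then have "uniform_limit {z} W w sequentially" using assms(2) by (simp del: uniform_limit_singleton)
  from tendsto_uniform_limitI[OF this singletonI] show ?thesis by (auto simp: convergent_def)
qed

lemma converges_holomorphically_derivative:
  assumes conv: "converges_holomorphically W" and z: "Im z > 0"
    and der: "\<forall>\<^sub>F j in sequentially. \<forall>z. Im z > 0 \<longrightarrow> (W j has_field_derivative W' j z) (at z)"
  shows "convergent (\<lambda>j. W' j z)"
proof -
  obtain w where w: "\<forall>K. compact K \<and> K \<subseteq> upper_half_plane \<longrightarrow> uniform_limit K W w sequentially"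
    using conv unfolding converges_holomorphically_def by blast
  have z': "z \<in> upper_half_plane" using z by simp
  obtain r where r: "r > 0" "cball z r \<subseteq> upper_half_plane"
    using open_upper_half_plane z' unfolding open_contains_cball by blast
  have sub: "ball z r \<subseteq> upper_half_plane" using ball_subset_cball r(2) by (rule order_trans)
  have "uniform_limit (cball z r) W w sequentially" using w r(2) by simp
  then have "uniform_limit (ball z r) W w sequentially"
    by (rule uniform_limit_on_subset) (rule ball_subset_cball)
  moreover have "\<forall>\<^sub>F j in sequentially. W j holomorphic_on ball z r"
    using der
  proof eventually_elim
    case (elim j)
    have "\<exists>f'. (W j has_field_derivative f') (at x)" if "x \<in> ball z r" for x
    proof
      have "x \<in> upper_half_plane" using sub that by (rule subsetD)
      then show "(W j has_field_derivative W' j x) (at x)" using elim by simp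
    qed
    then show ?case by (simp add: holomorphic_on_open)
  qed
  moreover have "z \<in> ball z r" using r(1) by simp
  ultimately have "(\<lambda>j. deriv (W j) z) \<longlonglongrightarrow> deriv w z"
    by (rule deriv_complex_uniform_limit[OF _ _ sequentially_bot open_ball])
  then have "convergent (\<lambda>j. deriv (W j) z)" unfolding convergent_def ..
  moreover have "\<forall>\<^sub>F j in sequentially. W' j z = deriv (W j) z"
    using der
  proof eventually_elim
    case (elim j)
    then have "(W j has_field_derivative W' j z) (at z)" using z by simp
    then show ?case by (rule DERIV_imp_deriv[symmetric])
  qed
  ultimately show ?thesis by (rule convergent_eventually_eq[rotated])
qed

lemma uniform_limit_null_comparison:
  fixes f :: "nat \<Rightarrow> complex \<Rightarrow> complex"
  assumes "c \<longlonglongrightarrow> 0" "\<forall>\<^sub>F j in sequentially. \<forall>z\<in>K. cmod (f j z) \<le> c j"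
  shows "uniform_limit K f (\<lambda>_. 0) sequentially"
proof (rule uniform_limitI)
  fix r :: real assume "r > 0"
  have "\<forall>\<^sub>F j in sequentially. c j < r" using order_tendstoD(2)[OF assms(1) \<open>r > 0\<close>] .
  with assms(2) show "\<forall>\<^sub>F j in sequentially. \<forall>z\<in>K. dist (f j z) 0 < r"
    by eventually_elim (auto intro: le_less_trans)
qed

text \<open>Convergence passes from \<open>W\<close> to any \<open>V\<close> that differs from
  an affine function of \<open>W\<close> by an error of order \<open>1/n\<close>, locally
  uniformly. The affine function covers the relation \<open>V = \<i> * pi - W\<close> between
  the two logarithmic averages. The lower bound on \<open>Im V\<close> keeps the limit off the
  real axis.\<close>
lemma converges_in_herglotz_transfer:
  fixes V W :: "nat \<Rightarrow> complex \<Rightarrow> complex"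
  assumes conv: "converges_holomorphically (\<lambda>j. W (N j))" and N: "filterlim N at_top sequentially"
    and close: "\<And>K. compact K \<Longrightarrow> K \<subseteq> upper_half_plane \<Longrightarrow>
      \<exists>C. \<forall>n\<ge>1. \<forall>z\<in>K. cmod (V n z - (c + s * W n z)) \<le> C / real n"
    and low: "\<And>z. Im z > 0 \<Longrightarrow> \<exists>e>0. \<forall>n\<ge>1. e \<le> Im (V n z)"
  shows "converges_in_herglotz (\<lambda>j. V (N j))"
proof -
  obtain w where hol: "w holomorphic_on upper_half_plane"
    and w: "\<forall>K. compact K \<and> K \<subseteq> upper_half_plane \<longrightarrow> uniform_limit K (\<lambda>j. W (N j)) w sequentially"
    using conv unfolding converges_holomorphically_def by blast
  define v where "v z = c + s * w z" for z
  have ev: "\<forall>\<^sub>F j in sequentially. N j \<ge> 1" using N by (simp add: filterlim_at_top)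
  have v: "uniform_limit K (\<lambda>j. V (N j)) v sequentially" if K: "compact K" "K \<subseteq> upper_half_plane" for K
  proof -
    obtain C where "\<forall>n\<ge>1. \<forall>z\<in>K. cmod (V n z - (c + s * W n z)) \<le> C / real n"
      using close[OF K] ..
    then have C: "cmod (V n z - (c + s * W n z)) \<le> C / real n" if "n \<ge> 1" "z \<in> K" for n z
      using that by simp
    have "(\<lambda>j. C / real (N j)) \<longlonglongrightarrow> 0"
      by (rule filterlim_compose[OF lim_const_over_n N])
    then have "uniform_limit K (\<lambda>j z. V (N j) z - (c + s * W (N j) z)) (\<lambda>_. 0) sequentially"
    proof (rule uniform_limit_null_comparison)
      show "\<forall>\<^sub>F j in sequentially. \<forall>z\<in>K. cmod (V (N j) z - (c + s * W (N j) z)) \<le> C / real (N j)"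
        using ev by eventually_elim (intro ballI C)
    qed
    moreover have "uniform_limit K (\<lambda>j z. s * W (N j) z) (\<lambda>z. s * w z) sequentially"
      using w K by (intro bounded_linear.uniform_limit[OF bounded_linear_mult_right]) simp
    ultimately have "uniform_limit K (\<lambda>j z. (V (N j) z - (c + s * W (N j) z)) + (c + s * W (N j) z))
        (\<lambda>z. 0 + (c + s * w z)) sequentially"
      by (intro uniform_limit_add uniform_limit_const)
    then show ?thesis unfolding v_def by (simp only: diff_add_cancel add_0_left)
  qed
  have "v holomorphic_on upper_half_plane" unfolding v_def by (intro holomorphic_intros hol)
  moreover have "Im (v z) > 0" if z: "Im z > 0" for z
  proof -
    obtain e where e: "e > 0" "\<forall>n\<ge>1. e \<le> Im (V n z)" using low[OF z] by blast
    have "uniform_limit {z} (\<lambda>j. V (N j)) v sequentially" by (rule v) (use z in auto)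
    from tendsto_uniform_limitI[OF this singletonI]
    have "e \<le> Im (v z)"
    proof (rule tendsto_lowerbound[OF tendsto_Im])
      show "\<forall>\<^sub>F j in sequentially. e \<le> Im (V (N j) z)" using ev by eventually_elim (use e in blast)
    qed simp
    then show ?thesis using e by simp
  qed
  ultimately have "v \<in> herglotz" by (auto simp: herglotz_def)
  then show ?thesis unfolding converges_in_herglotz_def using v by blast
qed

section \<open>Stieltjes transforms of measures on a bounded interval\<close>

text \<open>All measures in the theorem live on one interval determined by the operator norm.
  Mass cannot escape to infinity, and every continuous function can be used as a test
  function.\<close>
definition prob_on :: "real \<Rightarrow> real measure \<Rightarrow> bool" where
  "prob_on L \<mu> \<longleftrightarrow> real_distribution \<mu> \<and> (AE t in \<mu>. \<bar>t\<bar> \<le> L)"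

definition stieltjes :: "real measure \<Rightarrow> complex \<Rightarrow> complex" where
  "stieltjes \<mu> z = (\<integral>t. 1 / (of_real t - z) \<partial>\<mu>)"

lemma of_real_diff_nonreal: "Im z > 0 \<Longrightarrow> of_real t - z \<noteq> 0"
  by (auto simp: complex_eq_iff)

lemma cmod_inverse_of_real_diff_le:
  assumes "Im z > 0"
  shows "cmod (1 / (of_real t - z)) \<le> 1 / Im z"
proof -
  have "Im z \<le> cmod (of_real t - z)"
    using abs_Im_le_cmod[of "of_real t - z"] assms by simp
  then show ?thesis using assms by (simp add: norm_divide frac_le)
qed

lemma prob_on_integral_bound:
  fixes g :: "real \<Rightarrow> 'a::{banach, second_countable_topology}"
  assumes "prob_on L \<mu>" and g: "continuous_on UNIV g"
    and B: "\<And>t. \<bar>t\<bar> \<le> L \<Longrightarrow> norm (g t) \<le> B"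
  shows "integrable \<mu> g" "norm (\<integral>t. g t \<partial>\<mu>) \<le> B"
proof -
  interpret real_distribution \<mu> using assms(1) by (simp add: prob_on_def)
  have ae: "AE t in \<mu>. norm (g t) \<le> B"
    using assms(1) B by (auto simp: prob_on_def elim: AE_mp)
  have [measurable]: "g \<in> borel_measurable \<mu>"
    using borel_measurable_continuous_onI[OF g] by simp
  show *: "integrable \<mu> g" by (rule integrable_const_bound[OF ae]) simp
  have "norm (\<integral>t. g t \<partial>\<mu>) \<le> (\<integral>t. norm (g t) \<partial>\<mu>)" by simp
  also have "\<dots> \<le> (\<integral>t. B \<partial>\<mu>)"
    using * ae by (intro integral_mono_AE) auto
  finally show "norm (\<integral>t. g t \<partial>\<mu>) \<le> B" using prob_space by simp
qed

lemma prob_on_integrable: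
  fixes g :: "real \<Rightarrow> 'a::{banach, second_countable_topology}"
  assumes "prob_on L \<mu>" and g: "continuous_on UNIV g"
  shows "integrable \<mu> g"
proof -
  have "compact (g ` {-L..L})"
    by (intro compact_continuous_image continuous_on_subset[OF g]) auto
  then obtain B where "\<And>x. x \<in> g ` {-L..L} \<Longrightarrow> norm x \<le> B"
    using compact_imp_bounded bounded_iff by meson
  then have "norm (g t) \<le> B" if "\<bar>t\<bar> \<le> L" for t using that by (auto simp: abs_le_iff)
  then show ?thesis using prob_on_integral_bound(1)[OF assms] by blast
qed

lemma prob_on_integral_cong:
  fixes f g :: "real \<Rightarrow> 'a::{banach, second_countable_topology}"
  assumes "prob_on L \<mu>" "continuous_on UNIV f" "continuous_on UNIV g"
    and "\<And>t. \<bar>t\<bar> \<le> L \<Longrightarrow> f t = g t"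
  shows "(\<integral>t. f t \<partial>\<mu>) = (\<integral>t. g t \<partial>\<mu>)"
proof -
  interpret real_distribution \<mu> using assms(1) by (simp add: prob_on_def)
  have [measurable]: "f \<in> borel_measurable \<mu>" "g \<in> borel_measurable \<mu>"
    using borel_measurable_continuous_onI[OF assms(2)] borel_measurable_continuous_onI[OF assms(3)]
    by simp_all
  show ?thesis
    using assms(1,4) by (intro integral_cong_AE) (auto simp: prob_on_def elim: AE_mp)
qed

text \<open>Write \<open>S k z\<close> for the integral of \<open>t^k / (t - z)\<close> and
  \<open>m k\<close> for the \<open>k\<close>-th moment. The argument is an induction based on
  the identity \<open>S (k + 1) z = m k + z * S k z\<close>. Convergence of \<open>S k\<close>
  gives convergence of \<open>m k\<close>, because \<open>- z * S k z\<close> tends to \<open>m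
  k\<close> as \<open>z\<close> goes to infinity along the imaginary axis, at a rate that
  depends only on \<open>k\<close> and the interval; convergence of \<open>m k\<close> and of
  \<open>S k\<close> gives convergence of \<open>S (k + 1)\<close>.\<close>
lemma prob_on_moments_convergent:
  assumes ev: "\<forall>\<^sub>F j in sequentially. prob_on L (\<mu> j)"
    and st: "\<And>z. Im z > 0 \<Longrightarrow> convergent (\<lambda>j. stieltjes (\<mu> j) z)"
  shows "convergent (\<lambda>j. \<integral>t. complex_of_real t ^ k \<partial>\<mu> j)"
proof -
  define S where "S k z j = (\<integral>t. complex_of_real t ^ k / (of_real t - z) \<partial>\<mu> j)" for k z j
  define m where "m k j = (\<integral>t. complex_of_real t ^ k \<partial>\<mu> j)" for k j
  have cont: "continuous_on UNIV (\<lambda>t. complex_of_real t ^ k / (of_real t - z))" if "Im z > 0" for k z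
    using of_real_diff_nonreal[OF that] by (intro continuous_intros) auto
  have m_conv: "convergent (m k)" if Sk: "\<And>z. Im z > 0 \<Longrightarrow> convergent (S k z)" for k
  proof (rule convergent_approx)
    fix e :: real assume "e > 0"
    \<comment> \<open>The error of the approximation at the point \<open>\<i> * y\<close> is at most \<open>\<bar>L\<bar> ^ Suc k / y\<close>.\<close>
    define y where "y = (\<bar>L\<bar> ^ Suc k + 1) / e"
    have "y > 0" using \<open>e > 0\<close> by (simp add: y_def add_nonneg_pos)
    define z where "z = Complex 0 y"
    have z: "Im z > 0" using \<open>y > 0\<close> by (simp add: z_def)
    have "\<forall>\<^sub>F j in sequentially. norm (m k j - (- z) * S k z j) \<le> e"
      using ev
    proof eventually_elim
      case (elim j)
      have i1: "complex_integrable (\<mu> j) (\<lambda>t. complex_of_real t ^ k)"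
        by (intro prob_on_integrable[OF elim] continuous_intros)
      note i2 = prob_on_integrable[OF elim cont[OF z, of k]]
      have "m k j - (- z) * S k z j
          = (\<integral>t. complex_of_real t ^ k + z * (complex_of_real t ^ k / (of_real t - z)) \<partial>\<mu> j)"
        unfolding m_def S_def using i1 i2
        by (subst Bochner_Integration.integral_add)
          (auto intro!: continuous_intros integrable_mult_right simp del: times_divide_eq_right)
      also have "\<dots> = (\<integral>t. complex_of_real t ^ Suc k / (of_real t - z) \<partial>\<mu> j)"
        using of_real_diff_nonreal[OF z]
        by (intro Bochner_Integration.integral_cong) (auto simp: field_simps)
      also have "norm \<dots> \<le> \<bar>L\<bar> ^ Suc k / y"
      proof (rule prob_on_integral_bound(2)[OF elim cont[OF z]])
        fix t :: real assume t: "\<bar>t\<bar> \<le> L"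
        have "norm (complex_of_real t ^ Suc k * (1 / (of_real t - z))) \<le> \<bar>L\<bar> ^ Suc k * (1 / y)"
          unfolding norm_mult norm_power
          using cmod_inverse_of_real_diff_le[OF z, of t] t
          by (intro mult_mono power_mono) (auto simp: z_def)
        then show "norm (complex_of_real t ^ Suc k / (of_real t - z)) \<le> \<bar>L\<bar> ^ Suc k / y" by simp
      qed
      also have "\<dots> \<le> e"
        using \<open>e > 0\<close> by (simp add: y_def divide_simps add_nonneg_pos add_pos_nonneg)
      finally show ?case .
    qed
    moreover have "convergent (\<lambda>j. (- z) * S k z j)"
      using Sk[OF z] by (intro convergent_mult convergent_const)
    ultimately show "\<exists>y. convergent y \<and> (\<forall>\<^sub>F j in sequentially. norm (m k j - y j) \<le> e)" by blast
  qed
  have S_conv: "convergent (S k z)" if "Im z > 0" for k z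
    using that
  proof (induction k arbitrary: z)
    case 0
    then show ?case using st by (simp add: S_def stieltjes_def)
  next
    case (Suc k)
    have "\<forall>\<^sub>F j in sequentially. S (Suc k) z j = m k j + z * S k z j"
      using ev
    proof eventually_elim
      case (elim j)
      have i1: "complex_integrable (\<mu> j) (\<lambda>t. complex_of_real t ^ k)"
        by (intro prob_on_integrable[OF elim] continuous_intros)
      note i2 = prob_on_integrable[OF elim cont[OF Suc.prems, of k]]
      have "m k j + z * S k z j
          = (\<integral>t. complex_of_real t ^ k + z * (complex_of_real t ^ k / (of_real t - z)) \<partial>\<mu> j)"
        unfolding m_def S_def using i1 i2
        by (subst Bochner_Integration.integral_add)
          (auto intro!: continuous_intros integrable_mult_right simp del: times_divide_eq_right)
      also have "\<dots> = S (Suc k) z j" unfolding S_def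
        using of_real_diff_nonreal[OF Suc.prems]
        by (intro Bochner_Integration.integral_cong) (auto simp: field_simps)
      finally show ?case by simp
    qed
    moreover have "convergent (\<lambda>j. m k j + z * S k z j)"
      using Suc m_conv by (intro convergent_add convergent_mult convergent_const) auto
    ultimately show ?case by (rule convergent_eventually_eq)
  qed
  show ?thesis using m_conv[OF S_conv] unfolding m_def .
qed

text \<open>Polynomials are handled by the moments; the Weierstrass theorem on
  \<open>{-L..L}\<close> extends this to continuous functions.\<close>
lemma prob_on_integrals_convergent_real:
  fixes f :: "real \<Rightarrow> real"
  assumes ev: "\<forall>\<^sub>F j in sequentially. prob_on L (\<mu> j)"
    and st: "\<And>z. Im z > 0 \<Longrightarrow> convergent (\<lambda>j. stieltjes (\<mu> j) z)"
    and f: "continuous_on UNIV f"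
  shows "convergent (\<lambda>j. \<integral>t. f t \<partial>\<mu> j)"
proof (rule convergent_approx)
  fix e :: real assume "e > 0"
  obtain p where p: "real_polynomial_function p" "\<And>x. x \<in> {-L..L} \<Longrightarrow> \<bar>f x - p x\<bar> < e"
    using Stone_Weierstrass_real_polynomial_function[of "{-L..L}" f e]
      continuous_on_subset[OF f] \<open>e > 0\<close> by (metis compact_Icc subset_UNIV)
  then obtain c n where pc: "p = (\<lambda>x. \<Sum>i\<le>n. c i * x ^ i)"
    by (auto simp: real_polynomial_function_iff_sum)
  have pow: "convergent (\<lambda>j. \<integral>t. t ^ i \<partial>\<mu> j)" for i
  proof -
    have "convergent (\<lambda>j. Re (\<integral>t. complex_of_real t ^ i \<partial>\<mu> j))"
      by (intro convergent_Re prob_on_moments_convergent[OF ev st])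
    moreover have "(\<integral>t. complex_of_real t ^ i \<partial>\<mu> j) = of_real (\<integral>t. t ^ i \<partial>\<mu> j)" for j
      unfolding of_real_power[symmetric] by (rule integral_complex_of_real)
    ultimately show ?thesis by simp
  qed
  have "\<forall>\<^sub>F j in sequentially. norm ((\<integral>t. f t \<partial>\<mu> j) - (\<Sum>i\<le>n. c i * (\<integral>t. t ^ i \<partial>\<mu> j))) \<le> e"
    using ev
  proof eventually_elim
    case (elim j)
    note int = prob_on_integrable[OF elim]
    have cp: "continuous_on UNIV p" unfolding pc by (intro continuous_intros)
    have "(\<Sum>i\<le>n. c i * (\<integral>t. t ^ i \<partial>\<mu> j)) = (\<integral>t. p t \<partial>\<mu> j)"
      unfolding pc by (subst Bochner_Integration.integral_sum) (auto intro!: int continuous_intros)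
    then have "(\<integral>t. f t \<partial>\<mu> j) - (\<Sum>i\<le>n. c i * (\<integral>t. t ^ i \<partial>\<mu> j)) = (\<integral>t. f t - p t \<partial>\<mu> j)"
      using int[OF f] int[OF cp] by simp
    also have "norm \<dots> \<le> e"
    proof (rule prob_on_integral_bound(2)[OF elim])
      show "norm (f t - p t) \<le> e" if "\<bar>t\<bar> \<le> L" for t
      proof -
        have "t \<in> {-L..L}" using that by (auto simp: abs_le_iff)
        from p(2)[OF this] show ?thesis by simp
      qed
    qed (intro continuous_intros f cp)
    finally show ?case .
  qed
  moreover have "convergent (\<lambda>j. \<Sum>i\<le>n. c i * (\<integral>t. t ^ i \<partial>\<mu> j))"
    by (intro convergent_sum convergent_mult convergent_const pow)
  ultimately show "\<exists>y. convergent y \<and> (\<forall>\<^sub>F j in sequentially. norm ((\<integral>t. f t \<partial>\<mu> j) - y j) \<le> e)"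
    by blast
qed

lemma continuous_vanishing_at_infinity_bounded:
  fixes f :: "real \<Rightarrow> real"
  assumes "continuous_on UNIV f" "(f \<longlongrightarrow> 0) at_infinity"
  shows "\<exists>B. \<forall>t. norm (f t) \<le> B"
proof -
  have "\<forall>\<^sub>F t in at_infinity. norm (f t) < 1"
    using order_tendstoD(2)[OF tendsto_norm[OF assms(2)], of 1] by simp
  then obtain R where R: "\<And>t. R \<le> norm t \<Longrightarrow> norm (f t) < 1" by (auto simp: eventually_at_infinity)
  have "compact (f ` {-R..R})"
    by (intro compact_continuous_image continuous_on_subset[OF assms(1)]) auto
  then obtain B where B: "\<And>x. x \<in> f ` {-R..R} \<Longrightarrow> norm x \<le> B"
    using compact_imp_bounded bounded_iff by meson
  have "norm (f t) \<le> max 1 B" for t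
  proof (cases "R \<le> norm t")
    case False
    then have "t \<in> {-R..R}" by (auto simp: abs_if split: if_splits)
    then show ?thesis using B by fastforce
  qed (use R in \<open>fastforce intro: less_imp_le\<close>)
  then show ?thesis by blast
qed

text \<open>The integrals of each continuous function converge by the previous lemma; it remains
  to represent the limit functional by a measure. Measures on a fixed interval are tight, so
  Helly's theorem provides a subsequence that converges weakly to some \<open>M\<close>, and
  along this subsequence the limit functional is integration against \<open>M\<close>. The full
  sequence of integrals is already known to converge, so it has the same limit.\<close>
theorem converges_to_probability_if_stieltjes_convergent:
  assumes ev: "\<forall>\<^sub>F j in sequentially. prob_on L (\<mu> j)"
    and st: "\<And>z. Im z > 0 \<Longrightarrow> convergent (\<lambda>j. stieltjes (\<mu> j) z)"
  shows "converges_to_probability \<mu>"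
proof -
  obtain j0 where j0: "\<And>j. j \<ge> j0 \<Longrightarrow> prob_on L (\<mu> j)" using ev by (auto simp: eventually_sequentially)
  define \<nu> where "\<nu> j = \<mu> (j + j0)" for j
  have \<nu>: "prob_on L (\<nu> j)" for j using j0 by (simp add: \<nu>_def)
  have dist: "real_distribution (\<nu> j)" for j using \<nu> by (simp add: prob_on_def)
  have "tight \<nu>"
    unfolding tight_def
  proof (intro conjI allI impI dist)
    fix e :: real assume "e > 0"
    have "measure (\<nu> j) {-\<bar>L\<bar> - 1<..\<bar>L\<bar> + 1} = 1" for j
    proof -
      interpret real_distribution "\<nu> j" by (rule dist)
      have "AE t in \<nu> j. \<bar>t\<bar> \<le> L" using \<nu> by (simp add: prob_on_def)
      then have "AE t in \<nu> j. t \<in> {-\<bar>L\<bar> - 1<..\<bar>L\<bar> + 1}" by (rule AE_mp) auto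
      then show ?thesis by (subst prob_eq_1) auto
    qed
    then show "\<exists>a b. a < b \<and> (\<forall>n. 1 - e < measure (\<nu> n) {a<..b})"
      using \<open>e > 0\<close> by (intro exI[of _ "-\<bar>L\<bar> - 1"] exI[of _ "\<bar>L\<bar> + 1"]) auto
  qed
  from tight_imp_convergent_subsubsequence[OF this strict_mono_id]
  obtain r M where r: "strict_mono r" "real_distribution M" "weak_conv_m (\<nu> \<circ> id \<circ> r) M" by blast
  interpret M: real_distribution M by (rule r(2))
  have "weak_star_conv \<mu> M"
    unfolding weak_star_conv_def
  proof (intro allI impI, elim conjE)
    fix f :: "real \<Rightarrow> real" assume f: "continuous_on UNIV f" "(f \<longlongrightarrow> 0) at_infinity"
    obtain B where B: "\<forall>t. norm (f t) \<le> B" using continuous_vanishing_at_infinity_bounded[OF f] ..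
    obtain l where l: "(\<lambda>j. \<integral>t. f t \<partial>\<mu> j) \<longlonglongrightarrow> l"
      using prob_on_integrals_convergent_real[OF ev st f(1)] by (auto simp: convergent_def)
    then have "(\<lambda>j. \<integral>t. f t \<partial>\<nu> j) \<longlonglongrightarrow> l" unfolding \<nu>_def by (rule LIMSEQ_ignore_initial_segment)
    then have "(\<lambda>j. \<integral>t. f t \<partial>\<nu> (r j)) \<longlonglongrightarrow> l" using r(1) LIMSEQ_subseq_LIMSEQ by (fastforce simp: o_def)
    moreover have "(\<lambda>j. \<integral>t. f t \<partial>(\<nu> \<circ> id \<circ> r) j) \<longlonglongrightarrow> (\<integral>t. f t \<partial>M)"
      using f(1) B dist
      by (intro weak_conv_imp_integral_bdd_continuous_conv[OF _ r(2) r(3), of f B])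
        (auto simp: continuous_on_eq_continuous_at)
    ultimately show "(\<lambda>j. \<integral>t. f t \<partial>\<mu> j) \<longlonglongrightarrow> (\<integral>t. f t \<partial>M)"
      using l LIMSEQ_unique by (fastforce simp: o_def)
  qed
  moreover have "prob_space M" "sets M = sets borel" by unfold_locales simp_all
  ultimately show ?thesis unfolding converges_to_probability_def by blast
qed

text \<open>A test function that does not vanish at infinity is cut off outside
  \<open>{-L..L}\<close>, where the measures of the sequence have no mass.\<close>
lemma converges_to_probability_imp_convergent_real:
  fixes g :: "real \<Rightarrow> real"
  assumes ev: "\<forall>\<^sub>F j in sequentially. prob_on L (\<mu> j)"
    and conv: "converges_to_probability \<mu>" and g: "continuous_on UNIV g"
  shows "convergent (\<lambda>j. \<integral>t. g t \<partial>\<mu> j)"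
proof -
  obtain M where M: "weak_star_conv \<mu> M" using conv by (auto simp: converges_to_probability_def)
  \<comment> \<open>The cutoff is 1 on \<open>{-L..L}\<close> and 0 where \<open>\<bar>t\<bar>\<close> exceeds \<open>L + 1\<close>.\<close>
  define f where "f t = g t * max 0 (min 1 (L + 1 - \<bar>t\<bar>))" for t
  have f: "continuous_on UNIV f" unfolding f_def by (intro continuous_intros g)
  have "\<forall>\<^sub>F t in at_infinity. f t = 0"
    unfolding eventually_at_infinity by (intro exI[of _ "L + 1"]) (auto simp: f_def)
  then have "(f \<longlongrightarrow> 0) at_infinity" by (rule tendsto_eventually)
  then have "convergent (\<lambda>j. \<integral>t. f t \<partial>\<mu> j)"
    using M f by (auto simp: weak_star_conv_def convergent_def)
  moreover have "\<forall>\<^sub>F j in sequentially. (\<integral>t. g t \<partial>\<mu> j) = (\<integral>t. f t \<partial>\<mu> j)"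
    using ev by eventually_elim (rule prob_on_integral_cong, use f g in \<open>auto simp: f_def\<close>)
  ultimately show ?thesis by (rule convergent_eventually_eq[rotated])
qed

lemma converges_to_probability_imp_convergent:
  fixes g :: "real \<Rightarrow> complex"
  assumes ev: "\<forall>\<^sub>F j in sequentially. prob_on L (\<mu> j)"
    and conv: "converges_to_probability \<mu>" and g: "continuous_on UNIV g"
  shows "convergent (\<lambda>j. \<integral>t. g t \<partial>\<mu> j)"
proof -
  have cont: "continuous_on UNIV (\<lambda>t. Re (g t))" "continuous_on UNIV (\<lambda>t. Im (g t))"
    by (intro continuous_intros g)+
  have "convergent (\<lambda>j. of_real (\<integral>t. Re (g t) \<partial>\<mu> j) + \<i> * of_real (\<integral>t. Im (g t) \<partial>\<mu> j))"
    using converges_to_probability_imp_convergent_real[OF ev conv] cont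
    by (intro convergent_add convergent_mult convergent_const convergent_of_real_sequence) auto
  moreover have "\<forall>\<^sub>F j in sequentially. (\<integral>t. g t \<partial>\<mu> j)
      = of_real (\<integral>t. Re (g t) \<partial>\<mu> j) + \<i> * of_real (\<integral>t. Im (g t) \<partial>\<mu> j)"
    using ev
  proof eventually_elim
    case (elim j)
    show ?case using prob_on_integrable[OF elim g] by (auto simp: complex_eq_iff)
  qed
  ultimately show ?thesis by (rule convergent_eventually_eq[rotated])
qed

corollary converges_to_probability_iff_stieltjes:
  assumes ev: "\<forall>\<^sub>F j in sequentially. prob_on L (\<mu> j)"
  shows "converges_to_probability \<mu> \<longleftrightarrow> (\<forall>z. Im z > 0 \<longrightarrow> convergent (\<lambda>j. stieltjes (\<mu> j) z))"
proof (intro iffI allI impI)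
  fix z assume "converges_to_probability \<mu>" "Im z > 0"
  then show "convergent (\<lambda>j. stieltjes (\<mu> j) z)"
    unfolding stieltjes_def using of_real_diff_nonreal[of z]
    by (intro converges_to_probability_imp_convergent[OF ev] continuous_intros) auto
qed (use converges_to_probability_if_stieltjes_convergent[OF ev] in blast)

section \<open>The sequence space\<close>

text \<open>Sequences are plain functions without a vector space type, so sums, differences and
  multiples are all written as linear combinations, the only vector operation below.\<close>
abbreviation lincomb :: "complex \<Rightarrow> (nat \<Rightarrow> complex) \<Rightarrow> complex \<Rightarrow> (nat \<Rightarrow> complex) \<Rightarrow> nat \<Rightarrow> complex" where
  "lincomb c u d v \<equiv> (\<lambda>n. c * u n + d * v n)"

text \<open>Spectral measures are quadratic in the vector, so the squared norm avoids square
  roots throughout.\<close>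
definition norm_sq :: "(nat \<Rightarrow> complex) \<Rightarrow> real" where
  "norm_sq u = (\<Sum>n. (cmod (u n))\<^sup>2)"

lemma ell2_summable_inner:
  assumes "u \<in> ell2" "v \<in> ell2"
  shows "summable (\<lambda>n. cnj (u n) * v n)" "summable (\<lambda>n. cmod (cnj (u n) * v n))"
proof -
  have s: "summable (\<lambda>n. (cmod (u n))\<^sup>2 + (cmod (v n))\<^sup>2)"
    using assms by (intro summable_add) (auto simp: ell2_def)
  have le: "cmod (cnj (u n) * v n) \<le> (cmod (u n))\<^sup>2 + (cmod (v n))\<^sup>2" for n
  proof -
    have "0 \<le> cmod (u n) * cmod (v n)" by simp
    moreover have "2 * (cmod (u n) * cmod (v n)) \<le> (cmod (u n))\<^sup>2 + (cmod (v n))\<^sup>2"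
      using sum_squares_bound[of "cmod (u n)" "cmod (v n)"] by (simp only: mult.assoc)
    ultimately show ?thesis by (simp only: norm_mult complex_mod_cnj)
  qed
  show "summable (\<lambda>n. cmod (cnj (u n) * v n))"
    by (rule summable_comparison_test'[OF s, of 0]) (use le in simp)
  then show "summable (\<lambda>n. cnj (u n) * v n)" by (rule summable_norm_cancel)
qed

lemma ell2_lincomb [intro, simp]:
  assumes "u \<in> ell2" "v \<in> ell2"
  shows "lincomb c u d v \<in> ell2"
proof -
  have s: "summable (\<lambda>n. 2 * (cmod c)\<^sup>2 * (cmod (u n))\<^sup>2 + 2 * (cmod d)\<^sup>2 * (cmod (v n))\<^sup>2)"
    using assms by (intro summable_add summable_mult) (auto simp: ell2_def)
  have le: "(cmod (c * x + d * y))\<^sup>2 \<le> 2 * (cmod c)\<^sup>2 * (cmod x)\<^sup>2 + 2 * (cmod d)\<^sup>2 * (cmod y)\<^sup>2" for x y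
  proof -
    have "(cmod (c * x + d * y))\<^sup>2 \<le> (cmod (c * x) + cmod (d * y))\<^sup>2"
      by (intro power_mono norm_triangle_ineq) auto
    also have "\<dots> \<le> 2 * (cmod (c * x))\<^sup>2 + 2 * (cmod (d * y))\<^sup>2"
      using sum_squares_bound[of "cmod (c * x)" "cmod (d * y)"] by (simp add: power2_sum)
    finally show ?thesis by (simp add: norm_mult power_mult_distrib)
  qed
  have "summable (\<lambda>n. (cmod (c * u n + d * v n))\<^sup>2)"
    by (rule summable_comparison_test'[OF s, of 0]) (use le in simp)
  then show ?thesis using assms by (simp add: ell2_def)
qed

lemma ell2_diff [simp]:
  assumes "u \<in> ell2" "v \<in> ell2"
  shows "(\<lambda>n. u n - v n) \<in> ell2"
  using ell2_lincomb[OF assms, of 1 "-1"] by simp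

lemma ell2_inner_right_lincomb:
  assumes "w \<in> ell2" "u \<in> ell2" "v \<in> ell2"
  shows "ell2_inner w (lincomb c u d v) = c * ell2_inner w u + d * ell2_inner w v"
proof -
  have "(\<Sum>n. cnj (w n) * (c * u n + d * v n)) = (\<Sum>n. c * (cnj (w n) * u n) + d * (cnj (w n) * v n))"
    by (simp add: algebra_simps)
  also have "\<dots> = c * (\<Sum>n. cnj (w n) * u n) + d * (\<Sum>n. cnj (w n) * v n)"
    using assms
    by (simp add: suminf_add[symmetric] suminf_mult[symmetric] summable_mult ell2_summable_inner)
  finally show ?thesis by (simp add: ell2_inner_def)
qed

lemma ell2_inner_commute:
  assumes "u \<in> ell2" "v \<in> ell2"
  shows "ell2_inner v u = cnj (ell2_inner u v)"
proof -
  have "(\<lambda>n. cnj (u n) * v n) sums ell2_inner u v"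
    using ell2_summable_inner[OF assms] by (simp add: ell2_inner_def summable_sums)
  then have "(\<lambda>n. cnj (cnj (u n) * v n)) sums cnj (ell2_inner u v)" by (simp only: sums_cnj)
  then show ?thesis by (auto simp: ell2_inner_def mult.commute dest: sums_unique)
qed

lemma ell2_inner_left_lincomb:
  assumes "w \<in> ell2" "u \<in> ell2" "v \<in> ell2"
  shows "ell2_inner (lincomb c u d v) w = cnj c * ell2_inner u w + cnj d * ell2_inner v w"
  using assms ell2_inner_commute[of w "lincomb c u d v"] ell2_inner_right_lincomb[OF assms, of c d]
    ell2_inner_commute[of w u] ell2_inner_commute[of w v] by simp

lemma ell2_inner_self:
  assumes "u \<in> ell2"
  shows "ell2_inner u u = of_real (norm_sq u)"
proof -
  have "(\<lambda>n. complex_of_real ((cmod (u n))\<^sup>2)) sums of_real (norm_sq u)"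
    using assms by (subst sums_of_real_iff) (auto simp: norm_sq_def ell2_def summable_sums)
  moreover have "complex_of_real ((cmod (u n))\<^sup>2) = cnj (u n) * u n" for n
    using complex_norm_square[of "u n"] by (simp add: mult.commute)
  ultimately show ?thesis by (auto simp: ell2_inner_def dest: sums_unique)
qed

lemma norm_sq_nonneg [simp]: "u \<in> ell2 \<Longrightarrow> 0 \<le> norm_sq u"
  by (auto simp: norm_sq_def ell2_def intro!: suminf_nonneg)

lemma ell2_norm_power2: "u \<in> ell2 \<Longrightarrow> (ell2_norm u)\<^sup>2 = norm_sq u"
  using norm_sq_nonneg[of u] by (simp add: ell2_norm_def norm_sq_def)

lemma norm_sq_eq_0: "u \<in> ell2 \<Longrightarrow> norm_sq u = 0 \<Longrightarrow> u n = 0"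
  using suminf_eq_zero_iff[of "\<lambda>n. (cmod (u n))\<^sup>2"] by (auto simp: norm_sq_def ell2_def)

lemma norm_sq_lincomb:
  assumes "u \<in> ell2" "v \<in> ell2"
  shows "norm_sq (lincomb c u d v) =
    (cmod c)\<^sup>2 * norm_sq u + (cmod d)\<^sup>2 * norm_sq v + 2 * Re (cnj c * d * ell2_inner u v)"
proof -
  have "complex_of_real (norm_sq (lincomb c u d v)) = cnj c * (c * ell2_inner u u + d * ell2_inner u v)
        + cnj d * (c * ell2_inner v u + d * ell2_inner v v)"
    using assms by (simp flip: ell2_inner_self add: ell2_inner_left_lincomb ell2_inner_right_lincomb)
  also have "\<dots> = (c * cnj c) * norm_sq u + (d * cnj d) * norm_sq v
      + (cnj c * d * ell2_inner u v + cnj (cnj c * d * ell2_inner u v))"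
    using ell2_inner_commute[OF assms] assms by (simp add: ell2_inner_self algebra_simps)
  also have "\<dots> = of_real ((cmod c)\<^sup>2 * norm_sq u + (cmod d)\<^sup>2 * norm_sq v + 2 * Re (cnj c * d * ell2_inner u v))"
    by (simp only: of_real_add of_real_mult complex_norm_square complex_add_cnj)
  finally show ?thesis by (simp only: of_real_eq_iff)
qed

text \<open>The Cauchy-Schwarz inequality in the weighted arithmetic-mean form. The weight
  \<open>s\<close> is chosen at each use, and the right-hand side is additive over orthogonal
  pieces.\<close>
lemma ell2_inner_bound:
  assumes "u \<in> ell2" "v \<in> ell2" "s > 0"
  shows "cmod (ell2_inner u v) \<le> (s * norm_sq u + norm_sq v / s) / 2"
proof -
  have su: "summable (\<lambda>n. (cmod (u n))\<^sup>2)" "summable (\<lambda>n. (cmod (v n))\<^sup>2)"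
    using assms by (auto simp: ell2_def)
  have le: "cmod (cnj (u n) * v n) \<le> s / 2 * (cmod (u n))\<^sup>2 + 1 / (2 * s) * (cmod (v n))\<^sup>2" for n
  proof -
    have "0 \<le> (s * cmod (u n) - cmod (v n))\<^sup>2" by simp
    then have "2 * s * (cmod (u n) * cmod (v n)) \<le> s\<^sup>2 * (cmod (u n))\<^sup>2 + (cmod (v n))\<^sup>2"
      by (simp add: power2_diff power_mult_distrib)
    then show ?thesis using \<open>s > 0\<close> by (simp add: norm_mult field_simps power2_eq_square)
  qed
  have "cmod (ell2_inner u v) \<le> (\<Sum>n. cmod (cnj (u n) * v n))"
    unfolding ell2_inner_def by (rule summable_norm) (rule ell2_summable_inner(2)[OF assms(1,2)])
  also have "\<dots> \<le> (\<Sum>n. s / 2 * (cmod (u n))\<^sup>2 + 1 / (2 * s) * (cmod (v n))\<^sup>2)"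
    by (intro suminf_le le ell2_summable_inner(2)[OF assms(1,2)] summable_add summable_mult su)
  also have "\<dots> = s / 2 * norm_sq u + 1 / (2 * s) * norm_sq v"
    unfolding norm_sq_def using su
    by (simp add: suminf_add[symmetric] suminf_mult[symmetric] summable_mult del: times_divide_eq_left)
  finally show ?thesis by (simp add: field_simps)
qed

lemma delta_ell2: "n \<ge> 1 \<Longrightarrow> delta n \<in> ell2"
proof -
  assume "n \<ge> 1"
  moreover have "summable (\<lambda>k. (cmod (delta n k))\<^sup>2)"
    by (rule summable_finite[of "{n}"]) (auto simp: delta_def)
  ultimately show ?thesis by (auto simp: ell2_def delta_def)
qed

lemma ell2_inner_delta: "ell2_inner (delta n) v = v n"
proof -
  have "(\<lambda>k. cnj (delta n k) * v k) sums (\<Sum>k\<in>{n}. cnj (delta n k) * v k)"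
    by (rule sums_finite) (auto simp: delta_def)
  then show ?thesis by (auto simp: ell2_inner_def delta_def dest: sums_unique)
qed

lemma norm_sq_delta: "norm_sq (delta n) = 1"
proof -
  have "(\<lambda>k. (cmod (delta n k))\<^sup>2) sums (\<Sum>k\<in>{n}. (cmod (delta n k))\<^sup>2)"
    by (rule sums_finite) (auto simp: delta_def)
  then show ?thesis by (auto simp: norm_sq_def delta_def dest: sums_unique)
qed

lemma ell2_ext:
  assumes "u \<in> ell2" "v \<in> ell2" "\<And>w. w \<in> ell2 \<Longrightarrow> ell2_inner w u = ell2_inner w v"
  shows "u = v"
proof
  fix n show "u n = v n"
  proof (cases "n = 0")
    case False
    then have "delta n \<in> ell2" by (simp add: delta_ell2)
    from assms(3)[OF this] show ?thesis by (simp add: ell2_inner_delta)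
  qed (use assms in \<open>auto simp: ell2_def\<close>)
qed

section \<open>Spectral resolutions of bounded operators\<close>

text \<open>A spectral resolution is given only through the quadratic forms of the operator. The
  aim of this part is to recover from them the resolvent as the integral of \<open>1 / (t -
  z)\<close>. For this it suffices that the projections commute with the operator, which makes
  it nearly scalar on the ranges of \<open>E d - E c\<close> for short intervals.\<close>
locale bounded_spectral_resolution =
  fixes T :: "(nat \<Rightarrow> complex) \<Rightarrow> nat \<Rightarrow> complex" and E :: "real \<Rightarrow> (nat \<Rightarrow> complex) \<Rightarrow> nat \<Rightarrow> complex"
    and C :: real
  assumes res: "spectral_resolution T E"
    and T_ell2 [simp]: "u \<in> ell2 \<Longrightarrow> T u \<in> ell2"
    and T_lincomb: "T (lincomb c u d v) = lincomb c (T u) d (T v)"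
    and T_bound: "u \<in> ell2 \<Longrightarrow> cmod (ell2_inner u (T u)) \<le> C * norm_sq u"
begin

text \<open>The distribution function of the spectral measure of \<open>u\<close>.\<close>
definition F :: "(nat \<Rightarrow> complex) \<Rightarrow> real \<Rightarrow> real" where
  "F u t = norm_sq (E t u)"

lemma
  shows E_ell2 [simp]: "u \<in> ell2 \<Longrightarrow> E t u \<in> ell2"
    and E_lincomb: "u \<in> ell2 \<Longrightarrow> v \<in> ell2 \<Longrightarrow> E t (lincomb c u d v) = lincomb c (E t u) d (E t v)"
    and E_adjoint: "u \<in> ell2 \<Longrightarrow> v \<in> ell2 \<Longrightarrow> ell2_inner (E t u) v = ell2_inner u (E t v)"
  using res by (auto simp: spectral_resolution_def orthogonal_projection_def)

lemma E_E: "u \<in> ell2 \<Longrightarrow> E s (E t u) = E (min s t) u"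
  using res by (auto simp: spectral_resolution_def)

lemma F_eq_inner: "u \<in> ell2 \<Longrightarrow> of_real (F u t) = ell2_inner u (E t u)"
  by (simp add: F_def flip: ell2_inner_self) (simp add: E_adjoint E_E)

lemma norm_sq_E_diff:
  assumes "u \<in> ell2" "s \<le> t"
  shows "norm_sq (lincomb 1 (E t u) (-1) (E s u)) = F u t - F u s"
proof -
  have "ell2_inner (E t u) (E s u) = of_real (F u s)"
    using assms by (simp add: E_adjoint E_E F_eq_inner)
  then show ?thesis using assms by (subst norm_sq_lincomb) (auto simp: F_def)
qed

lemma norm_sq_E_codiff:
  assumes "u \<in> ell2"
  shows "norm_sq (lincomb 1 u (-1) (E t u)) = norm_sq u - F u t"
proof -
  have "ell2_inner u (E t u) = of_real (F u t)"
    using assms by (simp add: F_eq_inner)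
  then show ?thesis using assms by (subst norm_sq_lincomb) (auto simp: F_def)
qed

lemma F_mono: "u \<in> ell2 \<Longrightarrow> s \<le> t \<Longrightarrow> F u s \<le> F u t"
  using norm_sq_E_diff[of u s t] norm_sq_nonneg[of "lincomb 1 (E t u) (-1) (E s u)"] by simp

lemma F_eq_ell2_norm: "u \<in> ell2 \<Longrightarrow> F u t = (ell2_norm (E t u))\<^sup>2"
  by (simp add: F_def ell2_norm_power2)

lemma F_right_continuous:
  assumes "u \<in> ell2"
  shows "continuous (at_right t) (F u)"
proof -
  have "((\<lambda>s. (ell2_norm (\<lambda>n. E s u n - E t u n))\<^sup>2) \<longlongrightarrow> 0\<^sup>2) (at_right t)"
    using res assms by (intro tendsto_power) (auto simp: spectral_resolution_def)
  moreover have "\<forall>\<^sub>F s in at_right t. (ell2_norm (\<lambda>n. E s u n - E t u n))\<^sup>2 = F u s - F u t"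
    unfolding eventually_at_filter
  proof (intro always_eventually allI impI)
    fix s assume "s \<noteq> t" "s \<in> {t<..}"
    then show "(ell2_norm (\<lambda>n. E s u n - E t u n))\<^sup>2 = F u s - F u t"
      using norm_sq_E_diff[OF assms, of t s] ell2_norm_power2[of "lincomb 1 (E s u) (-1) (E t u)"] assms
      by simp
  qed
  ultimately have "((\<lambda>s. F u s - F u t) \<longlongrightarrow> 0) (at_right t)"
    using tendsto_cong by fastforce
  then show ?thesis by (simp add: continuous_within LIM_zero_iff)
qed

lemma F_at_bot:
  assumes "u \<in> ell2"
  shows "(F u \<longlongrightarrow> 0) at_bot"
proof -
  have "((\<lambda>t. (ell2_norm (E t u))\<^sup>2) \<longlongrightarrow> 0\<^sup>2) at_bot"
    using res assms by (intro tendsto_power) (auto simp: spectral_resolution_def)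
  moreover have "F u = (\<lambda>t. (ell2_norm (E t u))\<^sup>2)" using F_eq_ell2_norm[OF assms] by auto
  ultimately show ?thesis by simp
qed

lemma F_at_top:
  assumes "u \<in> ell2"
  shows "(F u \<longlongrightarrow> norm_sq u) at_top"
proof -
  have "((\<lambda>t. (ell2_norm (\<lambda>n. E t u n - u n))\<^sup>2) \<longlongrightarrow> 0\<^sup>2) at_top"
    using res assms by (intro tendsto_power) (auto simp: spectral_resolution_def)
  moreover have "(ell2_norm (\<lambda>n. E t u n - u n))\<^sup>2 = norm_sq u - F u t" for t
    using norm_sq_E_codiff[OF assms, of t] ell2_norm_power2[of "lincomb 1 u (-1) (E t u)"] assms
    by (simp add: ell2_norm_def norm_minus_commute)
  ultimately have "((\<lambda>t. norm_sq u - (norm_sq u - F u t)) \<longlongrightarrow> norm_sq u - 0) at_top"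
    by (intro tendsto_intros) simp
  then show ?thesis by simp
qed

abbreviation \<mu> :: "(nat \<Rightarrow> complex) \<Rightarrow> real measure" where
  "\<mu> u \<equiv> interval_measure (F u)"

lemma form_eq:
  assumes "u \<in> ell2"
  shows "integrable (\<mu> u) (\<lambda>t. t)" "ell2_inner u (T u) = of_real (\<integral>t. t \<partial>\<mu> u)"
proof -
  have "F u = (\<lambda>t. (ell2_norm (E t u))\<^sup>2)" using F_eq_ell2_norm[OF assms] by auto
  then show "integrable (\<mu> u) (\<lambda>t. t)" "ell2_inner u (T u) = of_real (\<integral>t. t \<partial>\<mu> u)"
    using res assms by (auto simp: spectral_resolution_def)
qed

text \<open>If \<open>E c w = 0\<close>, then the spectral measure of \<open>w\<close> lives on
  \<open>{c..}\<close>, and the quadratic form is the integral of \<open>t\<close> against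
  it.\<close>
lemma form_lower:
  assumes "w \<in> ell2" "F w c = 0"
  shows "c * norm_sq w \<le> Re (ell2_inner w (T w))"
proof -
  note F = F_mono[OF assms(1)] F_right_continuous[OF assms(1)] F_at_bot[OF assms(1)]
  interpret finite_borel_measure "\<mu> w"
    by (rule finite_borel_measure_interval_measure[OF F F_at_top[OF assms(1)]]) (simp_all add: assms)
  have tot: "measure (\<mu> w) UNIV = norm_sq w"
    using interval_measure_UNIV[OF F F_at_top[OF assms(1)]] assms by (simp add: measure_def)
  have "{..c} \<in> null_sets (\<mu> w)"
    using emeasure_interval_measure_Iic[OF F, of c] assms(2) by (auto simp: null_sets_def)
  then have ae: "AE t in \<mu> w. c \<le> t" by (rule AE_I') auto
  have "c * norm_sq w = (\<integral>t. c \<partial>\<mu> w)" using tot by simp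
  also have "\<dots> \<le> (\<integral>t. t \<partial>\<mu> w)"
    by (rule integral_mono_AE) (use ae form_eq[OF assms(1)] in auto)
  finally show ?thesis using form_eq(2)[OF assms(1)] by simp
qed

lemma form_upper:
  assumes "w \<in> ell2" "F w d = norm_sq w"
  shows "Re (ell2_inner w (T w)) \<le> d * norm_sq w"
proof -
  note F = F_mono[OF assms(1)] F_right_continuous[OF assms(1)] F_at_bot[OF assms(1)]
  interpret finite_borel_measure "\<mu> w"
    by (rule finite_borel_measure_interval_measure[OF F F_at_top[OF assms(1)]]) (simp_all add: assms)
  have tot: "measure (\<mu> w) UNIV = norm_sq w"
    using interval_measure_UNIV[OF F F_at_top[OF assms(1)]] assms by (simp add: measure_def)
  have "measure (\<mu> w) (UNIV - {..d}) = 0"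
    using measure_interval_measure_Iic[OF F, of d] assms(2) tot finite_measure_compl[of "{..d}"] by simp
  then have "{d<..} \<in> null_sets (\<mu> w)"
    by (auto simp: null_sets_def emeasure_eq_measure Compl_eq_Diff_UNIV[symmetric])
  then have ae: "AE t in \<mu> w. t \<le> d" by (rule AE_I') auto
  have "(\<integral>t. t \<partial>\<mu> w) \<le> (\<integral>t. d \<partial>\<mu> w)"
    by (rule integral_mono_AE) (use ae form_eq[OF assms(1)] in auto)
  also have "\<dots> = d * norm_sq w" using tot by simp
  finally show ?thesis using form_eq(2)[OF assms(1)] by simp
qed

lemma form_lincomb:
  assumes "x \<in> ell2" "y \<in> ell2"
  shows "ell2_inner (lincomb 1 x l y) (T (lincomb 1 x l y)) =
    ell2_inner x (T x) + l * ell2_inner x (T y) + cnj l * ell2_inner y (T x) + l * cnj l * ell2_inner y (T y)"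
  unfolding T_lincomb using assms
  by (simp only: ell2_inner_left_lincomb ell2_inner_right_lincomb ell2_lincomb T_ell2)
    (simp add: algebra_simps)

text \<open>Polarization: a form that is real on the diagonal is hermitian.\<close>
lemma T_hermitian:
  assumes "x \<in> ell2" "y \<in> ell2"
  shows "ell2_inner y (T x) = cnj (ell2_inner x (T y))"
proof -
  have real: "Im (ell2_inner u (T u)) = 0" if "u \<in> ell2" for u
    using form_eq(2)[OF that] by simp
  note eq = form_lincomb[OF assms]
  have "Im (ell2_inner x (T y) + ell2_inner y (T x)) = 0"
    using real[OF ell2_lincomb, OF assms, of 1 1] eq[of 1] real[OF assms(1)] real[OF assms(2)] by simp
  moreover have "Re (ell2_inner x (T y) - ell2_inner y (T x)) = 0"
    using real[OF ell2_lincomb, OF assms, of 1 \<i>] eq[of \<i>] real[OF assms(1)] real[OF assms(2)] by simp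
  ultimately show ?thesis by (simp add: complex_eq_iff)
qed

text \<open>The vectors \<open>x\<close> and \<open>y\<close> lie in the range of \<open>E
  t\<close> and in its complement, so \<open>E s x\<close> and \<open>E s y\<close> are
  orthogonal for every \<open>s\<close>. Therefore \<open>x + l y\<close> has the same spectral
  measure, hence the same value of the quadratic form, for all \<open>l\<close> of modulus 1.
  Comparing the values for \<open>1, -1, \<i>, -\<i>\<close> removes the mixed terms.\<close>
lemma T_E_orthogonal:
  fixes t :: real
  assumes "p \<in> ell2" "q \<in> ell2"
  defines "x \<equiv> E t p" and "y \<equiv> lincomb 1 q (-1) (E t q)"
  shows "ell2_inner x (T y) = 0" "ell2_inner y (T x) = 0"
proof -
  have xy: "x \<in> ell2" "y \<in> ell2" using assms by (simp_all add: x_def y_def)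
  define Q where "Q l = ell2_inner (lincomb 1 x l y) (T (lincomb 1 x l y))" for l
  have orth: "ell2_inner (E s x) (E s y) = 0" for s
  proof -
    have "ell2_inner (E s x) (E s y) = ell2_inner p (E t (E s y))"
      using xy assms by (simp add: E_adjoint E_E x_def min.commute min.left_commute)
    also have "E t (E s y) = (\<lambda>n. 0)"
    proof -
      have "E t (E s y) = lincomb 1 (E (min t s) q) (-1) (E (min t (min s t)) q)"
        using assms xy unfolding y_def by (simp only: E_E E_lincomb E_ell2)
      then show ?thesis by (simp add: min.commute min.left_commute)
    qed
    finally show ?thesis by (simp add: ell2_inner_def)
  qed
  have "F (lincomb 1 x l y) = F (lincomb 1 x 1 y)" if "cmod l = 1" for l
  proof
    fix s
    have "F (lincomb 1 x k y) s = F x s + (cmod k)\<^sup>2 * F y s" for k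
      unfolding F_def E_lincomb[OF xy] using xy orth by (subst norm_sq_lincomb) auto
    then show "F (lincomb 1 x l y) s = F (lincomb 1 x 1 y) s"
      using that by (simp only: norm_one)
  qed
  then have const: "Q l = Q 1" if "cmod l = 1" for l
    unfolding Q_def form_eq(2)[OF ell2_lincomb[OF xy]] using that by metis
  have "Q l = ell2_inner x (T x) + l * ell2_inner x (T y) + cnj l * ell2_inner y (T x)
      + l * cnj l * ell2_inner y (T y)" for l
    unfolding Q_def by (rule form_lincomb[OF xy])
  with const[of "-1"] const[of \<i>] const[of "-\<i>"]
  have "ell2_inner x (T y) + ell2_inner y (T x) = 0" "ell2_inner x (T y) - ell2_inner y (T x) = 0"
    by (simp_all add: complex_eq_iff)
  then show "ell2_inner x (T y) = 0" "ell2_inner y (T x) = 0" by (simp_all add: complex_eq_iff)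
qed

text \<open>Both sides have the same inner product with every \<open>q\<close>: by orthogonality
  one may replace \<open>q\<close> by \<open>E t q\<close> and then \<open>E t p\<close> by
  \<open>p\<close>.\<close>
lemma T_E_commute:
  assumes p: "p \<in> ell2"
  shows "T (E t p) = E t (T p)"
proof (rule ell2_ext)
  fix q assume q: "q \<in> ell2"
  have "ell2_inner q (T (E t p)) = ell2_inner (E t q) (T (E t p))"
    using T_E_orthogonal(2)[OF p q, of t] p q by (subst (asm) ell2_inner_left_lincomb) auto
  also have "\<dots> = ell2_inner (E t q) (T p)"
    using T_E_orthogonal(1)[OF q p, of t] p q unfolding T_lincomb
    by (subst (asm) ell2_inner_right_lincomb) auto
  also have "\<dots> = ell2_inner q (E t (T p))" using p q by (simp add: E_adjoint)
  finally show "ell2_inner q (T (E t p)) = ell2_inner q (E t (T p))" .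
qed (use p in auto)

text \<open>On the range of \<open>E t\<close> the quadratic form is at most \<open>t\<close>
  times the squared norm; for \<open>t < - C\<close> this contradicts the bound by
  \<open>C\<close> unless the range is zero.\<close>
lemma F_below:
  assumes u: "u \<in> ell2" and "t < - C"
  shows "F u t = 0"
proof -
  define w where "w = E t u"
  have w: "w \<in> ell2" using u by (simp add: w_def)
  have "F w t = norm_sq w" using u by (simp add: w_def F_def E_E)
  from form_upper[OF w this] have "Re (ell2_inner w (T w)) \<le> t * norm_sq w" .
  moreover have "- C * norm_sq w \<le> Re (ell2_inner w (T w))"
    using T_bound[OF w] abs_Re_le_cmod[of "ell2_inner w (T w)"] by simp
  ultimately have "(- C - t) * norm_sq w \<le> 0" by (simp add: algebra_simps)
  then have "norm_sq w = 0"
    using assms(2) norm_sq_nonneg[OF w] by (auto simp: mult_le_0_iff)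
  then show ?thesis by (simp add: F_def w_def)
qed

lemma F_above:
  assumes u: "u \<in> ell2" and "C < t"
  shows "F u t = norm_sq u"
proof -
  define w where "w = lincomb 1 u (-1) (E t u)"
  have w: "w \<in> ell2" using u by (simp add: w_def)
  have "E t w = (\<lambda>n. 0)" using u unfolding w_def by (subst E_lincomb) (auto simp: E_E)
  then have "F w t = 0" by (simp add: F_def norm_sq_def)
  from form_lower[OF w this] have "t * norm_sq w \<le> Re (ell2_inner w (T w))" .
  moreover have "Re (ell2_inner w (T w)) \<le> C * norm_sq w"
    using T_bound[OF w] abs_Re_le_cmod[of "ell2_inner w (T w)"] by simp
  ultimately have "(t - C) * norm_sq w \<le> 0" by (simp add: algebra_simps)
  then have "norm_sq w = 0"
    using assms(2) norm_sq_nonneg[OF w] by (auto simp: mult_le_0_iff)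
  then show ?thesis using norm_sq_E_codiff[OF u, of t] by (simp add: w_def)
qed

lemma E_below:
  assumes "u \<in> ell2" "t < - C"
  shows "E t u = (\<lambda>n. 0)"
proof
  fix n
  have "norm_sq (E t u) = 0" using F_below[OF assms] by (simp add: F_def)
  then show "E t u n = 0" using assms(1) by (intro norm_sq_eq_0) auto
qed

lemma E_above:
  assumes "u \<in> ell2" "C < t"
  shows "E t u = u"
proof
  fix n
  have "norm_sq (lincomb 1 u (-1) (E t u)) = 0"
    using F_above[OF assms] norm_sq_E_codiff[OF assms(1)] by simp
  then have "lincomb 1 u (-1) (E t u) n = 0" using assms(1) by (intro norm_sq_eq_0) auto
  then show "E t u n = u n" by simp
qed

text \<open>On vectors in the spectral window between \<open>c\<close> and \<open>c + h\<close>
  the form of \<open>A = T - c\<close> lies between \<open>0\<close> and \<open>h\<close> times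
  the squared norm, and the window is invariant under \<open>A\<close>. A positive form bounded
  by \<open>h\<close> belongs to an operator of norm at most \<open>h\<close>: this is its
  Cauchy-Schwarz inequality, obtained by evaluating the form at \<open>w - (1 / h) * A
  w\<close>.\<close>
lemma spectral_window_bound:
  assumes w: "w \<in> ell2" and lo: "E c w = (\<lambda>n. 0)" and hi: "E (c + h) w = w" and "h > 0"
  shows "norm_sq (lincomb 1 (T w) (- of_real c) w) \<le> h\<^sup>2 * norm_sq w"
proof -
  define A where "A u = lincomb 1 (T u) (- of_real c) u" for u
  have A_ell2: "A u \<in> ell2" if "u \<in> ell2" for u
    unfolding A_def using that by (intro ell2_lincomb T_ell2)
  have T0: "T (\<lambda>n. 0) = (\<lambda>n. 0)" using T_lincomb[of 0 w 0 w] by simp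
  define y where "y = A w"
  have y: "y \<in> ell2" using w by (simp add: y_def A_ell2)
  have y_lo: "E c y = (\<lambda>n. 0)"
    using w lo T0 unfolding y_def A_def by (subst E_lincomb) (auto simp flip: T_E_commute)
  have y_hi: "E (c + h) y = y"
    using w hi unfolding y_def A_def by (subst E_lincomb) (auto simp flip: T_E_commute)
  have A_inner: "ell2_inner v (A u) = ell2_inner v (T u) - of_real c * ell2_inner v u"
    if "u \<in> ell2" "v \<in> ell2" for u v
    using that unfolding A_def by (subst ell2_inner_right_lincomb) auto
  have A_herm: "ell2_inner w (A y) = of_real (norm_sq y)"
  proof -
    have "ell2_inner w (A y) = cnj (ell2_inner y (A w))"
      using A_inner w y T_hermitian[OF w y] T_hermitian[OF y w] ell2_inner_commute[OF y w] by simp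
    then show ?thesis using y by (simp add: y_def[symmetric] ell2_inner_self)
  qed
  have upper: "Re (ell2_inner u (A u)) \<le> h * norm_sq u" if u: "u \<in> ell2" "E (c + h) u = u" for u
    using form_upper[OF u(1), of "c + h"] u by (simp add: A_inner F_def ell2_inner_self algebra_simps)
  \<comment> \<open>The value of \<open>s\<close> that optimizes the lower bound of the form at \<open>w - s * y\<close>.\<close>
  define s where "s = 1 / h"
  define x where "x = lincomb 1 w (- of_real s) y"
  have x: "x \<in> ell2" unfolding x_def using w y by (intro ell2_lincomb)
  have "E c x = (\<lambda>n. 0)" using w y lo y_lo unfolding x_def by (subst E_lincomb) auto
  then have "0 \<le> Re (ell2_inner x (A x))"
    using form_lower[OF x, of c] x by (simp add: A_inner F_def norm_sq_def[of "\<lambda>n. 0"] ell2_inner_self)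
  moreover have "A x = lincomb 1 (A w) (- of_real s) (A y)"
    unfolding A_def x_def T_lincomb by (simp add: fun_eq_iff algebra_simps)
  then have "ell2_inner x (A x) = ell2_inner w (A w) - of_real s * ell2_inner w (A y)
      - of_real s * ell2_inner y (A w) + of_real s * of_real s * ell2_inner y (A y)"
    using w y unfolding x_def
    by (simp only: ell2_inner_left_lincomb ell2_inner_right_lincomb ell2_lincomb A_ell2)
      (simp add: algebra_simps)
  then have "Re (ell2_inner x (A x)) = Re (ell2_inner w (A w)) - 2 * s * norm_sq y
      + s\<^sup>2 * Re (ell2_inner y (A y))"
    using y by (simp add: A_herm y_def[symmetric] ell2_inner_self power2_eq_square)
  moreover have "s\<^sup>2 * Re (ell2_inner y (A y)) \<le> s\<^sup>2 * (h * norm_sq y)"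
    by (intro mult_left_mono upper y y_hi) simp
  moreover have "s\<^sup>2 * (h * norm_sq y) = s * norm_sq y"
    using \<open>h > 0\<close> by (simp add: s_def power2_eq_square)
  moreover have "Re (ell2_inner w (A w)) \<le> h * norm_sq w" by (intro upper w hi)
  ultimately have "s * norm_sq y \<le> h * norm_sq w" by linarith
  then have "norm_sq y \<le> h * (h * norm_sq w)"
    using \<open>h > 0\<close> by (simp add: s_def field_simps)
  then show ?thesis by (simp add: y_def A_def power2_eq_square algebra_simps)
qed

text \<open>The additional 1 puts both end points strictly outside the interval that carries the
  spectral measures.\<close>
definition grid :: "nat \<Rightarrow> nat \<Rightarrow> real" where
  "grid m i = - (\<bar>C\<bar> + 1) + real i * (2 * (\<bar>C\<bar> + 1) / real m)"

lemma grid_Suc: "grid m (Suc i) = grid m i + 2 * (\<bar>C\<bar> + 1) / real m"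
  by (simp add: grid_def algebra_simps add_divide_distrib)

lemma grid_ends: "grid m 0 < - C" "m > 0 \<Longrightarrow> C < grid m m"
  by (auto simp: grid_def)

text \<open>Cut \<open>v\<close> into its components \<open>P i v\<close> in the spectral
  windows of the grid. Since \<open>T\<close> commutes with the projections, \<open>P i
  u\<close> is \<open>(t i - z)\<close> times \<open>P i v\<close> up to an error controlled by
  the mesh, so that \<open>P i v\<close> contributes the \<open>i\<close>-th term of a Riemann
  sum of \<open>1 / (t - z)\<close>. The squared norms of the pieces add up to those of
  \<open>u\<close> and \<open>v\<close>.\<close>
lemma resolvent_form_riemann_sum:
  assumes u: "u \<in> ell2" and v: "v \<in> ell2" and z: "Im z > 0"
    and uv: "lincomb 1 (T v) (- z) v = u" and m: "m > 0"
  defines "h \<equiv> 2 * (\<bar>C\<bar> + 1) / real m"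
  shows "cmod (ell2_inner u v - (\<Sum>i<m. of_real (F u (grid m (Suc i)) - F u (grid m i)) / (of_real (grid m i) - z)))
    \<le> h * (norm_sq u + norm_sq v) / (2 * Im z)"
proof -
  have "h > 0" using m by (simp add: h_def)
  define t where "t = grid m"
  have t_Suc: "t (Suc i) = t i + h" for i by (simp add: t_def h_def grid_Suc)
  define P where "P i x = lincomb 1 (E (t (Suc i)) x) (-1) (E (t i) x)" for i x
  have P_ell2: "P i x \<in> ell2" if "x \<in> ell2" for i x unfolding P_def using that by (intro ell2_lincomb E_ell2)
  have P_nsq: "norm_sq (P i x) = F x (t (Suc i)) - F x (t i)" if "x \<in> ell2" for i x
    using norm_sq_E_diff[OF that, of "t i" "t (Suc i)"] t_Suc[of i] \<open>h > 0\<close> by (simp add: P_def)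
  have sum_nsq: "(\<Sum>i<m. norm_sq (P i x)) = norm_sq x" if "x \<in> ell2" for x
  proof -
    have "(\<Sum>i<m. norm_sq (P i x)) = F x (t m) - F x (t 0)"
      using that by (simp add: P_nsq sum_lessThan_telescope[of "\<lambda>i. F x (t i)"])
    then show ?thesis using F_below[OF that] F_above[OF that] grid_ends[of m] m by (simp add: t_def)
  qed
  have E_P: "E s (P i x) = lincomb 1 (E (min s (t (Suc i))) x) (-1) (E (min s (t i)) x)"
    if "x \<in> ell2" for s i x
    using that unfolding P_def by (subst E_lincomb) (auto simp: E_E)
  have term_bound: "cmod (ell2_inner u (P i v) - of_real (norm_sq (P i u)) / (of_real (t i) - z))
      \<le> h / (2 * Im z) * (norm_sq (P i u) + norm_sq (P i v))" for i
  proof -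
    define w where "w = P i v"
    define c where "c = t i"
    have w: "w \<in> ell2" using v by (simp add: w_def P_ell2)
    have lo: "E c w = (\<lambda>n. 0)" and hi: "E (c + h) w = w"
      using v t_Suc[of i] \<open>h > 0\<close> unfolding w_def by (auto simp: E_P c_def min_def) (auto simp: P_def)
    define e where "e = lincomb 1 (T w) (- of_real c) w"
    have e: "e \<in> ell2" unfolding e_def using w by (intro ell2_lincomb T_ell2)
    have Tw: "T w = lincomb 1 (E (t (Suc i)) (T v)) (-1) (E (t i) (T v))"
      using v unfolding w_def P_def by (subst T_lincomb) (simp add: T_E_commute)
    have Pu: "P i u = lincomb (of_real c - z) w 1 e"
    proof
      fix n
      have "P i u n = (E (t (Suc i)) (T v) n - z * E (t (Suc i)) v n) - (E (t i) (T v) n - z * E (t i) v n)"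
        using v unfolding P_def uv[symmetric] by (subst (1 2) E_lincomb) auto
      also have "\<dots> = T w n - z * w n" unfolding Tw by (simp add: w_def P_def algebra_simps)
      finally show "P i u n = (of_real c - z) * w n + 1 * e n" by (simp add: e_def algebra_simps)
    qed
    have P_adj: "ell2_inner (P i u) (P i v) = ell2_inner u (P i v)"
    proof -
      have ww: "lincomb 1 (E (t (Suc i)) w) (-1) (E (t i) w) = w"
        using hi lo t_Suc[of i] by (simp add: c_def)
      have "ell2_inner (P i u) w = ell2_inner u (lincomb 1 (E (t (Suc i)) w) (-1) (E (t i) w))"
        unfolding P_def using u w
        by (simp only: ell2_inner_left_lincomb ell2_inner_right_lincomb E_ell2 E_adjoint) simp
      then show ?thesis unfolding ww by (simp add: w_def)
    qed
    have Puw: "P i u \<in> ell2" using u by (rule P_ell2)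
    have "of_real (norm_sq (P i u)) = ell2_inner (P i u) (lincomb (of_real c - z) w 1 e)"
      using ell2_inner_self[OF Puw] Pu by simp
    also have "\<dots> = (of_real c - z) * ell2_inner u w + ell2_inner (P i u) e"
      using Puw w e P_adj by (subst ell2_inner_right_lincomb) (auto simp: w_def)
    finally have "ell2_inner u w - of_real (norm_sq (P i u)) / (of_real c - z)
        = - (ell2_inner (P i u) e * (1 / (of_real c - z)))"
      using of_real_diff_nonreal[OF z, of c] by (simp add: field_simps)
    also have "cmod \<dots> \<le> (h * norm_sq (P i u) + norm_sq e / h) / 2 * (1 / Im z)"
      unfolding norm_minus_cancel norm_mult
      using ell2_inner_bound[OF Puw e \<open>h > 0\<close>] cmod_inverse_of_real_diff_le[OF z, of c]
        norm_sq_nonneg[OF Puw] norm_sq_nonneg[OF e] \<open>h > 0\<close>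
      by (intro mult_mono) (auto simp: add_nonneg_nonneg)
    also have "\<dots> \<le> (h * norm_sq (P i u) + h * norm_sq w) / 2 * (1 / Im z)"
    proof -
      have "norm_sq e \<le> h\<^sup>2 * norm_sq w"
        unfolding e_def by (rule spectral_window_bound[OF w lo hi \<open>h > 0\<close>])
      then have "norm_sq e / h \<le> h * norm_sq w"
        using \<open>h > 0\<close> by (simp add: field_simps power2_eq_square)
      then show ?thesis using z by (intro mult_right_mono divide_right_mono add_left_mono) auto
    qed
    finally show ?thesis by (simp add: w_def c_def algebra_simps add_divide_distrib)
  qed
  have decomp: "ell2_inner u v = (\<Sum>i<m. ell2_inner u (P i v))"
  proof -
    have "ell2_inner u (P i v) = ell2_inner u (E (t (Suc i)) v) - ell2_inner u (E (t i) v)" for i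
      using u v unfolding P_def by (subst ell2_inner_right_lincomb) auto
    then have "(\<Sum>i<m. ell2_inner u (P i v)) = ell2_inner u (E (t m) v) - ell2_inner u (E (t 0) v)"
      by (simp add: sum_lessThan_telescope[of "\<lambda>i. ell2_inner u (E (t i) v)"])
    then show ?thesis using E_below[OF v] E_above[OF v] grid_ends[of m] m by (simp add: t_def ell2_inner_def)
  qed
  have "cmod (ell2_inner u v - (\<Sum>i<m. of_real (norm_sq (P i u)) / (of_real (t i) - z)))
      \<le> (\<Sum>i<m. h / (2 * Im z) * (norm_sq (P i u) + norm_sq (P i v)))"
    unfolding decomp sum_subtractf[symmetric]
    by (rule order_trans[OF norm_sum]) (intro sum_mono term_bound)
  also have "\<dots> = h * (norm_sq u + norm_sq v) / (2 * Im z)"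
    unfolding sum_distrib_left[symmetric] sum.distrib sum_nsq[OF u] sum_nsq[OF v] by simp
  finally show ?thesis unfolding P_nsq[OF u] t_def .
qed

end

lemma stieltjes_riemann_sum:
  fixes G :: "real \<Rightarrow> real"
  assumes mono: "\<And>x y. x \<le> y \<Longrightarrow> G x \<le> G y" and rc: "\<And>a. continuous (at_right a) G"
    and lo: "\<And>t. t < - K \<Longrightarrow> G t = 0" and hi: "\<And>t. t > K \<Longrightarrow> G t = 1"
    and z: "Im z > 0"
    and t0: "t 0 < - K" and tm: "K < t m" and t_Suc: "\<And>i. t (Suc i) = t i + h" and "h > 0"
  shows "prob_on (\<bar>K\<bar> + 1) (interval_measure G)"
    and "cmod (stieltjes (interval_measure G) z
      - (\<Sum>i<m. of_real (G (t (Suc i)) - G (t i)) / (of_real (t i) - z))) \<le> h / (Im z)\<^sup>2"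
proof -
  let ?M = "interval_measure G"
  have bot: "(G \<longlongrightarrow> 0) at_bot"
    by (rule tendsto_eventually) (auto simp: eventually_at_bot_dense intro!: exI[of _ "- K"] lo)
  have top: "(G \<longlongrightarrow> 1) at_top"
    by (rule tendsto_eventually) (auto simp: eventually_at_top_dense intro!: exI[of _ K] hi)
  interpret real_distribution ?M by (rule real_distribution_interval_measure[OF mono rc bot top])
  have ae: "AE t in ?M. t \<in> {x<..y}" if "x < - K" "K < y" for x y
  proof -
    have "measure ?M {x<..y} = 1"
      using measure_interval_measure_Ioc[of x y G] mono rc lo[OF that(1)] hi[OF that(2)] that mono[of y x]
      by (cases "x \<le> y") (auto intro: order.strict_implies_order)
    then show ?thesis by (subst prob_eq_1[symmetric]) auto
  qed
  have "AE t in ?M. t \<in> {-\<bar>K\<bar> - 1<..\<bar>K\<bar> + 1}" by (rule ae) auto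
  then have "AE t in ?M. \<bar>t\<bar> \<le> \<bar>K\<bar> + 1" by (rule AE_mp) auto
  then show on: "prob_on (\<bar>K\<bar> + 1) ?M" using real_distribution_axioms by (simp add: prob_on_def)
  define f where "f x = 1 / (of_real x - z)" for x :: real
  have f_lip: "cmod (f x - f y) \<le> \<bar>x - y\<bar> / (Im z)\<^sup>2" for x y
  proof -
    have "f x - f y = of_real (y - x) * (f x * f y)"
      using of_real_diff_nonreal[OF z] by (simp add: f_def field_simps)
    then have "cmod (f x - f y) = \<bar>x - y\<bar> * (cmod (f x) * cmod (f y))"
      by (simp only: norm_mult norm_of_real) (simp add: abs_minus_commute)
    also have "\<dots> \<le> \<bar>x - y\<bar> * (1 / Im z * (1 / Im z))"
      unfolding f_def using cmod_inverse_of_real_diff_le[OF z] z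
      by (intro mult_left_mono mult_mono) auto
    finally show ?thesis by (simp add: power2_eq_square)
  qed
  define \<phi> where "\<phi> x = (\<Sum>i<m. indicator {t i<..t (Suc i)} x *\<^sub>R f (t i))" for x
  have t_mono: "t i \<le> t (Suc i)" for i using t_Suc \<open>h > 0\<close> by simp
  have int_ind: "integrable ?M (\<lambda>x. indicator {t i<..t (Suc i)} x *\<^sub>R f (t i))" for i
    by (intro integrable_scaleR_left integrable_real_indicator) (auto simp: emeasure_eq_measure)
  have "(\<integral>x. \<phi> x \<partial>?M) = (\<Sum>i<m. of_real (G (t (Suc i)) - G (t i)) / (of_real (t i) - z))"
    unfolding \<phi>_def
    by (subst Bochner_Integration.integral_sum[OF int_ind], intro sum.cong refl)
      (simp add: measure_interval_measure_Ioc[OF t_mono mono rc] f_def scaleR_conv_of_real)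
  note int_\<phi>_eq = this
  have int_\<phi>: "integrable ?M \<phi>" unfolding \<phi>_def by (intro Bochner_Integration.integrable_sum int_ind)
  have int_f: "integrable ?M f"
    unfolding f_def using of_real_diff_nonreal[OF z]
    by (intro prob_on_integrable[OF on] continuous_intros) auto
  have "stieltjes ?M z = (\<integral>x. f x \<partial>?M)" by (simp add: stieltjes_def f_def)
  with int_\<phi>_eq int_f int_\<phi> have "stieltjes ?M z - (\<Sum>i<m. of_real (G (t (Suc i)) - G (t i)) / (of_real (t i) - z))
      = (\<integral>x. f x - \<phi> x \<partial>?M)"
    by simp
  also have "cmod \<dots> \<le> (\<integral>x. cmod (f x - \<phi> x) \<partial>?M)" by simp
  also have "\<dots> \<le> (\<integral>x. h / (Im z)\<^sup>2 \<partial>?M)"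
  proof (rule integral_mono_AE)
    show "AE x in ?M. cmod (f x - \<phi> x) \<le> h / (Im z)\<^sup>2"
      using ae[OF t0 tm]
    proof eventually_elim
      case (elim x)
      have tel: "(\<Sum>i<n. indicator {t i<..t (Suc i)} x) = (indicator {t 0<..t n} x :: real)" for n
      proof (induction n)
        case (Suc n)
        have "t 0 \<le> t n" by (induction n) (use t_mono order_trans in auto)
        then show ?case using Suc t_mono[of n] by (auto simp: indicator_def)
      qed simp
      have "f x = (\<Sum>i<m. indicator {t i<..t (Suc i)} x *\<^sub>R f x)"
        unfolding scaleR_left.sum[symmetric] tel using elim by simp
      then have "f x - \<phi> x = (\<Sum>i<m. indicator {t i<..t (Suc i)} x *\<^sub>R (f x - f (t i)))"
        unfolding \<phi>_def by (simp add: scaleR_diff_right sum_subtractf)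
      also have "cmod \<dots> \<le> (\<Sum>i<m. indicator {t i<..t (Suc i)} x * (h / (Im z)\<^sup>2))"
      proof (rule order_trans[OF norm_sum], rule sum_mono)
        fix i
        show "cmod (indicator {t i<..t (Suc i)} x *\<^sub>R (f x - f (t i)))
            \<le> indicator {t i<..t (Suc i)} x * (h / (Im z)\<^sup>2)"
        proof (cases "x \<in> {t i<..t (Suc i)}")
          case True
          then have "\<bar>x - t i\<bar> / (Im z)\<^sup>2 \<le> h / (Im z)\<^sup>2"
            using t_Suc[of i] by (intro divide_right_mono) auto
          then show ?thesis using f_lip[of x "t i"] True by simp
        qed simp
      qed
      also have "\<dots> = h / (Im z)\<^sup>2"
        unfolding sum_distrib_right[symmetric] tel using elim by simp
      finally show ?case .
    qed
  qed (use int_f int_\<phi> in auto)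
  also have "\<dots> = h / (Im z)\<^sup>2" using prob_space by simp
  finally show "cmod (stieltjes (interval_measure G) z
      - (\<Sum>i<m. of_real (G (t (Suc i)) - G (t i)) / (of_real (t i) - z))) \<le> h / (Im z)\<^sup>2" .
qed

context bounded_spectral_resolution
begin

text \<open>Both sides are within a multiple of \<open>1 / m\<close> of the same Riemann sum on
  the grid with \<open>m\<close> cells. Riemann sums are linear in the distribution function,
  which takes care of the average over \<open>n\<close>.\<close>
lemma nu_measure_stieltjes:
  assumes N: "N > 0" and z: "Im z > 0"
    and v: "\<And>n. n \<in> {1..N} \<Longrightarrow> v n \<in> ell2"
    and eq: "\<And>n. n \<in> {1..N} \<Longrightarrow> lincomb 1 (T (v n)) (- z) (v n) = delta n"
  shows "prob_on (\<bar>C\<bar> + 1) (nu_measure E N)"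
    and "stieltjes (nu_measure E N) z = (\<Sum>n=1..N. ell2_inner (delta n) (v n)) / of_nat N"
proof -
  define G where "G t = (\<Sum>n=1..N. F (delta n) t) / real N" for t
  have nu: "nu_measure E N = interval_measure G"
    unfolding nu_measure_def G_def by (simp add: F_eq_ell2_norm delta_ell2)
  have mono: "G x \<le> G y" if "x \<le> y" for x y
    unfolding G_def using that by (intro divide_right_mono sum_mono F_mono) (auto simp: delta_ell2)
  have rc: "continuous (at_right x) G" for x
  proof -
    have "continuous (at_right x) (F (delta n))" if "n \<in> {1..N}" for n
      using that by (intro F_right_continuous delta_ell2) auto
    then have "((\<lambda>t. (\<Sum>n=1..N. F (delta n) t) / real N) \<longlongrightarrow> (\<Sum>n=1..N. F (delta n) x) / real N) (at_right x)"
      unfolding continuous_within using N by (intro tendsto_divide tendsto_sum tendsto_const) auto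
    then show ?thesis unfolding continuous_within G_def .
  qed
  have lo: "G t = 0" if "t < - C" for t unfolding G_def using that by (simp add: F_below delta_ell2)
  have hi: "G t = 1" if "C < t" for t
    unfolding G_def using that N by (simp add: F_above delta_ell2 norm_sq_delta)
  note stieltjes = stieltjes_riemann_sum[where G = G and K = C, OF mono rc lo hi z grid_ends(1) grid_ends(2) grid_Suc]
  show "prob_on (\<bar>C\<bar> + 1) (nu_measure E N)"
    unfolding nu by (rule stieltjes(1)[of 1]) auto
  define S where "S = (\<Sum>n=1..N. ell2_inner (delta n) (v n)) / of_nat N"
  define B where "B = 2 * (\<bar>C\<bar> + 1) * (1 / (Im z)\<^sup>2 + (\<Sum>n=1..N. (1 + norm_sq (v n)) / (2 * Im z)) / real N)"
  have bound: "cmod (stieltjes (interval_measure G) z - S) \<le> B / real m" if "m > 0" for m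
  proof -
    define h where "h = 2 * (\<bar>C\<bar> + 1) / real m"
    define R where "R = (\<Sum>i<m. of_real (G (grid m (Suc i)) - G (grid m i)) / (of_real (grid m i) - z))"
    define Q where "Q n = (\<Sum>i<m. of_real (F (delta n) (grid m (Suc i)) - F (delta n) (grid m i)) / (of_real (grid m i) - z))" for n
    have R: "R = (\<Sum>n=1..N. Q n) / of_nat N"
    proof -
      have "R = (\<Sum>i<m. \<Sum>n=1..N. of_real (F (delta n) (grid m (Suc i)) - F (delta n) (grid m i)) / (of_real (grid m i) - z) / of_nat N)"
        unfolding R_def G_def
        by (intro sum.cong refl)
          (simp add: sum_subtractf diff_divide_distrib sum_divide_distrib[symmetric] of_real_sum mult.commute)
      also have "\<dots> = (\<Sum>n=1..N. Q n / of_nat N)"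
        unfolding Q_def sum_divide_distrib by (rule sum.swap)
      finally show ?thesis by (simp add: sum_divide_distrib)
    qed
    have "cmod (S - R) \<le> (\<Sum>n=1..N. h * ((1 + norm_sq (v n)) / (2 * Im z))) / real N"
    proof -
      have "S - R = (\<Sum>n=1..N. ell2_inner (delta n) (v n) - Q n) / of_nat N"
        unfolding S_def R by (simp add: sum_subtractf diff_divide_distrib)
      also have "cmod \<dots> \<le> (\<Sum>n=1..N. cmod (ell2_inner (delta n) (v n) - Q n)) / real N"
        unfolding norm_divide norm_of_nat by (intro divide_right_mono norm_sum) simp
      also have "\<dots> \<le> (\<Sum>n=1..N. h * ((1 + norm_sq (v n)) / (2 * Im z))) / real N"
        using resolvent_form_riemann_sum[OF delta_ell2 v z eq \<open>m > 0\<close>]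
        by (intro divide_right_mono sum_mono) (simp_all add: Q_def h_def norm_sq_delta)
      finally show ?thesis .
    qed
    moreover have "cmod (stieltjes (interval_measure G) z - R) \<le> h / (Im z)\<^sup>2"
      unfolding R_def h_def by (rule stieltjes(2)) (use \<open>m > 0\<close> in auto)
    ultimately have "cmod (stieltjes (interval_measure G) z - S)
        \<le> h / (Im z)\<^sup>2 + (\<Sum>n=1..N. h * ((1 + norm_sq (v n)) / (2 * Im z))) / real N"
      using norm_triangle_ineq4[of "stieltjes (interval_measure G) z - R" "S - R"] by simp
    also have "\<dots> = B / real m"
    proof -
      have "c / m / i + (c / m * X) / n = c * (1 / i + X / n) / m" for c m i X n :: real
        by (simp add: distrib_left add_divide_distrib mult.commute)
      then show ?thesis unfolding sum_distrib_left[symmetric] B_def h_def .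
    qed
    finally show ?thesis .
  qed
  have "cmod (stieltjes (interval_measure G) z - S) \<le> 0"
  proof (rule tendsto_lowerbound[OF lim_const_over_n])
    show "\<forall>\<^sub>F m in sequentially. cmod (stieltjes (interval_measure G) z - S) \<le> B / real m"
      using eventually_gt_at_top[of 0] by eventually_elim (rule bound)
  qed simp
  then show "stieltjes (nu_measure E N) z = (\<Sum>n=1..N. ell2_inner (delta n) (v n)) / of_nat N"
    by (simp add: nu S_def)
qed

end

section \<open>Solutions of the difference equation\<close>

text \<open>The convention \<open>a 0 = 1\<close> normalizes the Wronskian of the two solutions
  to 1.\<close>
locale jacobi_coefficients =
  fixes a b :: "nat \<Rightarrow> real" and M :: real
  assumes M_pos: "M > 0" and a_0 [simp]: "a 0 = 1"
    and a_bounds: "n \<ge> 1 \<Longrightarrow> 1 / (M + 1) \<le> a n \<and> a n \<le> M + 1"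
    and b_bound: "n \<ge> 1 \<Longrightarrow> \<bar>b n\<bar> \<le> M"
begin

lemma a_pos [simp]: "0 < a n"
  using a_bounds[of n] M_pos by (cases "n = 0") (auto intro: less_le_trans[of _ "1 / (M + 1)"])

lemma a_nonzero [simp]: "a n \<noteq> 0"
  using a_pos[of n] by linarith

lemma a_le: "a n \<le> M + 1"
  using a_bounds[of n] M_pos by (cases "n = 0") auto

abbreviation solves :: "complex \<Rightarrow> (nat \<Rightarrow> complex) \<Rightarrow> bool" where
  "solves z f \<equiv> (\<forall>k\<ge>1. difference_equation a b z f k)"

lemma solves_Suc:
  fixes f :: "nat \<Rightarrow> complex" and z :: complex
  shows "solves z f \<Longrightarrow> a (Suc n) * f (Suc (Suc n)) = (z - b (Suc n)) * f (Suc n) - a n * f n"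
  by (drule spec[of _ "Suc n"]) (simp add: difference_equation_def algebra_simps)

text \<open>The recursion for the solution with the given values at 0 and 1; both descriptions
  by a unique solution reduce to it.\<close>
fun sol :: "complex \<Rightarrow> complex \<Rightarrow> complex \<Rightarrow> nat \<Rightarrow> complex" where
  "sol z c d 0 = c"
| "sol z c d (Suc 0) = d"
| "sol z c d (Suc (Suc n)) = ((z - of_real (b (Suc n))) * sol z c d (Suc n) - of_real (a n) * sol z c d n) / of_real (a (Suc n))"

lemma solves_sol: "solves z (sol z c d)"
proof (intro allI impI)
  fix k :: nat assume "k \<ge> 1"
  then obtain n where "k = Suc n" by (cases k) auto
  moreover have "of_real (a (Suc n)) * sol z c d (Suc (Suc n))
      = (z - of_real (b (Suc n))) * sol z c d (Suc n) - of_real (a n) * sol z c d n" by simp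
  ultimately show "difference_equation a b z (sol z c d) k"
    by (simp add: difference_equation_def algebra_simps del: sol.simps(3))
qed

lemma solves_eq_sol:
  assumes "solves z f"
  shows "f n = sol z (f 0) (f 1) n"
proof (induction n rule: less_induct)
  case (less n)
  consider "n = 0" | "n = 1" | k where "n = Suc (Suc k)" by (metis One_nat_def not0_implies_Suc)
  then show ?case
  proof cases
    case 3
    have "a (Suc k) * f n = a (Suc k) * sol z (f 0) (f 1) n"
      using solves_Suc[OF assms, of k] less[of k] less[of "Suc k"] 3 by simp
    then show ?thesis by simp
  qed auto
qed

lemma the_sol: "(THE f. solves z f \<and> f 0 = c \<and> f 1 = d) = sol z c d"
proof (rule the_equality)
  show "solves z (sol z c d) \<and> sol z c d 0 = c \<and> sol z c d 1 = d" using solves_sol by simp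
next
  fix f assume "solves z f \<and> f 0 = c \<and> f 1 = d"
  then show "f = sol z c d" using solves_eq_sol[of z f] by auto
qed

lemma sol_linear: "sol z c d n = c * sol z 1 0 n + d * sol z 0 1 n"
  by (induction n rule: induct_nat_012)
    (simp_all add: algebra_simps add_divide_distrib diff_divide_distrib)

text \<open>The two solutions are denoted by \<open>p\<close>, which is polynomial in
  \<open>z\<close>, and \<open>q\<close>, which will turn out to be the square summable
  one.\<close>
abbreviation p :: "nat \<Rightarrow> complex \<Rightarrow> complex" where "p \<equiv> f_minus a b"
abbreviation q :: "nat \<Rightarrow> complex \<Rightarrow> complex" where "q \<equiv> f_plus a b"

lemma p_eq_sol: "p n z = sol z 0 1 n"
  unfolding f_minus_def by (simp only: the_sol conj_assoc)

lemma q_eq_sol: "q n z = sol z 1 (- green a b 1 z) n"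
  unfolding f_plus_def by (simp only: the_sol conj_assoc)

lemma p_solves: "solves z (\<lambda>n. p n z)" and p_0 [simp]: "p 0 z = 0" and p_1 [simp]: "p (Suc 0) z = 1"
  using solves_sol[of z 0 1] by (simp_all add: p_eq_sol)

lemma q_solves: "solves z (\<lambda>n. q n z)" and q_0 [simp]: "q 0 z = 1"
  using solves_sol[of z 1 "- green a b 1 z"] by (simp_all add: q_eq_sol)

lemma wronskian_const:
  fixes f g :: "nat \<Rightarrow> complex"
  assumes "solves z f" "solves z g"
  shows "a n * (f (Suc n) * g n - f n * g (Suc n)) = f 1 * g 0 - f 0 * g 1"
proof (induction n)
  case (Suc n)
  have "a (Suc n) * (f (Suc (Suc n)) * g (Suc n) - f (Suc n) * g (Suc (Suc n)))
      = (a (Suc n) * f (Suc (Suc n))) * g (Suc n) - f (Suc n) * (a (Suc n) * g (Suc (Suc n)))"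
    by (simp add: algebra_simps)
  also have "\<dots> = a n * (f (Suc n) * g n - f n * g (Suc n))"
    unfolding solves_Suc[OF assms(1)] solves_Suc[OF assms(2)] by (simp add: algebra_simps)
  finally show ?case using Suc by simp
qed simp

lemma wronskian_p_q: "a n * (p (Suc n) z * q n z - p n z * q (Suc n) z) = 1"
  using wronskian_const[OF p_solves q_solves, of n z] by simp

text \<open>The imaginary part of the Wronskian of a solution with its complex conjugate. It
  grows by \<open>Im z\<close> times the squared modulus in each step, which is the source of
  all positivity statements below: it starts at 0 for \<open>p\<close> and ends at 0 for square
  summable solutions.\<close>
definition flux :: "(nat \<Rightarrow> complex) \<Rightarrow> nat \<Rightarrow> real" where
  "flux f n = a n * Im (cnj (f n) * f (Suc n))"

lemma flux_Suc:
  assumes "solves z f"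
  shows "flux f (Suc n) = flux f n + Im z * (cmod (f (Suc n)))\<^sup>2"
proof -
  have "flux f (Suc n) = Im (cnj (f (Suc n)) * (a (Suc n) * f (Suc (Suc n))))"
    by (simp add: flux_def algebra_simps)
  also have "\<dots> = flux f n + Im z * (cmod (f (Suc n)))\<^sup>2"
    unfolding solves_Suc[OF assms] cmod_power2 flux_def
    by (simp add: algebra_simps power2_eq_square)
  finally show ?thesis .
qed

lemma flux_mono:
  assumes "solves z f" "Im z > 0" "m \<le> n"
  shows "flux f m \<le> flux f n"
  using \<open>m \<le> n\<close> by (induction n rule: dec_induct) (use flux_Suc[OF assms(1)] assms(2) in \<open>auto intro: order_trans\<close>)

lemma flux_eq_sum:
  assumes "solves z f"
  shows "flux f n = flux f 0 + Im z * (\<Sum>k=1..n. (cmod (f k))\<^sup>2)"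
  by (induction n) (simp_all add: flux_Suc[OF assms] algebra_simps)

lemma flux_tendsto_0:
  assumes "summable (\<lambda>n. (cmod (f n))\<^sup>2)"
  shows "flux f \<longlonglongrightarrow> 0"
proof -
  have "(\<lambda>n. (cmod (f n))\<^sup>2) \<longlonglongrightarrow> 0" by (rule summable_LIMSEQ_zero[OF assms])
  then have "(\<lambda>n. sqrt ((cmod (f n))\<^sup>2)) \<longlonglongrightarrow> sqrt 0" by (intro tendsto_intros)
  then have f0: "(\<lambda>n. cmod (f n)) \<longlonglongrightarrow> 0" by simp
  then have "(\<lambda>n. (M + 1) * (cmod (f n) * cmod (f (Suc n)))) \<longlonglongrightarrow> (M + 1) * (0 * 0)"
    by (intro tendsto_intros LIMSEQ_Suc)
  then have "(\<lambda>n. (M + 1) * (cmod (f n) * cmod (f (Suc n)))) \<longlonglongrightarrow> 0" by simp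
  then show ?thesis
  proof (rule Lim_null_comparison[rotated], intro always_eventually allI)
    fix n
    have "\<bar>flux f n\<bar> = a n * \<bar>Im (cnj (f n) * f (Suc n))\<bar>" by (simp add: flux_def abs_mult abs_of_pos)
    also have "\<dots> \<le> (M + 1) * cmod (cnj (f n) * f (Suc n))"
      using a_le[of n] by (intro mult_mono abs_Im_le_cmod) (use M_pos in \<open>auto intro: less_imp_le\<close>)
    finally show "norm (flux f n) \<le> (M + 1) * (cmod (f n) * cmod (f (Suc n)))"
      by (simp only: norm_mult complex_mod_cnj real_norm_def)
  qed
qed

lemma flux_decay:
  assumes f: "solves z f" "Im z > 0" "summable (\<lambda>n. (cmod (f n))\<^sup>2)"
  shows "Im z * (cmod (f (Suc n)))\<^sup>2 \<le> - flux f n"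
proof -
  have "flux f (Suc n) \<le> 0"
    by (rule tendsto_lowerbound[OF flux_tendsto_0[OF f(3)]])
      (auto intro!: eventually_mono[OF eventually_ge_at_top[of "Suc n"]] flux_mono[OF f(1,2)])
  then show ?thesis using flux_Suc[OF f(1), of n] by simp
qed

section \<open>The resolvent and the Green function\<close>

lemma jacobi_eq:
  fixes u :: "nat \<Rightarrow> complex"
  shows "u 0 = 0 \<Longrightarrow> jacobi a b u (Suc n) = a (Suc n) * u (Suc (Suc n)) + a n * u n + b (Suc n) * u (Suc n)"
  by (auto simp: jacobi_def)

lemma jacobi_0 [simp]: "jacobi a b u 0 = 0"
  by (simp add: jacobi_def)

lemma jacobi_lincomb: "jacobi a b (lincomb c u d v) = lincomb c (jacobi a b u) d (jacobi a b v)"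
  by (auto simp: jacobi_def fun_eq_iff algebra_simps)

text \<open>For an eigenvector in the sequence space the flux vanishes at 0 and at infinity
  while being increasing, so the eigenvector is zero.\<close>
lemma resolvent_unique:
  assumes z: "Im z > 0" and u: "u \<in> ell2"
  shows "resolvent a b z (\<lambda>n. jacobi a b u n - z * u n) = u"
proof -
  have "inj_on (\<lambda>u n. jacobi a b u n - z * u n) ell2"
  proof (rule inj_onI)
    fix u v assume u: "u \<in> ell2" and v: "v \<in> ell2"
      and eq: "(\<lambda>n. jacobi a b u n - z * u n) = (\<lambda>n. jacobi a b v n - z * v n)"
    define d where "d = lincomb 1 u (-1) v"
    have d: "d \<in> ell2" unfolding d_def using u v by (rule ell2_lincomb)
    then have d0: "d 0 = 0" and sd: "summable (\<lambda>n. (cmod (d n))\<^sup>2)" by (auto simp: ell2_def)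
    have "jacobi a b d n = z * d n" for n
      using fun_cong[OF eq, of n] unfolding d_def jacobi_lincomb by (simp add: algebra_simps)
    then have "solves z d"
      using jacobi_eq[of d, OF d0] by (auto simp: difference_equation_def gr0_conv_Suc Suc_le_eq)
    then have decay: "Im z * (cmod (d (Suc n)))\<^sup>2 \<le> - flux d n" and mono: "flux d 0 \<le> flux d n" for n
      using flux_decay[OF _ z sd] flux_mono[OF _ z] by auto
    have "d (Suc n) = 0" for n
    proof -
      have "Im z * (cmod (d (Suc n)))\<^sup>2 \<le> 0" using decay[of n] mono[of n] by (simp add: flux_def d0)
      then show ?thesis using z by (simp add: mult_le_0_iff)
    qed
    then have "d n = 0" for n using d0 by (cases n) auto
    then show "u = v" by (auto simp: d_def fun_eq_iff)
  qed
  then show ?thesis unfolding resolvent_def by (rule inv_into_f_f[OF _ u])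
qed

lemma flux_p:
  assumes "Im z > 0" "n \<ge> 1"
  shows "flux (\<lambda>n. p n z) n \<ge> Im z * (cmod (p n z))\<^sup>2" "flux (\<lambda>n. p n z) n \<ge> Im z"
proof -
  have 0: "flux (\<lambda>n. p n z) 0 = 0" by (simp add: flux_def)
  obtain k where n: "n = Suc k" using assms(2) by (cases n) auto
  show "flux (\<lambda>n. p n z) n \<ge> Im z * (cmod (p n z))\<^sup>2"
    using flux_Suc[OF p_solves, of z k] flux_mono[OF p_solves assms(1), of 0 k] 0 n by simp
  have "flux (\<lambda>n. p n z) 1 = Im z" using flux_Suc[OF p_solves, of z 0] 0 by simp
  then show "flux (\<lambda>n. p n z) n \<ge> Im z" using flux_mono[OF p_solves assms] by simp
qed

lemma p_nonzero:
  assumes "Im z > 0" "n \<ge> 1"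
  shows "p n z \<noteq> 0"
  using flux_p(2)[OF assms] assms(1) by (auto simp: flux_def)

text \<open>The solution \<open>f N\<close> with the values 1 at 0 and 0 at \<open>N + 1\<close>
  satisfies, by comparison of its flux at both ends, a bound on the sum of squares that does not
  depend on \<open>N\<close>. Its value \<open>- m N\<close> at 1 is therefore bounded, and any
  limit point of \<open>m\<close> yields a solution for which the bound persists. The existence
  of the resolvent rests on this compactness argument.\<close>
lemma square_summable_solution:
  assumes z: "Im z > 0"
  shows "\<exists>m. summable (\<lambda>n. (cmod (sol z 1 (- m) n))\<^sup>2)"
proof -
  define m where "m N = sol z 1 0 (Suc N) / p (Suc N) z" for N
  define f where "f N = sol z 1 (- m N)" for N
  have fN: "f N (Suc N) = 0" for N
    using p_nonzero[OF z, of "Suc N"] sol_linear[of z 1 "- m N" "Suc N"]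
    by (simp add: f_def m_def p_eq_sol del: sol.simps)
  have sum: "Im z * (\<Sum>k=1..N. (cmod (f N k))\<^sup>2) = Im (m N)" for N
    using flux_eq_sum[OF solves_sol, of z 1 "- m N" N] fN[of N]
    by (simp add: f_def flux_def)
  have m_bound: "cmod (m N) \<le> 1 / Im z" if "N \<ge> 1" for N
  proof -
    have "(cmod (m N))\<^sup>2 \<le> (\<Sum>k=1..N. (cmod (f N k))\<^sup>2)"
      using member_le_sum[of 1 "{1..N}" "\<lambda>k. (cmod (f N k))\<^sup>2"] that by (simp add: f_def)
    then have "Im z * (cmod (m N))\<^sup>2 \<le> Im z * (\<Sum>k=1..N. (cmod (f N k))\<^sup>2)"
      using z by (intro mult_left_mono) auto
    also have "\<dots> \<le> cmod (m N)" using sum[of N] abs_Im_le_cmod[of "m N"] by linarith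
    finally show ?thesis using z by (cases "m N = 0") (auto simp: power2_eq_square field_simps)
  qed
  have sum_bound: "(\<Sum>k=1..n. (cmod (f N k))\<^sup>2) \<le> 1 / (Im z)\<^sup>2" if "n \<le> N" "N \<ge> 1" for n N
  proof -
    have "Im z * (\<Sum>k=1..n. (cmod (f N k))\<^sup>2) \<le> Im z * (\<Sum>k=1..N. (cmod (f N k))\<^sup>2)"
      using z that by (intro mult_left_mono sum_mono2) auto
    also have "\<dots> \<le> 1 / Im z"
      using sum[of N] abs_Im_le_cmod[of "m N"] m_bound[OF that(2)] by linarith
    finally show ?thesis using z by (simp add: field_simps power2_eq_square)
  qed
  \<comment> \<open>The index 0 is left out, since the bound needs at least one site.\<close>
  have "\<forall>n. m (Suc n) \<in> cball 0 (1 / Im z)" using m_bound by simp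
  then obtain l r where r: "strict_mono (r :: nat \<Rightarrow> nat)" "((\<lambda>n. m (Suc n)) \<circ> r) \<longlonglongrightarrow> l"
    using compact_cball[of "0::complex" "1 / Im z"] unfolding compact_def by metis
  have conv: "(\<lambda>j. f (Suc (r j)) k) \<longlonglongrightarrow> sol z 1 (- l) k" for k
    unfolding f_def sol_linear[of z 1 "- m _"] sol_linear[of z 1 "- l"]
    using r(2) by (intro tendsto_intros) (simp add: o_def)
  have "(\<Sum>k=1..n. (cmod (sol z 1 (- l) k))\<^sup>2) \<le> 1 / (Im z)\<^sup>2" for n
  proof (rule tendsto_upperbound)
    show "(\<lambda>j. \<Sum>k=1..n. (cmod (f (Suc (r j)) k))\<^sup>2) \<longlonglongrightarrow> (\<Sum>k=1..n. (cmod (sol z 1 (- l) k))\<^sup>2)"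
      by (intro tendsto_intros conv)
    have "n \<le> Suc (r j)" if "j \<ge> n" for j
      using seq_suble[OF r(1), of j] that by linarith
    then show "\<forall>\<^sub>F j in sequentially. (\<Sum>k=1..n. (cmod (f (Suc (r j)) k))\<^sup>2) \<le> 1 / (Im z)\<^sup>2"
      using sum_bound by (intro eventually_mono[OF eventually_ge_at_top[of n]]) auto
  qed simp
  then have "summable (\<lambda>k. (cmod (sol z 1 (- l) (Suc k)))\<^sup>2)"
    by (intro summableI_nonneg_bounded[where x = "1 / (Im z)\<^sup>2"])
      (simp_all add: sum.atLeast1_atMost_eq lessThan_Suc_atMost)
  then show ?thesis using summable_Suc_iff[of "\<lambda>k. (cmod (sol z 1 (- l) k))\<^sup>2"] by blast
qed

text \<open>Away from 0, minus the square summable solution just found solves \<open>(J - z) u =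
  delta 1\<close>, because its value at 0 is \<open>- 1\<close> and enters the equation at 1
  with the factor \<open>a 0 = 1\<close>. So its value at 1 is the function that defines
  \<open>q\<close>.\<close>
lemma q_summable:
  assumes z: "Im z > 0"
  shows "summable (\<lambda>n. (cmod (q n z))\<^sup>2)"
proof -
  obtain m where m: "summable (\<lambda>n. (cmod (sol z 1 (- m) n))\<^sup>2)"
    using square_summable_solution[OF z] by blast
  define u where "u n = (if n = 0 then 0 else - sol z 1 (- m) n)" for n
  have "summable (\<lambda>n. (cmod (u n))\<^sup>2)"
    by (rule summable_comparison_test'[OF m, of 0]) (simp add: u_def)
  then have u: "u \<in> ell2" by (simp add: ell2_def u_def)
  have "jacobi a b u n - z * u n = delta 1 n" for n
  proof (cases n)
    case (Suc k)
    have "jacobi a b u n - z * u n = - (a (Suc k) * sol z 1 (- m) (Suc (Suc k)))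
        + (z - b (Suc k)) * sol z 1 (- m) (Suc k) + a k * u k"
      unfolding Suc using jacobi_eq[of u k] by (simp add: u_def algebra_simps del: sol.simps)
    also have "\<dots> = a k * (sol z 1 (- m) k + u k)"
      unfolding solves_Suc[OF solves_sol] by (simp add: algebra_simps)
    also have "\<dots> = delta 1 n" unfolding Suc by (cases k) (simp_all add: u_def delta_def)
    finally show ?thesis .
  qed (simp add: u_def delta_def)
  then have "resolvent a b z (delta 1) = u" using resolvent_unique[OF z u] by (simp add: fun_eq_iff)
  then have "green a b 1 z = m" by (simp add: green_def ell2_inner_delta u_def)
  then show ?thesis using m by (simp add: q_eq_sol)
qed

lemma flux_q:
  assumes "Im z > 0"
  shows "Im z * (cmod (q (Suc n) z))\<^sup>2 \<le> - flux (\<lambda>n. q n z) n"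
  by (rule flux_decay[OF q_solves assms q_summable[OF assms]])

text \<open>A zero of \<open>q\<close> would make the flux vanish there, then by decay also the
  next value, and two consecutive zeros contradict the Wronskian.\<close>
lemma q_nonzero:
  assumes z: "Im z > 0"
  shows "q n z \<noteq> 0"
proof
  assume 0: "q n z = 0"
  then have "Im z * (cmod (q (Suc n) z))\<^sup>2 \<le> 0" using flux_q[OF z, of n] by (simp add: flux_def)
  then have "q (Suc n) z = 0" using z by (simp add: mult_le_0_iff)
  with 0 show False using wronskian_p_q[of n z] by simp
qed

text \<open>The kernel of the resolvent: on either side of \<open>n\<close> it is a multiple of
  the solution that is admissible there. The value at 0 is the normalization of
  sequences.\<close>
definition green_vector :: "nat \<Rightarrow> complex \<Rightarrow> nat \<Rightarrow> complex" where
  "green_vector n z k = (if k = 0 then 0 else if k \<le> n then - p k z * q n z else - p n z * q k z)"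

lemma green_vector_resolves:
  assumes z: "Im z > 0" and n: "n \<ge> 1"
  shows "green_vector n z \<in> ell2"
    and "jacobi a b (green_vector n z) k - z * green_vector n z k = delta n k"
proof -
  let ?v = "green_vector n z"
  have v0: "?v 0 = 0" by (simp add: green_vector_def)
  have "summable (\<lambda>k. (cmod (p n z))\<^sup>2 * (cmod (q k z))\<^sup>2)"
    by (intro summable_mult q_summable z)
  then have "summable (\<lambda>k. (cmod (p n z))\<^sup>2 * (cmod (q (k + Suc n) z))\<^sup>2)"
    by (rule summable_ignore_initial_segment)
  then have "summable (\<lambda>k. (cmod (?v (k + Suc n)))\<^sup>2)"
    by (simp add: green_vector_def norm_mult power_mult_distrib)
  then have "summable (\<lambda>k. (cmod (?v k))\<^sup>2)" by (rule summable_iff_shift[THEN iffD1])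
  then show "?v \<in> ell2" using v0 by (simp add: ell2_def)
  show "jacobi a b ?v k - z * ?v k = delta n k"
  proof (cases k)
    case 0
    then show ?thesis using n v0 by (simp add: delta_def)
  next
    case (Suc j)
    have eq: "jacobi a b ?v k - z * ?v k = a (Suc j) * ?v (Suc (Suc j)) - (z - b (Suc j)) * ?v (Suc j) + a j * ?v j"
      unfolding Suc using jacobi_eq[of ?v j] v0 by (simp add: algebra_simps)
    have v_le: "?v i = - q n z * p i z" if "i \<le> n" for i using that by (simp add: green_vector_def)
    have v_ge: "?v i = - p n z * q i z" if "i \<ge> n" for i
      using that n by (auto simp: green_vector_def)
    consider "Suc j < n" | "Suc j = n" | "Suc j > n" by linarith
    then show ?thesis
    proof cases
      case 1
      have "jacobi a b ?v k - z * ?v k = - q n z * (a (Suc j) * p (Suc (Suc j)) z - (z - b (Suc j)) * p (Suc j) z + a j * p j z)"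
        unfolding eq using 1 by (simp add: v_le algebra_simps)
      then show ?thesis using solves_Suc[OF p_solves, of j z] 1 Suc by (simp add: delta_def)
    next
      case 2
      have "jacobi a b ?v k - z * ?v k = - p n z * (a n * q (Suc n) z)
          - q n z * (- ((z - b (Suc j)) * p (Suc j) z - a j * p j z))"
        unfolding eq using 2 v_ge[of "Suc (Suc j)"] v_le[of "Suc j"] v_le[of j] by (simp add: algebra_simps)
      also have "\<dots> = a n * (p (Suc n) z * q n z - p n z * q (Suc n) z)"
        unfolding solves_Suc[OF p_solves, symmetric] using 2 by (simp add: algebra_simps)
      also have "\<dots> = 1" by (rule wronskian_p_q)
      finally show ?thesis using 2 Suc by (simp add: delta_def)
    next
      case 3
      have "jacobi a b ?v k - z * ?v k = - p n z * (a (Suc j) * q (Suc (Suc j)) z - (z - b (Suc j)) * q (Suc j) z + a j * q j z)"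
        unfolding eq using 3 by (simp add: v_ge algebra_simps)
      then show ?thesis using solves_Suc[OF q_solves, of j z] 3 Suc by (simp add: delta_def)
    qed
  qed
qed

lemma green_eq:
  assumes z: "Im z > 0" and n: "n \<ge> 1"
  shows "green a b n z = - p n z * q n z"
proof -
  have "(\<lambda>k. jacobi a b (green_vector n z) k - z * green_vector n z k) = delta n"
    using green_vector_resolves(2)[OF z n] by auto
  then have "resolvent a b z (delta n) = green_vector n z"
    using resolvent_unique[OF z green_vector_resolves(1)[OF z n]] by simp
  then show ?thesis using n by (simp add: green_def ell2_inner_delta green_vector_def)
qed

end

section \<open>The logarithm on the upper half-plane\<close>

lemma Im_divide_eq: "Im (x / y) = Im (cnj y * x) / (cmod y)\<^sup>2"
  unfolding complex_div_cnj[of x y] by (simp add: mult.commute flip: of_real_power)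

lemma Im_le_cmod: "Im x \<le> cmod x"
  using abs_Im_le_cmod[of x] by linarith

text \<open>The argument of \<open>\<zeta>\<close> is at least its sine.\<close>
lemma Im_Ln_ge:
  assumes "Im \<zeta> > 0"
  shows "Im \<zeta> / cmod \<zeta> \<le> Im (Ln \<zeta>)"
proof -
  have "\<zeta> \<noteq> 0" using assms by auto
  have "0 \<le> Im (Ln \<zeta>)" using assms Im_Ln_pos_lt_imp by (metis less_imp_le)
  have "\<zeta> = exp (Ln \<zeta>)" using \<open>\<zeta> \<noteq> 0\<close> by simp
  then have "Im \<zeta> = exp (Re (Ln \<zeta>)) * sin (Im (Ln \<zeta>))" by (metis Im_exp)
  then have "Im \<zeta> / cmod \<zeta> = sin (Im (Ln \<zeta>))" using \<open>\<zeta> \<noteq> 0\<close> by simp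
  then show ?thesis using sin_x_le_x[OF \<open>0 \<le> Im (Ln \<zeta>)\<close>] by simp
qed

lemma Im_Ln_upper: "Im \<zeta> > 0 \<Longrightarrow> 0 < Im (Ln \<zeta>) \<and> Im (Ln \<zeta>) < pi"
  using Im_Ln_pos_lt[of \<zeta>] by (cases "\<zeta> = 0") auto

lemma Ln_diff_upper:
  assumes "Im \<zeta> > 0" "Im \<xi> > 0"
  shows "Ln \<zeta> - Ln \<xi> = Ln (\<zeta> / \<xi>)"
proof -
  have "\<zeta> \<noteq> 0" "\<xi> \<noteq> 0" using assms by auto
  then have "exp (Ln \<zeta> - Ln \<xi>) = \<zeta> / \<xi>" by (simp add: exp_diff)
  then show ?thesis
    using Im_Ln_upper[OF assms(1)] Im_Ln_upper[OF assms(2)] by (intro Ln_unique[symmetric]) auto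
qed

text \<open>Exponentiating shows the identity up to a multiple of \<open>2 * pi * \<i>\<close>.
  As all four arguments lie strictly between 0 and \<open>pi\<close>, the imaginary parts of
  \<open>Ln x + Ln y + Ln g\<close> and \<open>\<i> * pi + Ln g'\<close> differ by less than
  \<open>2 * pi\<close>, so the multiple is 0.\<close>
lemma Ln_product_neg:
  assumes up: "Im x > 0" "Im y > 0" "Im g > 0" "Im g' > 0" and eq: "x * y * g = - g'"
  shows "Ln x + Ln y = \<i> * pi + Ln g' - Ln g"
proof -
  have nz: "x \<noteq> 0" "y \<noteq> 0" "g \<noteq> 0" "g' \<noteq> 0" using up by auto
  have "exp (Ln x + Ln y + Ln g) = exp (\<i> * pi + Ln g')"
    using nz eq by (simp add: exp_add)
  then obtain k :: int where k: "Ln x + Ln y + Ln g = \<i> * pi + Ln g' + (of_int (2 * k) * pi) * \<i>"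
    by (auto simp: exp_eq)
  define r where "r = real_of_int (2 * k) * pi"
  have "Im (Ln x) + Im (Ln y) + Im (Ln g) = pi + Im (Ln g') + r"
    using arg_cong[OF k, of Im] by (simp add: r_def)
  then have "r < 2 * pi" "- (2 * pi) < r"
    using Im_Ln_upper[OF up(1)] Im_Ln_upper[OF up(2)] Im_Ln_upper[OF up(3)] Im_Ln_upper[OF up(4)]
    by linarith+
  then have "real_of_int k * pi < 1 * pi" "- 1 * pi < real_of_int k * pi" by (simp_all add: r_def mult.commute)
  then have "real_of_int k < 1" "- 1 < real_of_int k"
    by (simp_all only: mult_less_cancel_right_pos[OF pi_gt_zero])
  then have "k = 0" by linarith
  then show ?thesis using k by (simp add: algebra_simps)
qed

lemma average_ge:
  assumes "N \<ge> 1" "\<And>n. n \<ge> 1 \<Longrightarrow> e \<le> Im (h n)"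
  shows "e \<le> Im ((\<Sum>n=1..N. h n) / of_nat N)"
proof -
  have "real N * e = (\<Sum>n=1..N. e)" by simp
  also have "\<dots> \<le> (\<Sum>n=1..N. Im (h n))" by (intro sum_mono assms(2)) auto
  finally show ?thesis using assms(1) by (simp add: Im_divide_of_nat field_simps)
qed

context jacobi_coefficients
begin

section \<open>Boundedness of the Jacobi operator\<close>

lemma jacobi_norm_sq:
  assumes u: "u \<in> ell2"
  shows "jacobi a b u \<in> ell2" "norm_sq (jacobi a b u) \<le> (3 * (M + 1))\<^sup>2 * norm_sq u"
proof -
  have u0: "u 0 = 0" and su: "summable (\<lambda>n. (cmod (u n))\<^sup>2)" using u by (auto simp: ell2_def)
  have le: "(cmod (jacobi a b u (Suc n)))\<^sup>2
      \<le> 3 * (M + 1)\<^sup>2 * ((cmod (u (Suc (Suc n))))\<^sup>2 + (cmod (u n))\<^sup>2 + (cmod (u (Suc n)))\<^sup>2)" for n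
  proof -
    define x y w where "x = cmod (u (Suc (Suc n)))" and "y = cmod (u n)" and "w = cmod (u (Suc n))"
    have "cmod (jacobi a b u (Suc n)) \<le> a (Suc n) * x + a n * y + \<bar>b (Suc n)\<bar> * w"
      unfolding jacobi_eq[of u, OF u0] x_def y_def w_def
      by (intro order_trans[OF norm_triangle_ineq] add_mono) (simp_all add: norm_mult abs_of_pos)
    also have "\<dots> \<le> (M + 1) * x + (M + 1) * y + (M + 1) * w"
      using a_le[of "Suc n"] a_le[of n] b_bound[of "Suc n"]
      by (intro add_mono mult_right_mono) (auto simp: x_def y_def w_def)
    also have "\<dots> = (M + 1) * (x + y + w)" by (simp add: algebra_simps)
    finally have "(cmod (jacobi a b u (Suc n)))\<^sup>2 \<le> (M + 1)\<^sup>2 * (x + y + w)\<^sup>2"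
      unfolding power_mult_distrib[symmetric] by (intro power_mono) auto
    also have "\<dots> \<le> (M + 1)\<^sup>2 * (3 * (x\<^sup>2 + y\<^sup>2 + w\<^sup>2))"
    proof (rule mult_left_mono)
      show "(x + y + w)\<^sup>2 \<le> 3 * (x\<^sup>2 + y\<^sup>2 + w\<^sup>2)"
        using sum_squares_bound[of x y] sum_squares_bound[of y w] sum_squares_bound[of x w]
        by (simp add: power2_eq_square algebra_simps)
    qed simp
    finally show ?thesis by (simp add: x_def y_def w_def algebra_simps)
  qed
  have part: "(\<Sum>n<k. (cmod (u (n + j)))\<^sup>2) \<le> norm_sq u" for k j
  proof -
    have "(\<Sum>n<k. (cmod (u (n + j)))\<^sup>2) = (\<Sum>n\<in>{j..<k + j}. (cmod (u n))\<^sup>2)"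
      by (rule sum.reindex_bij_witness[of _ "\<lambda>n. n - j" "\<lambda>n. n + j"]) auto
    also have "\<dots> \<le> norm_sq u" unfolding norm_sq_def by (rule sum_le_suminf[OF su]) auto
    finally show ?thesis .
  qed
  have bound: "(\<Sum>n<k. (cmod (jacobi a b u (Suc n)))\<^sup>2) \<le> (3 * (M + 1))\<^sup>2 * norm_sq u" for k
  proof -
    have "(\<Sum>n<k. (cmod (jacobi a b u (Suc n)))\<^sup>2)
        \<le> 3 * (M + 1)\<^sup>2 * ((\<Sum>n<k. (cmod (u (n + 2)))\<^sup>2) + (\<Sum>n<k. (cmod (u (n + 0)))\<^sup>2) + (\<Sum>n<k. (cmod (u (n + 1)))\<^sup>2))"
      unfolding sum.distrib[symmetric] sum_distrib_left using le by (intro sum_mono) simp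
    also have "\<dots> \<le> 3 * (M + 1)\<^sup>2 * (norm_sq u + norm_sq u + norm_sq u)"
      by (intro mult_left_mono add_mono part) simp
    also have "\<dots> = (3 * (M + 1))\<^sup>2 * norm_sq u" by (simp add: power2_eq_square algebra_simps)
    finally show ?thesis .
  qed
  have s1: "summable (\<lambda>n. (cmod (jacobi a b u (Suc n)))\<^sup>2)"
    by (rule summableI_nonneg_bounded[OF _ bound]) simp
  then have s: "summable (\<lambda>n. (cmod (jacobi a b u n))\<^sup>2)"
    using summable_Suc_iff[of "\<lambda>n. (cmod (jacobi a b u n))\<^sup>2"] by simp
  then show "jacobi a b u \<in> ell2" by (simp add: ell2_def)
  have "norm_sq (jacobi a b u) = (\<Sum>n. (cmod (jacobi a b u (Suc n)))\<^sup>2)"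
    unfolding norm_sq_def using suminf_split_head[OF s] by simp
  also have "\<dots> \<le> (3 * (M + 1))\<^sup>2 * norm_sq u" by (rule suminf_le_const[OF s1 bound])
  finally show "norm_sq (jacobi a b u) \<le> (3 * (M + 1))\<^sup>2 * norm_sq u" .
qed

text \<open>The bound on the form follows from the bound on the norm with the weight equal to
  the norm bound.\<close>
lemma bounded_spectral_resolution_jacobi:
  assumes "spectral_resolution (jacobi a b) E"
  shows "bounded_spectral_resolution (jacobi a b) E (3 * (M + 1))"
proof
  fix u assume u: "u \<in> ell2"
  show "jacobi a b u \<in> ell2" by (rule jacobi_norm_sq[OF u])
  define s where "s = 3 * (M + 1)"
  have "s > 0" using M_pos by (simp add: s_def)
  have "cmod (ell2_inner u (jacobi a b u)) \<le> (s * norm_sq u + norm_sq (jacobi a b u) / s) / 2"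
    by (rule ell2_inner_bound[OF u jacobi_norm_sq(1)[OF u] \<open>s > 0\<close>])
  also have "norm_sq (jacobi a b u) / s \<le> s\<^sup>2 * norm_sq u / s"
    using jacobi_norm_sq(2)[OF u] \<open>s > 0\<close> by (intro divide_right_mono) (auto simp: s_def)
  finally show "cmod (ell2_inner u (jacobi a b u)) \<le> 3 * (M + 1) * norm_sq u"
    using \<open>s > 0\<close> by (simp add: s_def power2_eq_square mult.commute)
qed (use assms in \<open>auto simp: jacobi_lincomb\<close>)

section \<open>Bounds for the m-functions and the Green function\<close>

text \<open>An upper bound, the same for all sites, for the reciprocals of the Green function
  and, up to the factor \<open>a n\<close>, of the ratios of \<open>q\<close>. What matters is
  that it does not depend on the site and is locally bounded in \<open>z\<close>.\<close>
definition size_bound :: "complex \<Rightarrow> real" where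
  "size_bound z = cmod z + M + 2 * (M + 1)\<^sup>2 / Im z"

lemma size_bound_pos: "Im z > 0 \<Longrightarrow> size_bound z > 0"
  unfolding size_bound_def using M_pos by (intro add_nonneg_pos divide_pos_pos) auto

lemma size_bound_ge: "Im z > 0 \<Longrightarrow> cmod z + M + (M + 1)\<^sup>2 / Im z \<le> size_bound z"
  unfolding size_bound_def by (intro add_left_mono divide_right_mono) auto

lemma a_square_le: "a m * a n \<le> (M + 1)\<^sup>2"
  unfolding power2_eq_square using a_le[of m] a_le[of n] M_pos by (intro mult_mono) (auto intro: less_imp_le)

text \<open>Here the last term alone of the sum that makes up the flux is used.\<close>
lemma p_ratio_Im:
  assumes z: "Im z > 0" and n: "n \<ge> 1"
  shows "Im z \<le> a n * Im (p (Suc n) z / p n z)"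
proof -
  have "a n * Im (p (Suc n) z / p n z) = flux (\<lambda>n. p n z) n / (cmod (p n z))\<^sup>2"
    unfolding Im_divide_eq flux_def by simp
  moreover have "Im z \<le> flux (\<lambda>n. p n z) n / (cmod (p n z))\<^sup>2"
    using flux_p(1)[OF z n] p_nonzero[OF z n] by (simp add: le_divide_eq)
  ultimately show ?thesis by simp
qed

lemma p_ratio_inverse:
  assumes z: "Im z > 0" and n: "n \<ge> 1"
  shows "a n * cmod (p n z / p (Suc n) z) \<le> (M + 1)\<^sup>2 / Im z"
proof -
  have "Im z \<le> a n * cmod (p (Suc n) z / p n z)"
    by (rule order_trans[OF p_ratio_Im[OF z n] mult_left_mono[OF Im_le_cmod]]) (simp add: less_imp_le)
  then have "Im z * (a n * cmod (p n z / p (Suc n) z)) \<le> a n * a n"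
    using p_nonzero[OF z n] p_nonzero[OF z, of "Suc n"] a_pos[of n] by (simp add: norm_divide field_simps)
  also have "\<dots> \<le> (M + 1)\<^sup>2" by (rule a_square_le)
  finally show ?thesis using z by (simp add: field_simps)
qed

text \<open>By the difference equation the deviation is \<open>a (n - 1)\<close> times the
  reciprocal of the preceding ratio. The estimate bounds the ratios, and it also shows their
  asymptotics at infinity.\<close>
lemma p_ratio_approx:
  fixes z :: complex
  assumes z: "Im z > 0" and n: "n \<ge> 1"
  shows "cmod (a n * (p (Suc n) z / p n z) - (z - b n)) \<le> (M + 1)\<^sup>2 / Im z"
proof -
  obtain k where k: "n = Suc k" using n by (cases n) auto
  have "a n * (p (Suc n) z / p n z) = (a (Suc k) * p (Suc (Suc k)) z) / p (Suc k) z" by (simp add: k)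
  also have "\<dots> = (z - b n) - a k * (p k z / p (Suc k) z)"
    unfolding solves_Suc[OF p_solves] using p_nonzero[OF z n] by (simp add: k diff_divide_distrib)
  finally have "a n * (p (Suc n) z / p n z) - (z - b n) = - (a k * (p k z / p (Suc k) z))" by simp
  then have "cmod (a n * (p (Suc n) z / p n z) - (z - b n)) = a k * cmod (p k z / p (Suc k) z)"
    by (simp only: norm_minus_cancel norm_mult norm_of_real abs_of_pos[OF a_pos])
  also have "\<dots> \<le> (M + 1)\<^sup>2 / Im z"
  proof (cases "k = 0")
    case False
    then show ?thesis by (intro p_ratio_inverse z) auto
  qed (use z in simp)
  finally show ?thesis .
qed

lemma cmod_z_minus_b_le:
  fixes z :: complex
  shows "n \<ge> 1 \<Longrightarrow> cmod (z - b n) \<le> cmod z + M"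
  using norm_triangle_ineq4[of z "of_real (b n)"] b_bound[of n] by simp

lemma p_ratio_le:
  assumes z: "Im z > 0" and n: "n \<ge> 1"
  shows "a n * cmod (p (Suc n) z / p n z) \<le> cmod z + M + (M + 1)\<^sup>2 / Im z"
proof -
  have "a n * cmod (p (Suc n) z / p n z) = cmod (a n * (p (Suc n) z / p n z))"
    by (simp only: norm_mult norm_of_real abs_of_pos[OF a_pos])
  also have "\<dots> \<le> cmod (z - b n) + cmod (a n * (p (Suc n) z / p n z) - (z - b n))"
    by (metis norm_triangle_sub)
  finally show ?thesis using p_ratio_approx[OF z n] cmod_z_minus_b_le[OF n, of z] by linarith
qed

lemma q_ratio_Im:
  assumes z: "Im z > 0"
  shows "Im z * (cmod (q (Suc n) z / q n z))\<^sup>2 \<le> a n * Im (- (q (Suc n) z / q n z))"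
proof -
  have "a n * Im (- (q (Suc n) z / q n z)) = - flux (\<lambda>n. q n z) n / (cmod (q n z))\<^sup>2"
    unfolding Im_divide_eq flux_def by (simp add: Im_divide_eq)
  moreover have "Im z * (cmod (q (Suc n) z / q n z))\<^sup>2 = Im z * (cmod (q (Suc n) z))\<^sup>2 / (cmod (q n z))\<^sup>2"
    by (simp add: norm_divide power_divide)
  ultimately show ?thesis using flux_q[OF z, of n] by (simp only: divide_right_mono zero_le_power2)
qed

lemma q_ratio_le:
  assumes z: "Im z > 0"
  shows "a n * cmod (q (Suc n) z / q n z) \<le> (M + 1)\<^sup>2 / Im z"
proof -
  define x where "x = cmod (q (Suc n) z / q n z)"
  have "x > 0" using q_nonzero[OF z] by (simp add: x_def)
  have "Im z * x\<^sup>2 \<le> a n * x"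
    unfolding x_def norm_minus_cancel[of "q (Suc n) z / q n z", symmetric]
    by (rule order_trans[OF _ mult_left_mono[OF Im_le_cmod]])
      (use q_ratio_Im[OF z, of n] in \<open>simp_all add: less_imp_le\<close>)
  then have "Im z * x \<le> a n" using \<open>x > 0\<close> by (simp add: power2_eq_square)
  then have "a n * (Im z * x) \<le> a n * a n" by (intro mult_left_mono) (auto intro: less_imp_le)
  also have "\<dots> \<le> (M + 1)\<^sup>2" by (rule a_square_le)
  finally show ?thesis using z by (simp add: x_def[symmetric] field_simps)
qed

lemma q_ratio_ge:
  assumes z: "Im z > 0"
  shows "a n \<le> size_bound z * cmod (q (Suc n) z / q n z)"
proof -
  have eq: "a n * (q n z / q (Suc n) z) = (z - b (Suc n)) - a (Suc n) * (q (Suc (Suc n)) z / q (Suc n) z)"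
    using solves_Suc[OF q_solves, of n z] q_nonzero[OF z] by (simp add: field_simps)
  have "a n * cmod (q n z / q (Suc n) z) = cmod (a n * (q n z / q (Suc n) z))"
    by (simp only: norm_mult norm_of_real abs_of_pos[OF a_pos])
  also have "\<dots> \<le> cmod (z - b (Suc n)) + a (Suc n) * cmod (q (Suc (Suc n)) z / q (Suc n) z)"
    unfolding eq using norm_triangle_ineq4[of "z - b (Suc n)" "a (Suc n) * (q (Suc (Suc n)) z / q (Suc n) z)"]
    by (simp only: norm_mult norm_of_real abs_of_pos[OF a_pos])
  also have "\<dots> \<le> size_bound z"
    using cmod_z_minus_b_le[of "Suc n" z] q_ratio_le[OF z, of "Suc n"] size_bound_ge[OF z] by simp
  finally show ?thesis using q_nonzero[OF z] by (simp add: norm_divide field_simps)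
qed

text \<open>By the Wronskian, \<open>- 1 / g\<close> is the sum of the two ratios multiplied by
  \<open>a n\<close>. Its imaginary part is at least \<open>Im z\<close>, already because of the
  ratio of \<open>p\<close>, and its modulus is at most the size bound; the rest is
  elementary.\<close>
lemma green_bounds:
  assumes z: "Im z > 0" and n: "n \<ge> 1"
  defines "g \<equiv> green a b n z"
  shows "g \<noteq> 0" "cmod g \<le> 1 / Im z" "1 / size_bound z \<le> cmod g" "Im z / (size_bound z)\<^sup>2 \<le> Im g"
proof -
  have g: "g = - (p n z * q n z)" unfolding g_def using green_eq[OF z n] by simp
  show "g \<noteq> 0" using g p_nonzero[OF z n] q_nonzero[OF z] by simp
  \<comment> \<open>This is the Wronskian divided by the product of the solutions.\<close>
  have inv: "- (1 / g) = a n * (p (Suc n) z / p n z) + a n * (- (q (Suc n) z / q n z))"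
    using wronskian_p_q[of n z] p_nonzero[OF z n] q_nonzero[OF z, of n] unfolding g by (simp add: field_simps)
  have "a n * Im (- (q (Suc n) z / q n z)) \<ge> 0"
    by (rule order_trans[OF _ q_ratio_Im[OF z]]) (use z in simp)
  then have Im_inv: "Im z \<le> Im (- (1 / g))"
    using p_ratio_Im[OF z n] unfolding inv by (simp del: times_divide_eq_right)
  have "cmod (1 / g) \<le> a n * cmod (p (Suc n) z / p n z) + a n * cmod (q (Suc n) z / q n z)"
    using norm_triangle_ineq[of "a n * (p (Suc n) z / p n z)" "a n * (- (q (Suc n) z / q n z))"]
    unfolding inv[symmetric] by (simp only: norm_minus_cancel norm_mult norm_of_real abs_of_pos[OF a_pos])
  also have "\<dots> \<le> size_bound z"
    using p_ratio_le[OF z n] q_ratio_le[OF z, of n] by (simp add: size_bound_def)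
  finally have cmod_inv: "1 / cmod g \<le> size_bound z" by (simp add: norm_divide)
  then show lower: "1 / size_bound z \<le> cmod g"
    using size_bound_pos[OF z] \<open>g \<noteq> 0\<close> by (simp add: field_simps)
  have "Im z \<le> 1 / cmod g"
    using Im_inv abs_Im_le_cmod[of "- (1 / g)"] by (simp add: norm_divide)
  then show "cmod g \<le> 1 / Im z" using z \<open>g \<noteq> 0\<close> by (simp add: field_simps)
  have "Im g = Im (- (1 / g)) * (cmod g)\<^sup>2"
    using \<open>g \<noteq> 0\<close> by (simp add: Im_divide_eq)
  also have "\<dots> \<ge> Im z * (1 / size_bound z)\<^sup>2"
    using Im_inv z lower size_bound_pos[OF z] by (intro mult_mono power_mono) auto
  finally show "Im z / (size_bound z)\<^sup>2 \<le> Im g" by (simp add: power_divide)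
qed

section \<open>The two logarithmic averages\<close>

lemma a_m_plus: "of_real (a n) * m_plus a b n z = - (q (Suc n) z / q n z)"
  by (simp add: m_plus_def)

lemma a_m_minus: "of_real (a n) * m_minus a b n z = p (Suc n) z / p n z"
  by (simp add: m_minus_def)

lemma p_ratio_upper: "Im z > 0 \<Longrightarrow> n \<ge> 1 \<Longrightarrow> Im (p (Suc n) z / p n z) > 0"
  using less_le_trans[OF _ p_ratio_Im, of 0 z n] a_pos[of n] by (simp add: zero_less_mult_iff)

lemma q_ratio_upper: "Im z > 0 \<Longrightarrow> Im (- (q (Suc n) z / q n z)) > 0"
proof -
  assume z: "Im z > 0"
  have "0 < Im z * (cmod (q (Suc n) z / q n z))\<^sup>2"
    using z q_nonzero[OF z] by (intro mult_pos_pos zero_less_power) auto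
  also note q_ratio_Im[OF z, of n]
  finally show ?thesis by (rule zero_less_mult_pos[OF _ a_pos])
qed

text \<open>The product of the two arguments telescopes, because the Green function is minus the
  product of the two solutions.\<close>
lemma Ln_m_plus_m_minus:
  assumes z: "Im z > 0" and n: "n \<ge> 1"
  shows "Ln (a n * m_plus a b n z) + Ln (a n * m_minus a b n z)
    = \<i> * pi + (Ln (green a b (Suc n) z) - Ln (green a b n z))"
proof -
  have up: "Im (green a b k z) > 0" if "k \<ge> 1" for k
    by (rule less_le_trans[OF _ green_bounds(4)[OF z that]]) (use size_bound_pos[OF z] z in simp)
  have "- (q (Suc n) z / q n z) * (p (Suc n) z / p n z) * green a b n z = - green a b (Suc n) z"
    using p_nonzero[OF z n] q_nonzero[OF z, of n] green_eq[OF z n] green_eq[OF z, of "Suc n"]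
    by (simp add: field_simps)
  from Ln_product_neg[OF q_ratio_upper[OF z] p_ratio_upper[OF z n] up[OF n] up this]
  show ?thesis unfolding a_m_plus a_m_minus by simp
qed

text \<open>The error in \<open>w_plus + w_minus = \<i> * pi\<close> comes only from the two
  ends of the chain, and it is divided by \<open>N\<close>.\<close>
lemma w_plus_w_minus:
  assumes z: "Im z > 0" and N: "N \<ge> 1"
  shows "w_plus a b N z - (\<i> * pi - w_minus a b N z) = (Ln (green a b (Suc N) z) - Ln (green a b 1 z)) / of_nat N"
proof -
  have "(\<Sum>n=1..N. Ln (a n * m_plus a b n z)) + (\<Sum>n=1..N. Ln (a n * m_minus a b n z))
      = (\<Sum>n=1..N. \<i> * pi + (Ln (green a b (Suc n) z) - Ln (green a b n z)))"
    unfolding sum.distrib[symmetric] by (intro sum.cong refl Ln_m_plus_m_minus z) auto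
  also have "\<dots> = of_nat N * (\<i> * pi) + (Ln (green a b (Suc N) z) - Ln (green a b 1 z))"
    using sum_Suc_diff[of 1 N "\<lambda>n. Ln (green a b n z)"] N by (simp add: sum.distrib)
  finally show ?thesis
    using N unfolding w_plus_def w_minus_def by (simp add: field_simps)
qed

lemma Ln_green_bounded:
  assumes "compact K" "K \<subseteq> upper_half_plane"
  shows "\<exists>B. \<forall>z\<in>K. \<forall>n\<ge>1. cmod (Ln (green a b n z)) \<le> B"
proof -
  obtain e where e: "e > 0" "\<forall>z\<in>K. e \<le> Im z"
    using compact_upper_half_plane_Im_bound[OF assms] by blast
  obtain R where R: "\<forall>z\<in>K. cmod z \<le> R"
    using compact_imp_bounded[OF assms(1)] by (auto simp: bounded_iff)
  define S where "S = \<bar>R\<bar> + M + 2 * (M + 1)\<^sup>2 / e"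
  have "S > 0" unfolding S_def using M_pos e(1) by (intro add_nonneg_pos divide_pos_pos) auto
  have "cmod (Ln (green a b n z)) \<le> \<bar>ln (1 / e)\<bar> + \<bar>ln (1 / S)\<bar> + pi" if z: "z \<in> K" and n: "n \<ge> 1" for z n
  proof -
    have Im_z: "Im z > 0" using z assms(2) by auto
    define g where "g = green a b n z"
    have "size_bound z \<le> S"
      unfolding size_bound_def S_def using R e z by (intro add_mono divide_left_mono) force+
    then have "1 / S \<le> 1 / size_bound z" using size_bound_pos[OF Im_z] by (simp add: frac_le)
    then have lower: "1 / S \<le> cmod g" using green_bounds(3)[OF Im_z n] by (simp add: g_def)
    have "1 / Im z \<le> 1 / e" using e z by (simp add: frac_le)
    then have upper: "cmod g \<le> 1 / e" using green_bounds(2)[OF Im_z n] by (simp add: g_def)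
    have "g \<noteq> 0" using green_bounds(1)[OF Im_z n] by (simp add: g_def)
    have "ln (1 / S) \<le> ln (cmod g)" "ln (cmod g) \<le> ln (1 / e)"
      using lower upper \<open>S > 0\<close> \<open>g \<noteq> 0\<close> \<open>e > 0\<close> by (subst ln_le_cancel_iff, auto)+
    then have "\<bar>ln (cmod g)\<bar> \<le> \<bar>ln (1 / e)\<bar> + \<bar>ln (1 / S)\<bar>" by linarith
    moreover have "\<bar>Im (Ln g)\<bar> \<le> pi" using Im_Ln_le_pi[of g] mpi_less_Im_Ln[of g] \<open>g \<noteq> 0\<close> by linarith
    ultimately show ?thesis
      using cmod_le[of "Ln g"] \<open>g \<noteq> 0\<close> by (simp add: g_def)
  qed
  then show ?thesis by blast
qed

text \<open>The ratios stay in a compact part of the upper half-plane that does not depend on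
  the site.\<close>
lemma Im_Ln_m_lower:
  assumes z: "Im z > 0"
  shows "\<exists>e>0. \<forall>n\<ge>1. e \<le> Im (Ln (a n * m_plus a b n z)) \<and> e \<le> Im (Ln (a n * m_minus a b n z))"
proof -
  define e where "e = Im z / size_bound z"
  have "e > 0" using z size_bound_pos[OF z] by (simp add: e_def)
  have "e \<le> Im (Ln (a n * m_plus a b n z))" "e \<le> Im (Ln (a n * m_minus a b n z))" if n: "n \<ge> 1" for n
  proof -
    define x where "x = - (q (Suc n) z / q n z)"
    have x: "Im x > 0" unfolding x_def by (rule q_ratio_upper[OF z])
    then have "cmod x > 0" by auto
    have "e * (a n * cmod x) \<le> e * (size_bound z * cmod x * cmod x)"
      using q_ratio_ge[OF z, of n] \<open>cmod x > 0\<close> \<open>e > 0\<close> by (intro mult_left_mono mult_right_mono) (auto simp: x_def)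
    also have "\<dots> = Im z * (cmod x)\<^sup>2" using size_bound_pos[OF z] by (simp add: e_def power2_eq_square)
    also have "\<dots> \<le> a n * Im x" using q_ratio_Im[OF z, of n] by (simp add: x_def)
    finally have "e * cmod x \<le> Im x" by (simp add: mult.left_commute)
    then have "e \<le> Im x / cmod x" using \<open>cmod x > 0\<close> by (simp add: field_simps)
    also note Im_Ln_ge[OF x]
    finally show "e \<le> Im (Ln (a n * m_plus a b n z))" unfolding a_m_plus x_def .
    define y where "y = p (Suc n) z / p n z"
    have y: "Im y > 0" unfolding y_def by (rule p_ratio_upper[OF z n])
    then have "cmod y > 0" by auto
    have "a n * cmod y \<le> size_bound z"
      using p_ratio_le[OF z n] size_bound_ge[OF z] unfolding y_def by linarith
    then have "e * (a n * cmod y) \<le> e * size_bound z" using \<open>e > 0\<close> by (intro mult_left_mono) auto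
    also have "\<dots> = Im z" using size_bound_pos[OF z] by (simp add: e_def)
    also have "\<dots> \<le> a n * Im y" using p_ratio_Im[OF z n] by (simp add: y_def)
    finally have "e * cmod y \<le> Im y" by (simp add: mult.left_commute)
    then have "e \<le> Im y / cmod y" using \<open>cmod y > 0\<close> by (simp add: field_simps)
    also note Im_Ln_ge[OF y]
    finally show "e \<le> Im (Ln (a n * m_minus a b n z))" unfolding a_m_minus y_def .
  qed
  with \<open>e > 0\<close> show ?thesis by blast
qed

lemma w_Im_lower:
  assumes z: "Im z > 0"
  shows "\<exists>e>0. \<forall>N\<ge>1. e \<le> Im (w_plus a b N z) \<and> e \<le> Im (w_minus a b N z)"
proof -
  obtain e where e: "e > 0"
    "\<And>n. n \<ge> 1 \<Longrightarrow> e \<le> Im (Ln (a n * m_plus a b n z))"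
    "\<And>n. n \<ge> 1 \<Longrightarrow> e \<le> Im (Ln (a n * m_minus a b n z))"
    using Im_Ln_m_lower[OF z] by blast
  then have "e \<le> Im (w_plus a b N z) \<and> e \<le> Im (w_minus a b N z)" if "N \<ge> 1" for N
    unfolding w_plus_def w_minus_def using that by (intro conjI average_ge e)
  with e(1) show ?thesis by blast
qed

lemma g_avg_Im_lower:
  assumes z: "Im z > 0"
  shows "\<exists>e>0. \<forall>N\<ge>1. e \<le> Im (g_avg a b N z)"
proof (intro exI conjI allI impI)
  show "0 < Im z / (size_bound z)\<^sup>2" using size_bound_pos[OF z] z by simp
  show "Im z / (size_bound z)\<^sup>2 \<le> Im (g_avg a b N z)" if "N \<ge> 1" for N
    unfolding g_avg_def by (intro average_ge that green_bounds(4) z)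
qed

section \<open>Characteristic polynomials of the truncations\<close>

text \<open>The solution \<open>p\<close> as a formal polynomial in \<open>z\<close>, so that
  its degree, its roots and its derivative become available.\<close>
fun char_poly :: "nat \<Rightarrow> complex poly" where
  "char_poly 0 = 0"
| "char_poly (Suc 0) = 1"
| "char_poly (Suc (Suc n)) = smult (1 / of_real (a (Suc n)))
     ([:- of_real (b (Suc n)), 1:] * char_poly (Suc n) - smult (of_real (a n)) (char_poly n))"

lemma poly_char_poly: "poly (char_poly n) z = p n z"
  unfolding p_eq_sol by (induction n rule: induct_nat_012)
    (simp_all add: algebra_simps add_divide_distrib diff_divide_distrib)

lemma coeff_char_poly:
  "(\<forall>k\<ge>n. coeff (char_poly n) k = 0) \<and> coeff (char_poly (Suc n)) n = 1 / (\<Prod>k=1..n. of_real (a k))"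
proof (induction n rule: induct_nat_012)
  case (ge2 n)
  have "coeff (char_poly (Suc (Suc n))) k = 0" if "k \<ge> Suc (Suc n)" for k
    using that ge2 by (cases k) (auto simp: coeff_pCons)
  moreover have "coeff (char_poly (Suc (Suc (Suc n)))) (Suc (Suc n)) = 1 / (\<Prod>k=1..Suc (Suc n). of_real (a k))"
    using ge2 calculation by (simp add: coeff_pCons)
  ultimately show ?case by blast
qed (auto simp: coeff_pCons)

lemma degree_char_poly: "degree (char_poly (Suc n)) = n"
proof (rule antisym)
  show "degree (char_poly (Suc n)) \<le> n"
    using coeff_char_poly[of "Suc n"] by (intro degree_le) auto
  show "n \<le> degree (char_poly (Suc n))"
    using coeff_char_poly[of n] by (intro le_degree) auto
qed

text \<open>The Christoffel-Darboux formula: the derivative of \<open>p\<close> with respect to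
  \<open>z\<close> solves the difference equation with the inhomogeneity \<open>p\<close>, so
  its Wronskian with a solution \<open>g\<close> grows by \<open>p k z * g k\<close> in step
  \<open>k\<close>.\<close>
lemma christoffel_darboux:
  fixes g :: "nat \<Rightarrow> complex"
  assumes "solves z g"
  shows "a n * (poly (pderiv (char_poly (Suc n))) z * g n - poly (pderiv (char_poly n)) z * g (Suc n))
    = (\<Sum>k=1..n. p k z * g k)"
proof (induction n)
  case (Suc n)
  define D where "D k = poly (pderiv (char_poly k)) z" for k
  have "a (Suc n) * D (Suc (Suc n)) = p (Suc n) z + (z - b (Suc n)) * D (Suc n) - a n * D n"
    by (simp add: D_def pderiv_smult pderiv_mult pderiv_add pderiv_diff pderiv_pCons poly_char_poly algebra_simps)
  note rec = this
  have "a (Suc n) * (D (Suc (Suc n)) * g (Suc n) - D (Suc n) * g (Suc (Suc n)))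
      = (a (Suc n) * D (Suc (Suc n))) * g (Suc n) - D (Suc n) * (a (Suc n) * g (Suc (Suc n)))"
    by (simp add: algebra_simps)
  also have "\<dots> = p (Suc n) z * g (Suc n) + a n * (D (Suc n) * g n - D n * g (Suc n))"
    unfolding rec solves_Suc[OF assms] by (simp add: algebra_simps)
  finally show ?case using Suc by (simp add: D_def)
qed simp

lemma p_real: "p n (cnj z) = cnj (p n z)"
  unfolding p_eq_sol by (induction n rule: induct_nat_012) simp_all

lemma char_poly_root_real:
  assumes "n \<ge> 1" "p n z = 0"
  shows "Im z = 0"
proof (rule ccontr)
  assume "Im z \<noteq> 0"
  then consider "Im z > 0" | "Im (cnj z) > 0" by (auto simp: neq_iff)
  then show False
    using p_nonzero[OF _ assms(1), of z] p_nonzero[OF _ assms(1), of "cnj z"] assms(2) by cases (auto simp: p_real)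
qed

text \<open>A multiple root is real, as every root, and the formula above with \<open>g =
  p\<close> would make a sum of real squares vanish whose first term is 1.\<close>
lemma rsquarefree_char_poly: "rsquarefree (char_poly (Suc n))"
  unfolding rsquarefree_roots
proof (intro allI notI, elim conjE)
  fix z assume root: "poly (char_poly (Suc n)) z = 0" and droot: "poly (pderiv (char_poly (Suc n))) z = 0"
  then have "p (Suc n) z = 0" by (simp add: poly_char_poly)
  then have "Im z = 0" by (intro char_poly_root_real[of "Suc n"]) auto
  then have "cnj z = z" by (simp add: complex_eq_iff)
  then have "cnj (p k z) = p k z" for k using p_real[of k z] by simp
  then have sq: "p k z * p k z = of_real ((cmod (p k z))\<^sup>2)" for k by (metis complex_norm_square)
  have "(\<Sum>k=1..n. p k z * p k z) = 0"
    using christoffel_darboux[OF p_solves, of n z] droot \<open>p (Suc n) z = 0\<close> by simp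
  then have "complex_of_real (\<Sum>k=1..n. (cmod (p k z))\<^sup>2) = 0" unfolding sq by simp
  then have "(\<Sum>k=1..n. (cmod (p k z))\<^sup>2) = 0" by (simp only: of_real_eq_0_iff)
  then have "\<forall>k\<in>{1..n}. (cmod (p k z))\<^sup>2 = 0" by (subst (asm) sum_nonneg_eq_0_iff) auto
  then have "(cmod (p k z))\<^sup>2 = 0" if "k \<in> {1..n}" for k using that by blast
  from this[of 1] have "n = 0" by (cases n) auto
  then show False using \<open>p (Suc n) z = 0\<close> by simp
qed

abbreviation \<Lambda> :: "nat \<Rightarrow> real set" where "\<Lambda> \<equiv> truncated_eigenvalues a b"

lemma truncated_eigenvalues_iff: "x \<in> \<Lambda> N \<longleftrightarrow> p (Suc N) (of_real x) = 0 \<and> N \<ge> 1"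
proof
  assume "x \<in> \<Lambda> N"
  then obtain u where u: "u 0 = 0" "u (Suc N) = 0" "\<exists>n\<in>{1..N}. u n \<noteq> 0"
    "\<And>n. n \<in> {1..N} \<Longrightarrow> difference_equation a b (of_real x) u n"
    unfolding truncated_eigenvalues_def mem_Collect_eq Suc_eq_plus1 by blast
  have eq: "u n = u 1 * p n (of_real x)" if "n \<le> Suc N" for n
    using that
  proof (induction n rule: induct_nat_012)
    case (ge2 n)
    have "difference_equation a b (of_real x) u (Suc n)" using u(4) ge2(3) by simp
    then have "a (Suc n) * u (Suc (Suc n)) = (of_real x - b (Suc n)) * u (Suc n) - a n * u n"
      by (simp add: difference_equation_def algebra_simps)
    also have "\<dots> = u 1 * (a (Suc n) * p (Suc (Suc n)) (of_real x))"
      unfolding solves_Suc[OF p_solves] using ge2 by (simp add: algebra_simps)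
    finally have "of_real (a (Suc n)) * u (Suc (Suc n)) = of_real (a (Suc n)) * (u 1 * p (Suc (Suc n)) (of_real x))"
      by (simp add: algebra_simps)
    then show ?case by (simp only: mult_cancel_left of_real_eq_0_iff a_nonzero) simp
  qed (simp_all add: u)
  obtain n where n: "n \<in> {1..N}" "u n \<noteq> 0" using u(3) by blast
  have "u n = u 1 * p n (of_real x)" by (rule eq) (use n in auto)
  with n have "u 1 \<noteq> 0" by (metis mult_zero_left)
  moreover have "u 1 * p (Suc N) (of_real x) = 0" using eq[of "Suc N"] u(2) by (metis order_refl)
  ultimately show "p (Suc N) (of_real x) = 0 \<and> N \<ge> 1" using n by auto
next
  assume *: "p (Suc N) (of_real x) = 0 \<and> N \<ge> 1"
  then have "\<exists>n\<in>{1..N}. p n (of_real x) \<noteq> 0" by (intro bexI[of _ 1]) auto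
  then show "x \<in> \<Lambda> N"
    unfolding truncated_eigenvalues_def using * p_solves[of "of_real x"]
    by (intro CollectI exI[of _ "\<lambda>n. p n (of_real x)"]) auto
qed

lemma char_poly_roots:
  assumes "N \<ge> 1"
  shows "{z. poly (char_poly (Suc N)) z = 0} = of_real ` \<Lambda> N"
proof (intro set_eqI iffI)
  fix z assume "z \<in> {z. poly (char_poly (Suc N)) z = 0}"
  then have z: "p (Suc N) z = 0" by (simp add: poly_char_poly)
  then have "Im z = 0" by (intro char_poly_root_real[of "Suc N"]) auto
  then obtain x where x: "z = of_real x" by (metis complex_is_Real_iff Reals_cases)
  with z assms have "x \<in> \<Lambda> N" by (simp add: truncated_eigenvalues_iff)
  with x show "z \<in> of_real ` \<Lambda> N" by blast
qed (use assms in \<open>auto simp: truncated_eigenvalues_iff poly_char_poly\<close>)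

lemma
  assumes N: "N \<ge> 1"
  shows finite_eigenvalues: "finite (\<Lambda> N)"
    and card_eigenvalues: "card (\<Lambda> N) = N"
    and char_poly_factorization: "p (Suc N) z = (\<Prod>x\<in>\<Lambda> N. z - of_real x) / (\<Prod>n=1..N. of_real (a n))"
proof -
  have inj: "inj_on complex_of_real (\<Lambda> N)" by (auto simp: inj_on_def)
  have nz: "char_poly (Suc N) \<noteq> 0" using coeff_char_poly[of N] by auto
  then have "finite {z. poly (char_poly (Suc N)) z = 0}" by (rule poly_roots_finite)
  then show fin: "finite (\<Lambda> N)" unfolding char_poly_roots[OF N] using inj by (rule finite_imageD)
  have lead: "lead_coeff (char_poly (Suc N)) = 1 / (\<Prod>n=1..N. of_real (a n))"
    using coeff_char_poly[of N] by (simp add: degree_char_poly)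
  have "char_poly (Suc N) = smult (lead_coeff (char_poly (Suc N))) (\<Prod>z\<in>of_real ` \<Lambda> N. [:- z, 1:])"
    using complex_poly_decompose_rsquarefree[OF rsquarefree_char_poly, of N]
    unfolding char_poly_roots[OF N] by (rule sym)
  also have "(\<Prod>z\<in>of_real ` \<Lambda> N. [:- z, 1:]) = (\<Prod>x\<in>\<Lambda> N. [:- complex_of_real x, 1:])"
    by (simp add: prod.reindex[OF inj])
  finally have eq: "char_poly (Suc N) = smult (lead_coeff (char_poly (Suc N))) (\<Prod>x\<in>\<Lambda> N. [:- complex_of_real x, 1:])" .
  have "N = degree (char_poly (Suc N))" by (simp add: degree_char_poly)
  also have "\<dots> = degree (\<Prod>x\<in>\<Lambda> N. [:- complex_of_real x, 1:])"
    using nz by (subst eq) simp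
  also have "\<dots> = card (\<Lambda> N)" by (subst degree_prod_sum_eq) auto
  finally show "card (\<Lambda> N) = N" by simp
  have "p (Suc N) z = poly (char_poly (Suc N)) z" by (simp add: poly_char_poly)
  also have "\<dots> = (\<Prod>x\<in>\<Lambda> N. z - of_real x) / (\<Prod>n=1..N. of_real (a n))"
    by (subst eq) (simp add: lead poly_prod)
  finally show "p (Suc N) z = (\<Prod>x\<in>\<Lambda> N. z - of_real x) / (\<Prod>n=1..N. of_real (a n))" .
qed

lemma logarithmic_derivative_char_poly:
  assumes N: "N \<ge> 1" and z: "Im z > 0"
  shows "poly (pderiv (char_poly (Suc N))) z / p (Suc N) z = (\<Sum>x\<in>\<Lambda> N. 1 / (z - of_real x))"
proof -
  have nz: "z - of_real x \<noteq> 0" for x using z by (auto simp: complex_eq_iff)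
  define A where "A = (\<Prod>n=1..N. complex_of_real (a n))"
  have "A \<noteq> 0" by (simp add: A_def)
  have "((\<lambda>z. (\<Prod>x\<in>\<Lambda> N. z - of_real x) / A) has_field_derivative
      (\<Prod>x\<in>\<Lambda> N. z - of_real x) * (\<Sum>x\<in>\<Lambda> N. 1 / (z - of_real x)) / A) (at z)"
    using nz by (intro DERIV_cdivide has_field_derivative_prod') (auto intro!: derivative_eq_intros)
  moreover have "(poly (char_poly (Suc N)) has_field_derivative poly (pderiv (char_poly (Suc N))) z) (at z)"
    by (rule poly_DERIV)
  moreover have "poly (char_poly (Suc N)) = (\<lambda>z. (\<Prod>x\<in>\<Lambda> N. z - of_real x) / A)"
    unfolding A_def by (simp add: fun_eq_iff poly_char_poly char_poly_factorization[OF N])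
  ultimately have "poly (pderiv (char_poly (Suc N))) z = p (Suc N) z * (\<Sum>x\<in>\<Lambda> N. 1 / (z - of_real x))"
    using DERIV_unique by (fastforce simp: char_poly_factorization[OF N] A_def)
  then show ?thesis using p_nonzero[OF z, of "Suc N"] by simp
qed

text \<open>Compare both sides of the eigenvalue equation at a site where the eigenvector is
  largest. The resulting bound is weakened to the bound \<open>3 * (M + 1)\<close> of the
  operator.\<close>
lemma eigenvalue_bound:
  assumes "x \<in> \<Lambda> N"
  shows "\<bar>x\<bar> \<le> 3 * (M + 1)"
proof -
  define u where "u n = p n (of_real x)" for n
  have u1: "solves (of_real x) u" unfolding u_def by (rule p_solves)
  have u: "u 0 = 0" "u (Suc N) = 0" "u 1 = 1" and N: "N \<ge> 1"
    using assms by (auto simp: u_def truncated_eigenvalues_iff)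
  define m where "m = Max ((\<lambda>k. cmod (u k)) ` {1..N})"
  have "m \<in> (\<lambda>k. cmod (u k)) ` {1..N}" unfolding m_def using N by (intro Max_in) auto
  then obtain n where n1: "n \<in> {1..N}" and mn: "m = cmod (u n)" by blast
  have n2: "cmod (u k) \<le> cmod (u n)" if "k \<in> {1..N}" for k
    unfolding mn[symmetric] m_def using that by (intro Max_ge) auto
  note n = n1 n2
  have max: "cmod (u k) \<le> cmod (u n)" if k: "k \<le> Suc N" for k
  proof -
    have "k = 0 \<or> k = Suc N \<or> k \<in> {1..N}" using k by auto
    then consider "k = 0" | "k = Suc N" | "k \<in> {1..N}" by blast
    then show ?thesis using u(1,2) n2 by cases auto
  qed
  obtain l where l: "n = Suc l" using n(1) by (cases n) auto
  have "cmod (u n) > 0" using max[of 1] u(3) N by (auto intro: less_le_trans[of _ "cmod (u 1)"])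
  have "(of_real x - b n) * u n = a n * u (Suc n) + a l * u l"
    using solves_Suc[OF u1, of l] by (simp add: l)
  then have "\<bar>x - b n\<bar> * cmod (u n) = cmod (a n * u (Suc n) + a l * u l)"
    unfolding norm_of_real[symmetric, where 'a = complex] norm_mult[symmetric] by simp
  also have "\<dots> \<le> a n * cmod (u (Suc n)) + a l * cmod (u l)"
    using norm_triangle_ineq[of "a n * u (Suc n)" "a l * u l"] by (simp add: norm_mult abs_of_pos)
  also have "\<dots> \<le> (M + 1) * cmod (u n) + (M + 1) * cmod (u n)"
    using n(1) l a_le[of n] a_le[of l] M_pos by (intro add_mono mult_mono max) auto
  finally have "\<bar>x - b n\<bar> * cmod (u n) \<le> (2 * (M + 1)) * cmod (u n)" by (simp add: algebra_simps)
  then have "\<bar>x - b n\<bar> \<le> 2 * (M + 1)" using \<open>cmod (u n) > 0\<close> by (simp only: mult_le_cancel_right_pos)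
  then show ?thesis using b_bound[of n] n(1) by auto
qed

section \<open>The density of states measures\<close>

lemma k_measure_facts:
  assumes N: "N \<ge> 1"
  shows "prob_on (3 * (M + 1)) (k_measure a b N)"
    and "continuous_on UNIV f \<Longrightarrow> (\<integral>t. f t \<partial>k_measure a b N) = (\<Sum>x\<in>\<Lambda> N. (f x :: complex)) / of_nat N"
proof -
  let ?P = "point_measure (\<Lambda> N) (\<lambda>_. ennreal (1 / real N))"
  have meas: "(\<lambda>t. t) \<in> measurable ?P borel" by (simp add: measurable_point_measure_eq1)
  have "emeasure ?P (space ?P) = (\<Sum>x\<in>\<Lambda> N. ennreal (1 / real N))"
    using finite_eigenvalues[OF N] by (simp add: emeasure_point_measure_finite space_point_measure)
  also have "\<dots> = 1"
    using N by (simp add: card_eigenvalues[OF N] ennreal_of_nat_eq_real_of_nat flip: ennreal_mult)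
  finally interpret P: prob_space ?P by (rule prob_spaceI)
  have "prob_space (k_measure a b N)" unfolding k_measure_def by (rule P.prob_space_distr[OF meas])
  then interpret K: prob_space "k_measure a b N" .
  have "real_distribution (k_measure a b N)"
    by unfold_locales (simp_all add: k_measure_def)
  moreover have "AE t in k_measure a b N. \<bar>t\<bar> \<le> 3 * (M + 1)"
    unfolding k_measure_def using eigenvalue_bound
    by (subst AE_distr_iff[OF meas]) (auto simp: AE_point_measure space_point_measure intro!: AE_I2)
  ultimately show "prob_on (3 * (M + 1)) (k_measure a b N)" by (simp add: prob_on_def)
  assume f: "continuous_on UNIV f"
  have "(\<integral>t. f t \<partial>k_measure a b N) = (\<integral>t. f t \<partial>?P)"
    unfolding k_measure_def using borel_measurable_continuous_onI[OF f] by (rule integral_distr[OF meas])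
  also have "\<dots> = (\<Sum>x\<in>\<Lambda> N. (1 / real N) *\<^sub>R f x)"
    using finite_eigenvalues[OF N] by (intro lebesgue_integral_point_measure_finite) simp_all
  also have "\<dots> = (\<Sum>x\<in>\<Lambda> N. f x) / of_nat N"
    by (simp add: sum_divide_distrib scaleR_conv_of_real)
  finally show "(\<integral>t. f t \<partial>k_measure a b N) = (\<Sum>x\<in>\<Lambda> N. f x) / of_nat N" .
qed

lemma stieltjes_k_measure:
  assumes "N \<ge> 1" "Im z > 0"
  shows "stieltjes (k_measure a b N) z = (\<Sum>x\<in>\<Lambda> N. 1 / (of_real x - z)) / of_nat N"
  unfolding stieltjes_def using of_real_diff_nonreal[OF assms(2)]
  by (intro k_measure_facts(2)[OF assms(1)] continuous_intros) auto

text \<open>The Stieltjes transform of the eigenvalue measure is the averaged trace of the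
  resolvent of the truncation, and truncating is a perturbation of rank one as far as the
  resolvent on the first \<open>N\<close> sites is concerned. Explicitly, the
  Christoffel-Darboux formula with \<open>g = q\<close> and with \<open>g = p\<close> expresses
  the trace as that of the full resolvent plus \<open>q / p\<close> at \<open>N + 1\<close>
  times the sum of the squares of \<open>p\<close>. The flux bounds this sum, and what remains
  is a Green function times a bounded ratio.\<close>
lemma g_avg_stieltjes_k_measure:
  assumes N: "N \<ge> 1" and z: "Im z > 0"
  shows "cmod (g_avg a b N z - stieltjes (k_measure a b N) z) \<le> (M + 1)\<^sup>2 / (Im z) ^ 3 / real N"
proof -
  define D where "D n = poly (pderiv (char_poly n)) z" for n
  define P where "P = p (Suc N) z"
  define Q where "Q = q (Suc N) z"
  have "P \<noteq> 0" unfolding P_def by (rule p_nonzero[OF z]) simp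
  have "P * (\<Sum>k=1..N. p k z * q k z) - Q * (\<Sum>k=1..N. p k z * p k z)
      = a N * D (Suc N) * (P * q N z - p N z * Q)"
    unfolding christoffel_darboux[OF q_solves, symmetric] christoffel_darboux[OF p_solves, symmetric]
    by (simp add: D_def P_def Q_def algebra_simps)
  also have "\<dots> = D (Suc N)" using wronskian_p_q[of N z] by (simp add: P_def Q_def mult.assoc mult.left_commute)
  \<comment> \<open>The left side is the logarithmic derivative, hence the trace of the resolvent of the truncation.\<close>
  finally have DP: "D (Suc N) / P = (\<Sum>k=1..N. p k z * q k z) - Q / P * (\<Sum>k=1..N. p k z * p k z)"
    using \<open>P \<noteq> 0\<close> by (simp add: field_simps)
  have "D (Suc N) / P = (\<Sum>x\<in>\<Lambda> N. 1 / (z - of_real x))"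
    unfolding D_def P_def by (rule logarithmic_derivative_char_poly[OF N z])
  moreover have "(\<Sum>x\<in>\<Lambda> N. 1 / (z - of_real x)) = - (\<Sum>x\<in>\<Lambda> N. 1 / (of_real x - z))"
    unfolding sum_negf[symmetric] by (intro sum.cong refl) (metis minus_diff_eq minus_divide_right)
  moreover have "(\<Sum>k=1..N. green a b k z) = - (\<Sum>k=1..N. p k z * q k z)"
    unfolding sum_negf[symmetric] by (intro sum.cong refl) (simp add: green_eq[OF z])
  ultimately have "(\<Sum>k=1..N. green a b k z) - (\<Sum>x\<in>\<Lambda> N. 1 / (of_real x - z))
      = - (\<Sum>k=1..N. p k z * q k z) + D (Suc N) / P" by simp
  also have "\<dots> = - (Q / P * (\<Sum>k=1..N. p k z * p k z))" unfolding DP by simp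
  finally have "g_avg a b N z - stieltjes (k_measure a b N) z
      = - (Q / P * (\<Sum>k=1..N. p k z * p k z)) / of_nat N"
    unfolding g_avg_def stieltjes_k_measure[OF N z] by (simp only: diff_divide_distrib[symmetric])
  then have eq: "cmod (g_avg a b N z - stieltjes (k_measure a b N) z)
      = cmod (Q / P) * cmod (\<Sum>k=1..N. p k z * p k z) / real N"
    by (simp only: norm_divide norm_mult norm_minus_cancel norm_of_nat)
  have "Im z * cmod (\<Sum>k=1..N. p k z * p k z) \<le> Im z * (\<Sum>k=1..N. (cmod (p k z))\<^sup>2)"
    using z by (intro mult_left_mono order_trans[OF norm_sum]) (auto simp: norm_mult power2_eq_square)
  also have "\<dots> = flux (\<lambda>n. p n z) N" using flux_eq_sum[OF p_solves, of z N] by (simp add: flux_def)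
  also have "\<dots> \<le> a N * (cmod (p N z) * cmod P)"
    unfolding flux_def P_def using Im_le_cmod[of "cnj (p N z) * p (Suc N) z"]
    by (intro mult_left_mono) (auto simp: norm_mult less_imp_le)
  finally have S: "cmod (\<Sum>k=1..N. p k z * p k z) \<le> a N * (cmod (p N z) * cmod P) / Im z"
    using z by (simp add: field_simps)
  have "cmod (Q / P) * cmod (\<Sum>k=1..N. p k z * p k z) \<le> cmod (Q / P) * (a N * (cmod (p N z) * cmod P) / Im z)"
    by (intro mult_left_mono S) simp
  also have "\<dots> = cmod (green a b (Suc N) z) * (a N * cmod (p N z / P)) / Im z"
    using \<open>P \<noteq> 0\<close> by (simp add: green_eq[OF z] norm_mult norm_divide P_def Q_def)
  also have "\<dots> \<le> 1 / Im z * ((M + 1)\<^sup>2 / Im z) / Im z"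
    unfolding P_def using green_bounds(2)[OF z, of "Suc N"] p_ratio_inverse[OF z N] z
    by (intro divide_right_mono mult_mono) (auto simp: less_imp_le)
  also have "\<dots> = (M + 1)\<^sup>2 / (Im z) ^ 3" by (simp add: power3_eq_cube)
  finally show ?thesis unfolding eq by (intro divide_right_mono) auto
qed

end

section \<open>The Thouless formula\<close>

text \<open>Two holomorphic logarithms of the same function on a connected set differ by a
  constant, which is determined by the behaviour at infinity.\<close>
lemma holomorphic_logarithms_eq:
  assumes A: "A holomorphic_on upper_half_plane" and B: "B holomorphic_on upper_half_plane"
    and exp_eq: "\<And>z. Im z > 0 \<Longrightarrow> exp (A z) = exp (B z)"
    and lim: "((\<lambda>y. A (Complex 0 y) - B (Complex 0 y)) \<longlongrightarrow> 0) at_top"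
    and z: "Im z > 0"
  shows "A z = B z"
proof -
  define f where "f z = A z - B z" for z
  have f: "f holomorphic_on upper_half_plane" unfolding f_def by (intro holomorphic_intros A B)
  have "(f has_field_derivative 0) (at x within upper_half_plane)" if x: "x \<in> upper_half_plane" for x
  proof -
    have df: "(f has_field_derivative deriv f x) (at x)"
      by (rule holomorphic_derivI[OF f open_upper_half_plane x])
    then have "((\<lambda>z. exp (f z)) has_field_derivative exp (f x) * deriv f x) (at x)"
      by (rule DERIV_chain'[OF _ DERIV_exp])
    moreover have "((\<lambda>z. exp (f z)) has_field_derivative 0) (at x)"
    proof (rule has_field_derivative_transform_within_open[OF DERIV_const open_upper_half_plane x])
      show "1 = exp (f w)" if "w \<in> upper_half_plane" for w
        using exp_eq[of w] that by (simp add: f_def exp_diff)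
    qed
    ultimately have "exp (f x) * deriv f x = 0" by (rule DERIV_unique)
    then show ?thesis using df by (simp add: has_field_derivative_at_within)
  qed
  then obtain c where c: "\<And>x. Im x > 0 \<Longrightarrow> f x = c"
    using has_field_derivative_zero_constant[OF convex_halfspace_Im_gt[of 0], of f] by auto
  have "((\<lambda>y. f (Complex 0 y)) \<longlongrightarrow> c) at_top"
  proof (rule tendsto_eventually)
    show "\<forall>\<^sub>F y in at_top. f (Complex 0 y) = c"
      using eventually_gt_at_top[of 0] by eventually_elim (simp add: c)
  qed
  moreover have "((\<lambda>y. f (Complex 0 y)) \<longlongrightarrow> 0) at_top" using lim by (simp add: f_def)
  ultimately have "c = 0" using tendsto_unique trivial_limit_at_top_linorder by blast
  then show ?thesis using c[OF z] by (simp add: f_def)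
qed

lemma Ln_along_imaginary_axis:
  fixes f :: "real \<Rightarrow> complex"
  assumes "\<And>y. y > 0 \<Longrightarrow> Im (f y) > 0" and "c > 0"
    and "\<And>y. y \<ge> 1 \<Longrightarrow> cmod (f y - c * Complex 0 y) \<le> B"
  shows "((\<lambda>y. Ln (f y) - Ln (Complex 0 y)) \<longlongrightarrow> of_real (ln c)) at_top"
proof -
  have "((\<lambda>y. f y / Complex 0 y - of_real c) \<longlongrightarrow> 0) at_top"
  proof (rule Lim_null_comparison)
    show "((\<lambda>y. B / y) \<longlongrightarrow> 0) at_top"
      by (intro tendsto_divide_0[OF tendsto_const] filterlim_at_top_imp_at_infinity filterlim_ident)
    show "\<forall>\<^sub>F y in at_top. norm (f y / Complex 0 y - of_real c) \<le> B / y"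
      using eventually_ge_at_top[of 1]
    proof eventually_elim
      case (elim y)
      then have nz: "Complex 0 y \<noteq> 0" by (simp add: complex_eq_iff)
      have "f y / Complex 0 y - of_real c = (f y - c * Complex 0 y) / Complex 0 y"
        using nz by (simp add: field_simps)
      also have "cmod \<dots> = cmod (f y - c * Complex 0 y) / y"
      proof -
        have "cmod (Complex 0 y) = y" using elim by (simp add: cmod_def)
        then show ?thesis by (simp only: norm_divide)
      qed
      finally show ?case using assms(3)[OF elim] elim by (simp add: divide_right_mono)
    qed
  qed
  then have "((\<lambda>y. f y / Complex 0 y) \<longlongrightarrow> of_real c) at_top" by (rule LIM_zero_cancel)
  then have "((\<lambda>y. Ln (f y / Complex 0 y)) \<longlongrightarrow> Ln (of_real c)) at_top"
    using \<open>c > 0\<close> by (intro tendsto_Ln) (auto simp: complex_nonpos_Reals_iff)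
  moreover have "\<forall>\<^sub>F y in at_top. Ln (f y / Complex 0 y) = Ln (f y) - Ln (Complex 0 y)"
    using eventually_gt_at_top[of 0] by eventually_elim (subst Ln_diff_upper, auto intro: assms(1))
  ultimately have "((\<lambda>y. Ln (f y) - Ln (Complex 0 y)) \<longlongrightarrow> Ln (of_real c)) at_top"
    by (rule Lim_transform_eventually)
  then show ?thesis using \<open>c > 0\<close> by (simp add: Ln_of_real)
qed

context jacobi_coefficients
begin

text \<open>The Thouless formula. Both sides, multiplied by \<open>N\<close>, are holomorphic
  logarithms of \<open>p (N + 1)\<close>: the left side as a product of successive ratios, the
  right side as a product over the eigenvalues. Along the imaginary axis each of the
  \<open>N\<close> logarithms on either side behaves like \<open>Ln z\<close> plus a constant,
  and the constants agree.\<close>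
lemma log_average_eq:
  assumes N: "N \<ge> 1" and z: "Im z > 0"
  shows "w_minus a b N z =
    (\<integral>t. Ln (z - of_real t) \<partial>k_measure a b N) - of_real ((\<Sum>n=1..N. ln (a n)) / real N)"
proof -
  define A where "A z = (\<Sum>n=1..N. Ln (p (Suc n) z / p n z))" for z
  define B where "B z = (\<Sum>x\<in>\<Lambda> N. Ln (z - of_real x)) - of_real (\<Sum>n=1..N. ln (a n))" for z
  have p_hol: "(\<lambda>z. p n z) holomorphic_on S" for n S
    unfolding poly_char_poly[symmetric] by (intro holomorphic_intros)
  have Im_diff: "Im z > 0 \<Longrightarrow> Im (z - of_real x) > 0" for z x by simp
  have "A holomorphic_on upper_half_plane"
    unfolding A_def
  proof (intro holomorphic_intros p_hol)
    fix n z assume "n \<in> {1..N}" "z \<in> upper_half_plane"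
    then show "p n z \<noteq> 0" "p (Suc n) z / p n z \<notin> \<real>\<^sub>\<le>\<^sub>0"
      using p_nonzero[of z n] p_ratio_upper[of z n] by (auto simp: complex_nonpos_Reals_iff)
  qed
  moreover have "B holomorphic_on upper_half_plane"
    unfolding B_def by (intro holomorphic_intros) (auto simp: complex_nonpos_Reals_iff)
  moreover have "exp (A z) = exp (B z)" if z: "Im z > 0" for z
  proof -
    have "exp (A z) = (\<Prod>n=1..N. p (Suc n) z / p n z)"
      unfolding A_def exp_sum[OF finite_atLeastAtMost]
    proof (intro prod.cong refl)
      fix n assume "n \<in> {1..N}"
      then show "exp (Ln (p (Suc n) z / p n z)) = p (Suc n) z / p n z"
        using p_nonzero[OF z, of n] p_nonzero[OF z, of "Suc n"] by (intro exp_Ln) auto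
    qed
    also have "\<dots> = p (Suc N) z"
      using N by (induction N rule: dec_induct) (use p_nonzero[OF z] in auto)
    also have "\<dots> = exp (B z)"
    proof -
      have "exp (\<Sum>x\<in>\<Lambda> N. Ln (z - of_real x)) = (\<Prod>x\<in>\<Lambda> N. z - of_real x)"
        unfolding exp_sum[OF finite_eigenvalues[OF N]] using Im_diff[OF z]
        by (intro prod.cong refl exp_Ln) (metis zero_complex.simps(2) less_irrefl)
      moreover have "exp (complex_of_real (\<Sum>n=1..N. ln (a n))) = (\<Prod>n=1..N. of_real (a n))"
      proof -
        have "exp (\<Sum>n=1..N. ln (a n)) = (\<Prod>n=1..N. a n)" by (simp add: exp_sum)
        then show ?thesis by (simp only: exp_of_real of_real_prod)
      qed
      ultimately show ?thesis unfolding B_def exp_diff char_poly_factorization[OF N] by simp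
    qed
    finally show ?thesis .
  qed
  moreover have "((\<lambda>y. A (Complex 0 y) - B (Complex 0 y)) \<longlongrightarrow> 0) at_top"
  proof -
    let ?iy = "\<lambda>y. Complex 0 y"
    have "((\<lambda>y. Ln (p (Suc n) (?iy y) / p n (?iy y)) - Ln (?iy y)) \<longlongrightarrow> of_real (ln (1 / a n))) at_top"
      if n: "n \<in> {1..N}" for n
    proof (rule Ln_along_imaginary_axis)
      show "Im (p (Suc n) (?iy y) / p n (?iy y)) > 0" if "y > 0" for y
        using p_ratio_upper[of "?iy y" n] n that by simp
      show "cmod (p (Suc n) (?iy y) / p n (?iy y) - of_real (1 / a n) * ?iy y) \<le> ((M + 1)\<^sup>2 + M) / a n"
        if y: "y \<ge> 1" for y
      proof -
        define r where "r = p (Suc n) (?iy y) / p n (?iy y)"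
        have "cmod (of_real (a n) * r - (?iy y - of_real (b n))) \<le> (M + 1)\<^sup>2 / y"
          using p_ratio_approx[of "?iy y" n] n y by (simp add: r_def)
        also have "\<dots> \<le> (M + 1)\<^sup>2" using y by (simp add: divide_le_eq mult_le_cancel_left1)
        finally have "cmod (of_real (a n) * r - ?iy y) \<le> (M + 1)\<^sup>2 + M"
          using norm_triangle_ineq4[of "of_real (a n) * r - (?iy y - of_real (b n))" "of_real (b n)"]
            b_bound[of n] n by (simp add: algebra_simps)
        moreover have "r - of_real (1 / a n) * ?iy y = (of_real (a n) * r - ?iy y) / of_real (a n)"
          by (simp add: diff_divide_distrib)
        ultimately show ?thesis unfolding r_def[symmetric]
          by (simp add: norm_divide abs_of_pos divide_right_mono less_imp_le)
      qed
    qed simp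
    then have limA: "((\<lambda>y. \<Sum>n=1..N. Ln (p (Suc n) (?iy y) / p n (?iy y)) - Ln (?iy y)) \<longlongrightarrow>
        (\<Sum>n=1..N. of_real (ln (1 / a n)))) at_top" by (rule tendsto_sum)
    have "((\<lambda>y. Ln (?iy y - of_real x) - Ln (?iy y)) \<longlongrightarrow> of_real (ln 1)) at_top" for x
      by (rule Ln_along_imaginary_axis[where B = "\<bar>x\<bar>"]) auto
    then have limB: "((\<lambda>y. \<Sum>x\<in>\<Lambda> N. Ln (?iy y - of_real x) - Ln (?iy y)) \<longlongrightarrow> (\<Sum>x\<in>\<Lambda> N. of_real (ln 1))) at_top"
      by (intro tendsto_sum)
    \<comment> \<open>The logarithms of \<open>\<i> * y\<close> cancel, because there are as many eigenvalues as sites.\<close>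
    have "A (?iy y) - B (?iy y) = (\<Sum>n=1..N. Ln (p (Suc n) (?iy y) / p n (?iy y)) - Ln (?iy y))
        - (\<Sum>x\<in>\<Lambda> N. Ln (?iy y - of_real x) - Ln (?iy y)) + of_real (\<Sum>n=1..N. ln (a n))" for y
      by (simp add: A_def B_def sum_subtractf card_eigenvalues[OF N])
    moreover have "((\<lambda>y. (\<Sum>n=1..N. Ln (p (Suc n) (?iy y) / p n (?iy y)) - Ln (?iy y))
        - (\<Sum>x\<in>\<Lambda> N. Ln (?iy y - of_real x) - Ln (?iy y)) + of_real (\<Sum>n=1..N. ln (a n)))
        \<longlongrightarrow> (\<Sum>n=1..N. of_real (ln (1 / a n))) - (\<Sum>x\<in>\<Lambda> N. of_real (ln 1)) + of_real (\<Sum>n=1..N. ln (a n))) at_top"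
      by (intro tendsto_add tendsto_diff limA limB tendsto_const)
    moreover have "(\<Sum>n=1..N. complex_of_real (ln (1 / a n))) = - of_real (\<Sum>n=1..N. ln (a n))"
      by (simp add: ln_div sum_negf)
    ultimately show ?thesis by simp
  qed
  ultimately have "A z = B z" by (rule holomorphic_logarithms_eq[OF _ _ _ _ z])
  moreover have "(\<integral>t. Ln (z - of_real t) \<partial>k_measure a b N) = (\<Sum>x\<in>\<Lambda> N. Ln (z - of_real x)) / of_nat N"
    using z by (intro k_measure_facts(2)[OF N] continuous_intros) (auto simp: complex_nonpos_Reals_iff)
  ultimately show ?thesis
    unfolding w_minus_def a_m_minus A_def B_def by (simp add: diff_divide_distrib)
qed

lemma w_minus_derivative:
  assumes N: "N \<ge> 1" and z: "Im z > 0"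
  shows "(w_minus a b N has_field_derivative - stieltjes (k_measure a b N) z) (at z)"
proof (rule has_field_derivative_transform_within_open[OF _ open_upper_half_plane])
  have int: "(\<integral>t. Ln (z - of_real t) \<partial>k_measure a b N) = (\<Sum>x\<in>\<Lambda> N. Ln (z - of_real x)) / of_nat N"
    if "Im z > 0" for z
    using that by (intro k_measure_facts(2)[OF N] continuous_intros) (auto simp: complex_nonpos_Reals_iff)
  show "(\<Sum>x\<in>\<Lambda> N. Ln (z - of_real x)) / of_nat N - of_real ((\<Sum>n=1..N. ln (a n)) / real N) = w_minus a b N z"
    if "z \<in> upper_half_plane" for z
    using that log_average_eq[OF N, of z] int[of z] by simp
  have "((\<lambda>z. Ln (z - of_real x)) has_field_derivative 1 / (z - of_real x)) (at z)" for x
  proof -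
    have "z - of_real x \<notin> \<real>\<^sub>\<le>\<^sub>0" using z by (simp add: complex_nonpos_Reals_iff)
    moreover have "((\<lambda>z. z - of_real x) has_field_derivative 1 - 0) (at z)"
      by (rule DERIV_diff[OF DERIV_ident DERIV_const])
    ultimately have "((\<lambda>z. Ln (z - of_real x)) has_field_derivative inverse (z - of_real x) * (1 - 0)) (at z)"
      by (intro DERIV_chain2[OF has_field_derivative_Ln])
    then show ?thesis by (simp add: inverse_eq_divide)
  qed
  then have "((\<lambda>z. \<Sum>x\<in>\<Lambda> N. Ln (z - of_real x)) has_field_derivative (\<Sum>x\<in>\<Lambda> N. 1 / (z - of_real x))) (at z)"
    by (rule DERIV_sum)
  then have "((\<lambda>z. (\<Sum>x\<in>\<Lambda> N. Ln (z - of_real x)) / of_nat N - of_real ((\<Sum>n=1..N. ln (a n)) / real N))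
      has_field_derivative (\<Sum>x\<in>\<Lambda> N. 1 / (z - of_real x)) / of_nat N - 0) (at z)"
    by (rule DERIV_diff[OF DERIV_cdivide DERIV_const])
  moreover have "1 / (z - of_real x) = - (1 / (of_real x - z))" for x
    by (metis minus_diff_eq minus_divide_right)
  then have "(\<Sum>x\<in>\<Lambda> N. 1 / (z - of_real x)) / of_nat N - 0 = - stieltjes (k_measure a b N) z"
    unfolding stieltjes_k_measure[OF N z] by (simp only: sum_negf divide_minus_left diff_0_right)
  ultimately show "((\<lambda>z. (\<Sum>x\<in>\<Lambda> N. Ln (z - of_real x)) / of_nat N - of_real ((\<Sum>n=1..N. ln (a n)) / real N))
      has_field_derivative - stieltjes (k_measure a b N) z) (at z)" by simp
qed (use z in simp)

lemma w_minus_holomorphic: "w_minus a b N holomorphic_on upper_half_plane"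
proof (cases "N \<ge> 1")
  case True
  show ?thesis
    unfolding holomorphic_on_open[OF open_upper_half_plane]
  proof (intro ballI exI)
    fix z assume "z \<in> upper_half_plane"
    then show "(w_minus a b N has_field_derivative - stieltjes (k_measure a b N) z) (at z)"
      by (intro w_minus_derivative True) simp
  qed
next
  case False
  then have "w_minus a b N = (\<lambda>z. 0)" by (auto simp: w_minus_def)
  then show ?thesis by simp
qed

text \<open>The derivative is the Stieltjes transform of a probability measure.\<close>
lemma w_minus_lipschitz:
  assumes e: "e > 0" and zw: "e \<le> Im z" "e \<le> Im w"
  shows "cmod (w_minus a b N z - w_minus a b N w) \<le> 1 / e * cmod (z - w)"
proof (cases "N \<ge> 1")
  case True
  show ?thesis
  proof (rule field_differentiable_bound[of "{z. e \<le> Im z}"])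
    show "convex {z. e \<le> Im z}" using convex_halfspace_Im_ge by simp
    fix x assume x: "x \<in> {z. e \<le> Im z}"
    then have Im_x: "Im x > 0" using e by auto
    show "(w_minus a b N has_field_derivative - stieltjes (k_measure a b N) x) (at x within {z. e \<le> Im z})"
      by (rule has_field_derivative_at_within[OF w_minus_derivative[OF True Im_x]])
    have "cmod (stieltjes (k_measure a b N) x) \<le> 1 / Im x"
      unfolding stieltjes_def using of_real_diff_nonreal[OF Im_x] cmod_inverse_of_real_diff_le[OF Im_x]
      by (intro prob_on_integral_bound(2)[OF k_measure_facts(1)[OF True]] continuous_intros) auto
    also have "\<dots> \<le> 1 / e" using x e by (simp add: frac_le)
    finally show "cmod (- stieltjes (k_measure a b N) x) \<le> 1 / e" by simp
  qed (use zw in auto)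
next
  case False
  then show ?thesis using e by (simp add: w_minus_def)
qed

section \<open>Equivalence of the convergence statements\<close>

lemma cond_A_iff:
  "cond_A a N \<longleftrightarrow> convergent (\<lambda>j. (\<Sum>n=1..N j. ln (a n)) / real (N j))"
proof -
  define s where "s j = (\<Sum>n=1..N j. ln (a n)) / real (N j)" for j
  have eq: "(\<Prod>n=1..N j. a n) powr (1 / real (N j)) = exp (s j)" for j
  proof -
    have "(\<Prod>n=1..N j. a n) \<noteq> 0" by (simp add: prod_pos)
    then show ?thesis by (simp add: powr_def ln_prod s_def)
  qed
  show ?thesis unfolding cond_A_def eq s_def[symmetric]
  proof
    assume "\<exists>A>0. (\<lambda>j. exp (s j)) \<longlonglongrightarrow> A"
    then obtain A where "A > 0" "(\<lambda>j. exp (s j)) \<longlonglongrightarrow> A" by blast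
    then have "(\<lambda>j. ln (exp (s j))) \<longlonglongrightarrow> ln A" by (intro tendsto_ln) auto
    then show "convergent s" by (auto simp: convergent_def)
  next
    assume "convergent s"
    then obtain l where "s \<longlonglongrightarrow> l" by (auto simp: convergent_def)
    then have "(\<lambda>j. exp (s j)) \<longlonglongrightarrow> exp l" by (rule tendsto_exp)
    then show "\<exists>A>0. (\<lambda>j. exp (s j)) \<longlonglongrightarrow> A" by (intro exI[of _ "exp l"]) simp
  qed
qed

context
  fixes N :: "nat \<Rightarrow> nat"
  assumes N: "filterlim N at_top sequentially"
begin

lemma eventually_N_pos: "\<forall>\<^sub>F j in sequentially. N j \<ge> 1"
  using N by (simp add: filterlim_at_top)

lemma w_plus_w_minus_close:
  assumes "compact K" "K \<subseteq> upper_half_plane"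
  shows "\<exists>C. \<forall>n\<ge>1. \<forall>z\<in>K. cmod (w_plus a b n z - (\<i> * pi + (-1) * w_minus a b n z)) \<le> C / real n"
    and "\<exists>C. \<forall>n\<ge>1. \<forall>z\<in>K. cmod (w_minus a b n z - (\<i> * pi + (-1) * w_plus a b n z)) \<le> C / real n"
proof -
  obtain B where B: "\<And>z n. z \<in> K \<Longrightarrow> n \<ge> 1 \<Longrightarrow> cmod (Ln (green a b n z)) \<le> B"
    using Ln_green_bounded[OF assms] by blast
  have le: "cmod (w_plus a b n z - (\<i> * pi - w_minus a b n z)) \<le> (2 * B) / real n"
    if "n \<ge> 1" "z \<in> K" for n z
  proof -
    have z: "Im z > 0" using that assms(2) by auto
    have "cmod (Ln (green a b (Suc n) z) - Ln (green a b 1 z)) \<le> B + B"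
      by (rule order_trans[OF norm_triangle_ineq4 add_mono]) (use B that in auto)
    then show ?thesis unfolding w_plus_w_minus[OF z that(1)]
      by (simp add: norm_divide divide_right_mono)
  qed
  then show "\<exists>C. \<forall>n\<ge>1. \<forall>z\<in>K. cmod (w_plus a b n z - (\<i> * pi + (-1) * w_minus a b n z)) \<le> C / real n"
    by (intro exI[of _ "2 * B"]) simp
  have "w_minus a b n z - (\<i> * pi + (-1) * w_plus a b n z) = w_plus a b n z - (\<i> * pi - w_minus a b n z)" for n z
    by simp
  then show "\<exists>C. \<forall>n\<ge>1. \<forall>z\<in>K. cmod (w_minus a b n z - (\<i> * pi + (-1) * w_plus a b n z)) \<le> C / real n"
    using le by (intro exI[of _ "2 * B"] allI impI ballI) (simp only:)
qed

lemma cond_WP_iff_WM: "cond_WP a b N \<longleftrightarrow> cond_WM a b N"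
proof
  assume "cond_WP a b N"
  then have "converges_holomorphically (\<lambda>j. w_plus a b (N j))"
    unfolding cond_WP_def by (rule converges_in_herglotz_imp_holomorphically)
  then show "cond_WM a b N" unfolding cond_WM_def
    by (rule converges_in_herglotz_transfer[OF _ N w_plus_w_minus_close(2)]) (use w_Im_lower in blast)+
next
  assume "cond_WM a b N"
  then have "converges_holomorphically (\<lambda>j. w_minus a b (N j))"
    unfolding cond_WM_def by (rule converges_in_herglotz_imp_holomorphically)
  then show "cond_WP a b N" unfolding cond_WP_def
    by (rule converges_in_herglotz_transfer[OF _ N w_plus_w_minus_close(1)]) (use w_Im_lower in blast)+
qed

lemma eventually_prob_on_k: "\<forall>\<^sub>F j in sequentially. prob_on (3 * (M + 1)) (k_measure a b (N j))"
  using eventually_N_pos by eventually_elim (rule k_measure_facts(1))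

text \<open>Convergence of the Stieltjes transforms, or equivalently of the averaged Green
  functions, at each point is the common form into which the conditions on \<open>g\<close>,
  \<open>\<nu>\<close> and \<open>k\<close> are translated.\<close>
lemma cond_K_iff_stieltjes:
  "cond_K a b N \<longleftrightarrow> (\<forall>z. Im z > 0 \<longrightarrow> convergent (\<lambda>j. stieltjes (k_measure a b (N j)) z))"
  unfolding cond_K_def by (rule converges_to_probability_iff_stieltjes[OF eventually_prob_on_k])

lemma cond_K_iff_g_avg:
  "cond_K a b N \<longleftrightarrow> (\<forall>z. Im z > 0 \<longrightarrow> convergent (\<lambda>j. g_avg a b (N j) z))"
proof -
  have "convergent (\<lambda>j. stieltjes (k_measure a b (N j)) z) \<longleftrightarrow> convergent (\<lambda>j. g_avg a b (N j) z)"
    if z: "Im z > 0" for z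
  proof -
    define d where "d j = g_avg a b (N j) z - stieltjes (k_measure a b (N j)) z" for j
    have "d \<longlonglongrightarrow> 0"
    proof (rule Lim_null_comparison)
      show "(\<lambda>j. (M + 1)\<^sup>2 / (Im z) ^ 3 / real (N j)) \<longlonglongrightarrow> 0"
        by (rule filterlim_compose[OF lim_const_over_n N])
      show "\<forall>\<^sub>F j in sequentially. norm (d j) \<le> (M + 1)\<^sup>2 / (Im z) ^ 3 / real (N j)"
        using eventually_N_pos by eventually_elim (simp only: d_def g_avg_stieltjes_k_measure z)
    qed
    then have d: "convergent d" by (auto simp: convergent_def)
    show ?thesis
    proof
      assume "convergent (\<lambda>j. stieltjes (k_measure a b (N j)) z)"
      from convergent_add[OF this d] show "convergent (\<lambda>j. g_avg a b (N j) z)" by (simp add: d_def)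
    next
      assume "convergent (\<lambda>j. g_avg a b (N j) z)"
      from convergent_diff[OF this d] show "convergent (\<lambda>j. stieltjes (k_measure a b (N j)) z)"
        by (simp add: d_def)
    qed
  qed
  then show ?thesis unfolding cond_K_iff_stieltjes by blast
qed

lemma cond_N_iff_g_avg:
  assumes "spectral_resolution (jacobi a b) E"
  shows "cond_N E N \<longleftrightarrow> (\<forall>z. Im z > 0 \<longrightarrow> convergent (\<lambda>j. g_avg a b (N j) z))"
proof -
  interpret R: bounded_spectral_resolution "jacobi a b" E "3 * (M + 1)"
    by (rule bounded_spectral_resolution_jacobi[OF assms])
  have resolves: "lincomb 1 (jacobi a b (green_vector n z)) (- z) (green_vector n z) = delta n"
    if "n \<ge> 1" "Im z > 0" for n z
    using green_vector_resolves(2)[OF that(2,1)] by (simp add: fun_eq_iff)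
  have nu: "prob_on (\<bar>3 * (M + 1)\<bar> + 1) (nu_measure E n)" "stieltjes (nu_measure E n) z = g_avg a b n z"
    if n: "n \<ge> 1" and z: "Im z > 0" for n z
  proof -
    have *: "n > 0" using n by simp
    note nu = R.nu_measure_stieltjes[OF * z, where v = "\<lambda>k. green_vector k z"]
    show "prob_on (\<bar>3 * (M + 1)\<bar> + 1) (nu_measure E n)"
      by (rule nu(1)) (use green_vector_resolves(1)[OF z] resolves z in auto)
    have "stieltjes (nu_measure E n) z = (\<Sum>k=1..n. ell2_inner (delta k) (green_vector k z)) / of_nat n"
      by (rule nu(2)) (use green_vector_resolves(1)[OF z] resolves z in auto)
    also have "\<dots> = g_avg a b n z"
      unfolding g_avg_def
      by (intro arg_cong2[where f = "(/)"] sum.cong refl)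
        (simp add: ell2_inner_delta green_vector_def green_eq[OF z])
    finally show "stieltjes (nu_measure E n) z = g_avg a b n z" .
  qed
  have ev: "\<forall>\<^sub>F j in sequentially. prob_on (\<bar>3 * (M + 1)\<bar> + 1) (nu_measure E (N j))"
    using eventually_N_pos by eventually_elim (rule nu(1)[of _ \<i>], auto)
  have "convergent (\<lambda>j. stieltjes (nu_measure E (N j)) z) \<longleftrightarrow> convergent (\<lambda>j. g_avg a b (N j) z)"
    if "Im z > 0" for z
    by (rule convergent_cong) (use eventually_N_pos in \<open>eventually_elim, simp add: nu(2) that\<close>)
  then show ?thesis
    unfolding cond_N_def converges_to_probability_iff_stieltjes[OF ev] by blast
qed

text \<open>The limit of the averaged Green functions is obtained from the Stieltjes transforms
  of the eigenvalue measures: these are rational functions, so holomorphy and Lipschitz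
  estimates are immediate.\<close>
lemma cond_K_iff_G: "cond_K a b N \<longleftrightarrow> cond_G a b N"
proof
  assume "cond_G a b N"
  then have "converges_holomorphically (\<lambda>j. g_avg a b (N j))"
    unfolding cond_G_def by (rule converges_in_herglotz_imp_holomorphically)
  then show "cond_K a b N"
    unfolding cond_K_iff_g_avg using converges_holomorphically_imp_convergent by blast
next
  assume K: "cond_K a b N"
  define S where "S n z = (\<Sum>x\<in>\<Lambda> n. 1 / (of_real x - z)) / of_nat n" for n :: nat and z :: complex
  have S: "S n z = stieltjes (k_measure a b n) z" if "n \<ge> 1" "Im z > 0" for n z
    unfolding S_def using stieltjes_k_measure[OF that] by simp
  have "converges_holomorphically (\<lambda>j. S (N j))"
  proof (rule converges_holomorphically_pointwise)
    show "S (N j) holomorphic_on upper_half_plane" for j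
      unfolding S_def using of_real_diff_nonreal by (cases "N j = 0") (auto intro!: holomorphic_intros)
    show "convergent (\<lambda>j. S (N j) z)" if z: "Im z > 0" for z
    proof (rule convergent_eventually_eq)
      show "\<forall>\<^sub>F j in sequentially. S (N j) z = stieltjes (k_measure a b (N j)) z"
        using eventually_N_pos by eventually_elim (rule S[OF _ z])
      show "convergent (\<lambda>j. stieltjes (k_measure a b (N j)) z)" using K z cond_K_iff_stieltjes by blast
    qed
    fix e :: real assume e: "e > 0"
    have "cmod (S n z - S n w) \<le> 1 / e\<^sup>2 * cmod (z - w)" if zw: "e \<le> Im z" "e \<le> Im w" for n z w
    proof (cases "n \<ge> 1")
      case True
      have le: "cmod (1 / (of_real x - z) - 1 / (of_real x - w)) \<le> 1 / e\<^sup>2 * cmod (z - w)" for x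
      proof -
        have Im: "Im z > 0" "Im w > 0" using zw e by auto
        have "1 / (of_real x - z) - 1 / (of_real x - w) = (1 / (of_real x - z)) * (1 / (of_real x - w)) * (z - w)"
          using of_real_diff_nonreal[OF Im(1), of x] of_real_diff_nonreal[OF Im(2), of x] by (simp add: field_simps)
        also have "cmod \<dots> \<le> (1 / e * (1 / e)) * cmod (z - w)"
          unfolding norm_mult
          using cmod_inverse_of_real_diff_le[OF Im(1), of x] cmod_inverse_of_real_diff_le[OF Im(2), of x]
            frac_le[of 1 1 e "Im z"] frac_le[of 1 1 e "Im w"] e zw
          by (intro mult_right_mono mult_mono) auto
        finally show ?thesis by (simp add: power2_eq_square)
      qed
      have "S n z - S n w = (\<Sum>x\<in>\<Lambda> n. 1 / (of_real x - z) - 1 / (of_real x - w)) / of_nat n"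
        by (simp add: S_def sum_subtractf diff_divide_distrib)
      also have "cmod \<dots> \<le> (\<Sum>x\<in>\<Lambda> n. 1 / e\<^sup>2 * cmod (z - w)) / real n"
        unfolding norm_divide norm_of_nat by (intro divide_right_mono order_trans[OF norm_sum] sum_mono le) simp
      also have "\<dots> = 1 / e\<^sup>2 * cmod (z - w)" using True by (simp add: card_eigenvalues)
      finally show ?thesis .
    next
      case False
      then have "n = 0" by simp
      then show ?thesis using e by (simp add: S_def)
    qed
    then show "\<exists>B. \<forall>j z w. e \<le> Im z \<longrightarrow> e \<le> Im w \<longrightarrow> cmod (S (N j) z - S (N j) w) \<le> B * cmod (z - w)"
      by blast
  qed
  then show "cond_G a b N" unfolding cond_G_def
  proof (rule converges_in_herglotz_transfer[where c = 0 and s = 1, OF _ N _ g_avg_Im_lower])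
    fix K assume K: "compact K" "K \<subseteq> upper_half_plane"
    obtain e where e: "e > 0" "\<forall>z\<in>K. e \<le> Im z" using compact_upper_half_plane_Im_bound[OF K] by blast
    have "cmod (g_avg a b n z - (0 + 1 * S n z)) \<le> (M + 1)\<^sup>2 / e ^ 3 / real n" if n: "n \<ge> 1" and z: "z \<in> K" for n z
    proof -
      have Im: "Im z > 0" using z K by auto
      have "cmod (g_avg a b n z - (0 + 1 * S n z)) \<le> (M + 1)\<^sup>2 / (Im z) ^ 3 / real n"
        using g_avg_stieltjes_k_measure[OF n Im] by (simp add: S[OF n Im])
      also have "\<dots> \<le> (M + 1)\<^sup>2 / e ^ 3 / real n"
        using e z by (intro divide_right_mono divide_left_mono power_mono) (auto intro!: mult_pos_pos zero_less_power Im)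
      finally show ?thesis .
    qed
    then show "\<exists>C. \<forall>n\<ge>1. \<forall>z\<in>K. cmod (g_avg a b n z - (0 + 1 * S n z)) \<le> C / real n" by blast
  qed
qed

text \<open>Locally uniform convergence of holomorphic functions carries over to the
  derivatives.\<close>
lemma cond_WM_imp_K:
  assumes "cond_WM a b N"
  shows "cond_K a b N"
  unfolding cond_K_iff_stieltjes
proof (intro allI impI)
  fix z assume z: "Im z > 0"
  have "converges_holomorphically (\<lambda>j. w_minus a b (N j))"
    using assms unfolding cond_WM_def by (rule converges_in_herglotz_imp_holomorphically)
  then have "convergent (\<lambda>j. - stieltjes (k_measure a b (N j)) z)"
  proof (rule converges_holomorphically_derivative[OF _ z])
    show "\<forall>\<^sub>F j in sequentially. \<forall>z. Im z > 0 \<longrightarrow>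
        (w_minus a b (N j) has_field_derivative - stieltjes (k_measure a b (N j)) z) (at z)"
      using eventually_N_pos by eventually_elim (use w_minus_derivative in blast)
  qed
  then show "convergent (\<lambda>j. stieltjes (k_measure a b (N j)) z)"
    by (simp add: convergent_minus_iff[symmetric])
qed

lemma cond_K_imp_log_integrals_convergent:
  assumes "cond_K a b N" "Im z > 0"
  shows "convergent (\<lambda>j. \<integral>t. Ln (z - of_real t) \<partial>k_measure a b (N j))"
  using assms unfolding cond_K_def
  by (intro converges_to_probability_imp_convergent[OF eventually_prob_on_k] continuous_intros)
    (auto simp: complex_nonpos_Reals_iff)

text \<open>In the Thouless formula the integrals converge as soon as the eigenvalue measures
  do; then the average \<open>w_minus\<close> converges if and only if the geometric means of
  the off-diagonal entries converge to a positive limit. One point, here \<open>\<i>\<close>,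
  suffices to see the latter.\<close>
lemma cond_WM_iff: "cond_WM a b N \<longleftrightarrow> cond_K a b N \<and> cond_A a N"
proof
  assume WM: "cond_WM a b N"
  then have K: "cond_K a b N" by (rule cond_WM_imp_K)
  have i: "Im \<i> > 0" by simp
  have w: "convergent (\<lambda>j. w_minus a b (N j) \<i>)"
    by (rule converges_holomorphically_imp_convergent[OF converges_in_herglotz_imp_holomorphically i])
      (use WM in \<open>simp only: cond_WM_def\<close>)
  have "convergent (\<lambda>j. Re ((\<integral>t. Ln (\<i> - of_real t) \<partial>k_measure a b (N j)) - w_minus a b (N j) \<i>))"
    by (rule convergent_Re[OF convergent_diff[OF cond_K_imp_log_integrals_convergent[OF K i] w]])
  moreover have "\<forall>\<^sub>F j in sequentially. (\<Sum>n=1..N j. ln (a n)) / real (N j)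
      = Re ((\<integral>t. Ln (\<i> - of_real t) \<partial>k_measure a b (N j)) - w_minus a b (N j) \<i>)"
    using eventually_N_pos
  proof eventually_elim
    case (elim j)
    have "(\<integral>t. Ln (\<i> - of_real t) \<partial>k_measure a b (N j)) - w_minus a b (N j) \<i>
        = of_real ((\<Sum>n=1..N j. ln (a n)) / real (N j))"
      unfolding log_average_eq[OF elim i] by (simp only: diff_diff_eq2 add_diff_cancel_left')
    then show ?case by (simp only: Re_complex_of_real)
  qed
  ultimately have "cond_A a N" unfolding cond_A_iff by (rule convergent_eventually_eq[rotated])
  with K show "cond_K a b N \<and> cond_A a N" ..
next
  assume KA: "cond_K a b N \<and> cond_A a N"
  have "converges_holomorphically (\<lambda>j. w_minus a b (N j))"
  proof (rule converges_holomorphically_pointwise[OF w_minus_holomorphic])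
    show "\<exists>B. \<forall>j z w. e \<le> Im z \<longrightarrow> e \<le> Im w \<longrightarrow> cmod (w_minus a b (N j) z - w_minus a b (N j) w) \<le> B * cmod (z - w)"
      if "e > 0" for e
      using w_minus_lipschitz[OF that] by blast
    fix z assume z: "Im z > 0"
    show "convergent (\<lambda>j. w_minus a b (N j) z)"
    proof (rule convergent_eventually_eq)
      show "\<forall>\<^sub>F j in sequentially. w_minus a b (N j) z = (\<integral>t. Ln (z - of_real t) \<partial>k_measure a b (N j))
          - of_real ((\<Sum>n=1..N j. ln (a n)) / real (N j))"
        using eventually_N_pos by eventually_elim (rule log_average_eq[OF _ z])
      show "convergent (\<lambda>j. (\<integral>t. Ln (z - of_real t) \<partial>k_measure a b (N j))
          - of_real ((\<Sum>n=1..N j. ln (a n)) / real (N j)))"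
        using KA z by (intro convergent_diff cond_K_imp_log_integrals_convergent convergent_of_real_sequence)
          (auto simp: cond_A_iff)
    qed
  qed
  then show "cond_WM a b N" unfolding cond_WM_def
  proof (rule converges_in_herglotz_transfer[where c = 0 and s = 1, OF _ N])
    show "\<exists>C. \<forall>n\<ge>1. \<forall>z\<in>K. cmod (w_minus a b n z - (0 + 1 * w_minus a b n z)) \<le> C / real n" for K
      by (intro exI[of _ 0]) simp
    show "\<exists>e>0. \<forall>n\<ge>1. e \<le> Im (w_minus a b n z)" if "Im z > 0" for z
      using w_Im_lower[OF that] by blast
  qed
qed

end

end

theorem theorem3p1:
  fixes a b :: "nat \<Rightarrow> real" and M :: real and N :: "nat \<Rightarrow> nat"
    and E :: "real \<Rightarrow> (nat \<Rightarrow> complex) \<Rightarrow> (nat \<Rightarrow> complex)"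
  assumes "M > 0"
    and "a 0 = 1"
    and "\<And>n. n \<ge> 1 \<Longrightarrow> 1 / (M + 1) \<le> a n \<and> a n \<le> M + 1"
    and "\<And>n. n \<ge> 1 \<Longrightarrow> \<bar>b n\<bar> \<le> M"
    and "spectral_resolution (jacobi a b) E"
    and "filterlim N at_top sequentially"
  shows "(cond_WP a b N \<longleftrightarrow> cond_WM a b N)
    \<and> (cond_G a b N \<longleftrightarrow> cond_N E N) \<and> (cond_N E N \<longleftrightarrow> cond_K a b N)
    \<and> (cond_WP a b N \<or> cond_WM a b N \<longrightarrow>
         cond_G a b N \<and> cond_N E N \<and> cond_K a b N \<and> cond_A a N)
    \<and> (cond_A a N \<longrightarrow> cond_G a b N \<or> cond_N E N \<or> cond_K a b N \<longrightarrow>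
         cond_WP a b N \<and> cond_WM a b N)"
proof -
  interpret jacobi_coefficients a b M by unfold_locales (use assms in auto)
  have "cond_N E N \<longleftrightarrow> cond_K a b N"
    using cond_N_iff_g_avg[OF assms(6,5)] cond_K_iff_g_avg[OF assms(6)] by blast
  then show ?thesis
    using cond_WP_iff_WM[OF assms(6)] cond_K_iff_G[OF assms(6)] cond_WM_iff[OF assms(6)] by blast
qed

end
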